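(* There are unique (real) analytic functions $B_1,B_2:T\to\mathbb{R}$ and $B_3:T\to\mathbb{C}$ such that $B_1$ does not depend on the variable $t_1$ and, for all $t=(t_1,t_2,t_3)\in T$, $z\in\mathbb{H}$, $k\in\mathbb{C}^*$ and $k'\in\mathbb{C}$, $$B_1(g(z))=\mathrm{Im}(z),\qquad B_1(t_1,t_2k^{-4},t_3k^{-6})=B_1(t)|k|^2,$$ $$B_2(g(z))=0,\qquad B_2(t_1k^{-2}+k'k^{-1},\,t_2k^{-4},\,t_3k^{-6})=B_1(t)|k'|^2+B_2(t)|k^{-1}|^2+\mathrm{Im}\big(B_3(t)k'\overline{k^{-1}}\big),$$ $$B_3(g(z))=1,\qquad B_3(t_1k^{-2}+k'k^{-1},\,t_2k^{-4},\,t_3k^{-6})=B_3(t)k\overline{k^{-1}}+2\sqrt{-1}\,k\,\overline{k'}\,B_1(t).$$ Moreover, $|B_3|$ restricted to the zero locus of $B_2$ is identically one.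
   Context: $\mathbb{H}=\{z\in\mathbb{C}:\mathrm{Im}(z)>0\}$ and $T=\mathbb{C}^3\setminus\{(t_1,t_2,t_3)\in\mathbb{C}^3: 27t_3^2-t_2^3=0\}$. The map $g=(g_1,g_2,g_3):\mathbb{H}\to T\subset\mathbb{C}^3$ is given by the Eisenstein series $g_k(z)=a_k\Big(1+(-1)^k\frac{4k}{B_k}\sum_{n\ge1}\sigma_{2k-1}(n)e^{2\pi i zn}\Big)$, $k=1,2,3$, where in this formula the $B_k$ are the Bernoulli numbers $B_1=\frac16$, $B_2=\frac1{30}$, $B_3=\frac1{42}$ (not to be confused with the functions $B_1,B_2,B_3$ of the claim), $\sigma_i(n)=\sum_{d\mid n}d^i$, and $(a_1,a_2,a_3)=\big(\frac{2\pi i}{12},\,12(\frac{2\pi i}{12})^2,\,8(\frac{2\pi i}{12})^3\big)$. *)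

theory Defs
  imports "HOL-Analysis.Analysis"
begin

text \<open>
  Real analyticity in several variables: near every point of \<open>S\<close>, \<open>f\<close> is the sum of an
  (unconditionally convergent) power series in the real coordinates. A multi-index is a function
  on \<open>Basis\<close>, made extensional so that each multi-index is counted exactly once. The notion is
  meant for open \<open>S\<close>, where by shrinking \<open>r\<close> it only depends on the values of \<open>f\<close> on \<open>S\<close>.
\<close>

definition real_analytic_on ::
  "('a::euclidean_space \<Rightarrow> 'b::real_normed_vector) \<Rightarrow> 'a set \<Rightarrow> bool"
where
  "real_analytic_on f S \<longleftrightarrow>
     (\<forall>a\<in>S. \<exists>r>0. \<exists>c :: ('a \<Rightarrow> nat) \<Rightarrow> 'b. \<forall>x\<in>ball a r.
        ((\<lambda>\<alpha>. (\<Prod>b\<in>Basis. ((x - a) \<bullet> b) ^ \<alpha> b) *\<^sub>R c \<alpha>) has_sum f x)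
          (Basis \<rightarrow>\<^sub>E UNIV))"

definition T :: "(complex \<times> complex \<times> complex) set"
where
  "T = UNIV - {(t1, t2, t3). 27 * t3 ^ 2 - t2 ^ 3 = 0}"

definition divisor_sigma :: "nat \<Rightarrow> nat \<Rightarrow> nat"
where
  "divisor_sigma i n = (\<Sum>d | d dvd n. d ^ i)"

text \<open>
  \<open>eisenstein k a b\<close> is the Eisenstein series of weight \<open>2 * k\<close> with constant term \<open>a\<close>, where
  \<open>b\<close> is the \<open>k\<close>-th Bernoulli number in the convention \<open>1/6, 1/30, 1/42, \<dots>\<close> (all positive).
\<close>

definition eisenstein :: "nat \<Rightarrow> complex \<Rightarrow> complex \<Rightarrow> complex \<Rightarrow> complex"
where
  "eisenstein k a b z =
     a * (1 + (- 1) ^ k * (4 * of_nat k / b) *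
       (\<Sum>n. of_nat (divisor_sigma (2 * k - 1) (Suc n)) *
             exp (2 * of_real pi * \<i> * z * of_nat (Suc n))))"

definition g :: "complex \<Rightarrow> complex \<times> complex \<times> complex"
where
  "g z = (eisenstein 1 (2 * of_real pi * \<i> / 12) (1 / 6) z,
          eisenstein 2 (12 * (2 * of_real pi * \<i> / 12) ^ 2) (1 / 30) z,
          eisenstein 3 (8 * (2 * of_real pi * \<i> / 12) ^ 3) (1 / 42) z)"

definition B_system ::
  "(complex \<times> complex \<times> complex \<Rightarrow> real) \<Rightarrow> (complex \<times> complex \<times> complex \<Rightarrow> real) \<Rightarrow>
   (complex \<times> complex \<times> complex \<Rightarrow> complex) \<Rightarrow> bool"
where
  "B_system B1 B2 B3 \<longleftrightarrow>
     real_analytic_on B1 T \<and> real_analytic_on B2 T \<and> real_analytic_on B3 T \<and>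
     (\<forall>t1 t1' t2 t3. (t1, t2, t3) \<in> T \<and> (t1', t2, t3) \<in> T \<longrightarrow>
        B1 (t1, t2, t3) = B1 (t1', t2, t3)) \<and>
     (\<forall>z. Im z > 0 \<longrightarrow> B1 (g z) = Im z \<and> B2 (g z) = 0 \<and> B3 (g z) = 1) \<and>
     (\<forall>t1 t2 t3 k k'. (t1, t2, t3) \<in> T \<and> k \<noteq> 0 \<longrightarrow>
        B1 (t1, t2 * k powi (-4), t3 * k powi (-6)) = B1 (t1, t2, t3) * (cmod k)\<^sup>2 \<and>
        B2 (t1 * k powi (-2) + k' * inverse k, t2 * k powi (-4), t3 * k powi (-6)) =
          B1 (t1, t2, t3) * (cmod k')\<^sup>2 + B2 (t1, t2, t3) * (cmod (inverse k))\<^sup>2 +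
          Im (B3 (t1, t2, t3) * k' * cnj (inverse k)) \<and>
        B3 (t1 * k powi (-2) + k' * inverse k, t2 * k powi (-4), t3 * k powi (-6)) =
          B3 (t1, t2, t3) * k * cnj (inverse k) +
          2 * \<i> * k * cnj k' * of_real (B1 (t1, t2, t3)))"

end

(*
  A point of T is an elliptic curve y^2 = 4 (x - t1)^3 - t2 (x - t1) - t3 with a basis of differential
  forms, and g parametrises it by its periods.  Every t in T has the form g(z) acted upon by some
  k = 1/m and k', so the functional equations force
    B1 = Im z / |m|^2,  B2 = Im z |k'|^2 + Im (k' cnj m),  B3 = cnj m / m + 2 i cnj k' Im z / m.
  These do not depend on the choice of (z, m): the Weierstrass function of a lattice is the only
  solution 1/x^2 + O(x^2) of y'^2 = 4 y^3 - g2 y - g3, so equal invariants give equal lattices, and the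
  quasi-periods of the zeta function yield the matching transformation of E2.  The Weierstrass function
  is summed as a q-series, which makes E2, E4, E6 appear as its Laurent coefficients.  Existence of
  (z, m) is the surjectivity of J, whose image is open and, by reduction to the fundamental domain,
  closed.  Real analyticity: the rigidity above makes G3 / G2^(3/2) (or G2 / G3^(2/3) where G2 vanishes)
  locally injective, so z and m can be chosen holomorphically in t.
*)
theory Submission
  imports Defs "HOL-Complex_Analysis.Complex_Analysis"
begin

section \<open>Lambert series\<close>

text \<open>The difficulty is that \<open>t\<close> does not determine \<open>(z, m)\<close>: each
  integer matrix of determinant 1 yields another choice, and \<open>B2\<close> and \<open>B3\<close>
  also involve \<open>G1\<close>, which is only quasi-modular. Its defect \<open>c * m * n\<close>
  is exactly what the terms with Im z compensate.

  Double series over the lattice are avoided. Summing over the period 2 \<pi> i beforehand leaves a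
  sum with geometric decay in q, where adding the other period is a shift of the index. Thus E2
  never occurs as a conditionally convergent lattice sum: it is the constant that cancels the
  constant Laurent term of \<open>wp\<close>. The primitive taken without this constant has
  increments 0 and 1 along the two basic periods, so the anomaly of E2 can be read off from a single
  translation.

  The claim about the zero locus of \<open>B2\<close> comes from an identity valid on all of
  \<open>T\<close>: the squared modulus of \<open>B3\<close> is 1 + 4 \<open>B1\<close>
  \<open>B2\<close>.\<close>

lemmas abs_summable_comparison = Infinite_Sum.abs_summable_on_comparison_test'

definition sigma_series :: "nat \<Rightarrow> complex \<Rightarrow> complex" where
  "sigma_series k q = (\<Sum>n. of_nat (divisor_sigma k (Suc n)) * q ^ Suc n)"

text \<open>The Koebe function, the sum of n u^n. At u = exp x it is 1 / (4 sinh(x/2)^2), which is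
  the sum of 1 / (x + 2 \<pi> i n)^2 over all integers n: one row of lattice poles.\<close>

definition koebe :: "complex \<Rightarrow> complex" where
  "koebe u = u / (1 - u)\<^sup>2"

lemma summable_power_geometric:
  fixes \<rho> :: real
  assumes "0 \<le> \<rho>" "\<rho> < 1"
  shows "summable (\<lambda>m. real m ^ k * \<rho> ^ m)"
  using assms
proof (induction k arbitrary: \<rho>)
  case 0
  then show ?case by simp
next
  case (Suc k)
  \<comment> \<open>Writing \<rho> = s^2 splits the decay: one s^n keeps the additional factor n
    bounded, the other s^n is left to the induction hypothesis, which therefore has to cover all
    bases.\<close>
  define s where "s = sqrt \<rho>"
  have s: "0 \<le> s" "s < 1" "s ^ 2 = \<rho>"
    using Suc.prems by (auto simp: s_def)
  have "(\<lambda>n. real n * s ^ n) \<longlonglongrightarrow> 0"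
    using powser_times_n_limit_0[of s] s by auto
  then obtain C where C: "\<And>n. norm (real n * s ^ n) \<le> C"
    by (metis convergentI convergent_imp_Bseq BseqE)
  have "summable (\<lambda>m. C * (real m ^ k * s ^ m))"
    using Suc.IH[of s] s by (intro summable_mult) auto
  then show ?case
  proof (rule summable_comparison_test'[where N=0])
    fix n :: nat
    have "norm (real n ^ Suc k * \<rho> ^ n) = norm (real n * s ^ n) * (real n ^ k * s ^ n)"
      using s(1) by (simp add: s(3)[symmetric] power_mult[symmetric] power2_eq_square
          power_mult_distrib abs_mult mult_ac)
    also have "\<dots> \<le> C * (real n ^ k * s ^ n)"
      using C s(1) by (intro mult_right_mono) auto
    finally show "norm (real n ^ Suc k * \<rho> ^ n) \<le> C * (real n ^ k * s ^ n)" .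
  qed
qed

lemma summable_double_geometric:
  fixes a \<rho> :: real
  assumes "0 \<le> a" "a < 1" "0 \<le> \<rho>" "\<rho> < 1"
  shows "(\<lambda>(n,m). a ^ n * (real (Suc m) ^ k * \<rho> ^ Suc m)) summable_on UNIV \<times> UNIV"
proof -
  have sm: "summable (\<lambda>m. real (Suc m) ^ k * \<rho> ^ Suc m)"
    using summable_power_geometric[of \<rho> k] assms by (subst summable_Suc_iff)
  then obtain S where S: "((\<lambda>m. real (Suc m) ^ k * \<rho> ^ Suc m) has_sum S) UNIV"
    using norm_summable_imp_has_sum[of "\<lambda>m. real (Suc m) ^ k * \<rho> ^ Suc m"] assms
    by (auto simp: summable_def)
  have "(\<lambda>n. a ^ n * S) summable_on UNIV"
    using assms by (intro norm_summable_imp_summable_on)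
      (auto simp: abs_mult power_abs intro!: summable_mult2 summable_geometric)
  with S show ?thesis
    using assms by (intro summable_on_SigmaI[where g = "\<lambda>n. a ^ n * S"]) (auto intro!: has_sum_cmult_right)
qed

lemma power_Suc_times_Suc_le:
  fixes a :: real
  assumes "0 \<le> a" "a \<le> 1"
  shows "a ^ (Suc n * Suc m) \<le> a ^ n * a ^ Suc m"
  unfolding power_add[symmetric] by (intro power_decreasing) (use assms in auto)

text \<open>Group the pairs by the product N = (n+1)(m+1): the second factors run through the
  divisors of N, so the fibre over N contributes \<sigma>_k(N) q^N. Indices start at 0 and stand for
  the positive integers \<open>Suc n\<close>, \<open>Suc m\<close>.\<close>

lemma lambert_has_sum:
  assumes "norm q < 1"
  shows "((\<lambda>(n,m). of_nat (Suc m) ^ k * q ^ (Suc n * Suc m)) has_sum sigma_series k q) (UNIV \<times> UNIV)"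
    (is "(?F has_sum _) _")
proof -
  have "(\<lambda>p. norm (?F p)) summable_on UNIV \<times> UNIV"
  proof (rule abs_summable_comparison)
    show "(\<lambda>(n,m). norm q ^ n * (real (Suc m) ^ k * norm q ^ Suc m)) summable_on UNIV \<times> UNIV"
      using assms by (intro summable_double_geometric) auto
    fix p :: "nat \<times> nat"
    obtain n m where p: "p = (n,m)" by force
    have "norm (?F p) = real (Suc m) ^ k * norm q ^ (Suc n * Suc m)"
      unfolding p by (simp only: case_prod_conv norm_mult norm_power norm_of_nat)
    also have "\<dots> \<le> real (Suc m) ^ k * (norm q ^ n * norm q ^ Suc m)"
      using assms by (intro mult_left_mono power_Suc_times_Suc_le) auto
    finally show "norm (?F p) \<le> (case p of (n,m) \<Rightarrow> norm q ^ n * (real (Suc m) ^ k * norm q ^ Suc m))"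
      by (simp add: p mult_ac)
  qed
  then have "?F summable_on UNIV \<times> UNIV"
    by (rule abs_summable_summable)
  then obtain s where s: "(?F has_sum s) (UNIV \<times> UNIV)"
    by (auto simp: summable_on_def)
  have "((\<lambda>(N,d). of_nat d ^ k * q ^ Suc N) has_sum s) (Sigma UNIV (\<lambda>N. {d. d dvd Suc N}))"
  proof (subst has_sum_reindex_bij_witness[where j = "\<lambda>(N,d). (Suc N div d - 1, d - 1)"
        and i = "\<lambda>(n,m). (Suc n * Suc m - 1, Suc m)" and T = "UNIV \<times> UNIV" and h = ?F and s' = s])
    fix p :: "nat \<times> nat"
    assume "p \<in> Sigma UNIV (\<lambda>N. {d. d dvd Suc N})"
    then obtain N d e where p: "p = (N,d)" "Suc N = d * e" by (auto elim!: dvdE)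
    then obtain d' e' where de: "d = Suc d'" "e = Suc e'"
      by (metis mult_0 mult_0_right nat.distinct(1) not0_implies_Suc)
    have N: "N = Suc e' * Suc d' - 1" using p de by simp
    have div: "Suc N div d = Suc e'" using p(2) de by (metis nat.distinct(1) nonzero_mult_div_cancel_left)
    show "(case case p of (N, d) \<Rightarrow> (Suc N div d - 1, d - 1) of
            (n, m) \<Rightarrow> (Suc n * Suc m - 1, Suc m)) = p"
      unfolding p(1) case_prod_conv div using N de by simp
    show "?F (case p of (N, d) \<Rightarrow> (Suc N div d - 1, d - 1)) = (case p of (N,d) \<Rightarrow> of_nat d ^ k * q ^ Suc N)"
      unfolding p(1) case_prod_conv div using p(2) de by (simp add: mult.commute)
  next
    fix p :: "nat \<times> nat"
    show "(case case p of (n, m) \<Rightarrow> (Suc n * Suc m - 1, Suc m) of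
            (N, d) \<Rightarrow> (Suc N div d - 1, d - 1)) = p"
    proof (cases p)
      case (Pair n m)
      have "Suc (Suc n * Suc m - 1) = Suc n * Suc m" by simp
      then have "Suc (Suc n * Suc m - 1) div Suc m = Suc n"
        by (metis nat.distinct(1) nonzero_mult_div_cancel_right)
      then show ?thesis unfolding Pair case_prod_conv by simp
    qed
    have "Suc (Suc n * Suc m - 1) = Suc n * Suc m" for n m by simp
    then show "(case p of (n, m) \<Rightarrow> (Suc n * Suc m - 1, Suc m)) \<in> Sigma UNIV (\<lambda>N. {d. d dvd Suc N})"
      unfolding case_prod_unfold by (simp only: mem_Sigma_iff mem_Collect_eq dvd_triv_right UNIV_I simp_thms)
  qed (use s in auto)
  then have "((\<lambda>N. \<Sum>d | d dvd Suc N. of_nat d ^ k * q ^ Suc N) has_sum s) UNIV"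
    by (rule has_sum_SigmaD) (auto intro!: has_sum_finiteI)
  then have "(\<lambda>N. \<Sum>d | d dvd Suc N. of_nat d ^ k * q ^ Suc N) sums s"
    by (rule has_sum_imp_sums)
  then have "sigma_series k q = s"
    unfolding sigma_series_def divisor_sigma_def
    by (simp add: sums_iff sum_distrib_right)
  with s show ?thesis by simp
qed

lemma koebe_sums:
  assumes "norm u < 1"
  shows "((\<lambda>m. of_nat (Suc m) * u ^ Suc m) has_sum koebe u) UNIV"
proof (rule norm_summable_imp_has_sum)
  show "summable (\<lambda>m. norm (of_nat (Suc m) * u ^ Suc m))"
    using summable_power_geometric[of "norm u" 1] assms
    by (simp add: norm_mult norm_power del: power_Suc of_nat_Suc) (subst summable_Suc_iff, simp)
  show "(\<lambda>m. of_nat (Suc m) * u ^ Suc m) sums koebe u"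
    using sums_mult[OF geometric_deriv_sums[OF assms], of u]
    by (simp add: koebe_def mult_ac)
qed

lemma exp_has_sum:
  "((\<lambda>k. z ^ k / fact k) has_sum exp z) UNIV" for z :: complex
proof (rule norm_summable_imp_has_sum)
  show "summable (\<lambda>k. norm (z ^ k / fact k))"
    using summable_norm_exp[of z] by (simp add: scaleR_conv_of_real field_simps norm_mult norm_divide)
  show "(\<lambda>k. z ^ k / fact k) sums exp z"
    using exp_converges[of z] by (simp add: scaleR_conv_of_real field_simps)
qed

text \<open>The rows other than the central one in the sum of koebe (q^n exp x) over all integers n;
  negative n are folded into the second summand by koebe (1/u) = koebe u, which avoids negative
  powers of q.\<close>

definition koebe_tail :: "complex \<Rightarrow> complex \<Rightarrow> complex" where
  "koebe_tail q x = (\<Sum>n. koebe (q ^ Suc n * exp x) + koebe (q ^ Suc n * exp (- x)))"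

text \<open>Expanding \<open>koebe\<close> in powers of u and then each exponential in powers of x
  gives a sum over (k, n, m). Summing over k inside returns the tail, summing over (n, m) inside
  gives Lambert series. The bound on \<open>norm q * exp r\<close> makes the triple sum absolutely
  convergent; the factor 1 + (-1)^k comes from adding the values at x and -x.\<close>

lemma koebe_tail_expansion:
  assumes r: "norm q * exp r < 1" and x: "norm x \<le> r"
  shows "(\<lambda>k. (1 + (-1) ^ k) / fact k * sigma_series (Suc k) q * x ^ k) sums koebe_tail q x"
proof -
  have r0: "0 \<le> r" using x norm_ge_zero[of x] by linarith
  have q1: "norm q < 1"
    using r mult_left_mono[of 1 "exp r" "norm q"] r0 by simp
  define F :: "nat \<times> (nat \<times> nat) \<Rightarrow> complex" where
    "F = (\<lambda>(k,(n,m)). (1 + (-1) ^ k) / fact k * x ^ k * (of_nat (Suc m) ^ Suc k * q ^ (Suc n * Suc m)))"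
  define G :: "nat \<times> nat \<Rightarrow> nat \<Rightarrow> real" where
    "G = (\<lambda>(n,m) k. 2 * real (Suc m) * norm q ^ (Suc n * Suc m) * ((real (Suc m) * r) ^ k / fact k))"
  have G: "(\<lambda>(p,k). G p k) summable_on UNIV \<times> UNIV"
  proof (rule summable_on_SigmaI)
    let ?g = "\<lambda>(n,m). 2 * real (Suc m) * norm q ^ (Suc n * Suc m) * exp (real (Suc m) * r)"
    fix p :: "nat \<times> nat"
    obtain n m where p: "p = (n,m)" by force
    have "((\<lambda>k. (real (Suc m) * r) ^ k / fact k) has_sum exp (real (Suc m) * r)) UNIV"
    proof (rule norm_summable_imp_has_sum)
      show "summable (\<lambda>k. norm ((real (Suc m) * r) ^ k / fact k))"
        using summable_norm_exp[of "real (Suc m) * r"] by (simp add: field_simps)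
      show "(\<lambda>k. (real (Suc m) * r) ^ k / fact k) sums exp (real (Suc m) * r)"
        using exp_converges[of "real (Suc m) * r"] by (simp add: field_simps)
    qed
    then show "((\<lambda>k. case (p,k) of (p,k) \<Rightarrow> G p k) has_sum ?g p) UNIV"
      unfolding G_def p case_prod_conv by (rule has_sum_cmult_right)
    show "\<And>k. 0 \<le> (case (p,k) of (p,k) \<Rightarrow> G p k)"
      unfolding G_def p using r0 by auto
  next
    let ?g = "\<lambda>(n,m). 2 * real (Suc m) * norm q ^ (Suc n * Suc m) * exp (real (Suc m) * r)"
    have "(\<lambda>p. 2 * (case p of (n,m) \<Rightarrow> norm q ^ n * (real (Suc m) ^ 1 * (norm q * exp r) ^ Suc m)))
            summable_on UNIV \<times> UNIV"
      using r q1 by (intro summable_on_cmult_right summable_double_geometric) auto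
    moreover have "norm (?g p) \<le> 2 * (case p of (n,m) \<Rightarrow> norm q ^ n * (real (Suc m) ^ 1 * (norm q * exp r) ^ Suc m))" for p
    proof -
      obtain n m where p: "p = (n,m)" by force
      have "norm (?g p) = 2 * real (Suc m) * norm q ^ (Suc n * Suc m) * exp (real (Suc m) * r)"
        by (simp add: p abs_mult)
      also have "\<dots> \<le> 2 * real (Suc m) * (norm q ^ n * norm q ^ Suc m) * exp (real (Suc m) * r)"
        using q1 by (intro mult_right_mono mult_left_mono power_Suc_times_Suc_le) auto
      also have "\<dots> = 2 * (norm q ^ n * (real (Suc m) ^ 1 * (norm q * exp r) ^ Suc m))"
        by (simp add: power_mult_distrib exp_of_nat_mult del: power_Suc of_nat_Suc)
      finally show ?thesis by (simp add: p)
    qed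
    ultimately have "(\<lambda>p. norm (?g p)) summable_on UNIV \<times> UNIV"
      by (intro abs_summable_comparison) auto
    then show "?g summable_on UNIV"
      using abs_summable_summable by force
  qed
  have F_le: "norm (F (k, p)) \<le> G p k" for k p
  proof -
    obtain n m where p: "p = (n,m)" by force
    have "norm (1 + (-1) ^ k :: complex) \<le> 2"
      using norm_triangle_ineq[of 1 "(-1) ^ k :: complex"] by (simp add: norm_power)
    then have "norm (F (k, p)) \<le> 2 / fact k * r ^ k * (real (Suc m) ^ Suc k * norm q ^ (Suc n * Suc m))"
      unfolding F_def p case_prod_conv norm_mult norm_divide norm_power norm_of_nat norm_fact
      using x r0 by (intro mult_mono divide_right_mono power_mono) auto
    then show ?thesis
      by (simp add: G_def p power_mult_distrib mult_ac del: of_nat_Suc mult_Suc mult_Suc_right)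
  qed
  have swap: "(\<lambda>t. norm (case t of (p,k) \<Rightarrow> F (k,p))) summable_on UNIV \<times> UNIV"
    by (rule abs_summable_comparison[OF G]) (auto simp: F_le)
  then have "(\<lambda>(p,k). F (k,p)) summable_on UNIV \<times> UNIV"
    by (rule abs_summable_summable)
  then obtain s where s: "((\<lambda>(p,k). F (k,p)) has_sum s) (UNIV \<times> UNIV)"
    by (auto simp: summable_on_def)
  then have s': "(F has_sum s) (UNIV \<times> UNIV)"
    by (subst has_sum_swap) (simp add: case_prod_unfold)
  have "((\<lambda>k. (1 + (-1) ^ k) / fact k * x ^ k * sigma_series (Suc k) q) has_sum s) UNIV"
    using s'
  proof (rule has_sum_SigmaD)
    fix k :: nat
    show "((\<lambda>p. F (k, p)) has_sum (1 + (-1) ^ k) / fact k * x ^ k * sigma_series (Suc k) q) UNIV"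
      using has_sum_cmult_right[OF lambert_has_sum[OF q1, of "Suc k"], of "(1 + (-1) ^ k) / fact k * x ^ k"]
      by (simp add: F_def case_prod_unfold)
  qed
  then have 1: "(\<lambda>k. (1 + (-1) ^ k) / fact k * x ^ k * sigma_series (Suc k) q) sums s"
    by (rule has_sum_imp_sums)
  have u: "norm (q ^ Suc n * exp y) < 1" if "norm y \<le> r" for n y
  proof -
    have "norm (q ^ Suc n * exp y) \<le> norm q ^ Suc n * exp r"
      using that norm_exp[of y] by (auto simp: norm_mult norm_power intro!: mult_left_mono order_trans[OF norm_exp])
    also have "\<dots> \<le> norm q ^ 1 * exp r"
      using q1 by (intro mult_right_mono power_decreasing) auto
    finally show ?thesis using r by simp
  qed
  let ?H = "\<lambda>(n,m). of_nat (Suc m) * (q ^ Suc n * exp x) ^ Suc m + of_nat (Suc m) * (q ^ Suc n * exp (-x)) ^ Suc m"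
  have "(?H has_sum s) (UNIV \<times> UNIV)"
  proof (rule has_sum_SigmaD[where f = "\<lambda>(p,k). F (k,p)" and B = "\<lambda>_. UNIV"])
    fix p :: "nat \<times> nat"
    obtain n m where p: "p = (n,m)" by force
    let ?e = "of_nat (Suc m) * x" and ?c = "of_nat (Suc m) * q ^ (Suc n * Suc m)"
    have "((\<lambda>k. ?c * (?e ^ k / fact k + (- ?e) ^ k / fact k)) has_sum ?c * (exp ?e + exp (- ?e))) UNIV"
      by (intro has_sum_cmult_right has_sum_add exp_has_sum)
    also have "(\<lambda>k. ?c * (?e ^ k / fact k + (- ?e) ^ k / fact k)) = (\<lambda>k. F (k, p))"
      unfolding power_minus[of ?e]
      by (auto simp: F_def p fun_eq_iff power_mult_distrib field_simps simp del: of_nat_Suc)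
    also have "?c * (exp ?e + exp (- ?e)) = ?H p"
    proof -
      have "exp (of_nat (Suc m) * x) = exp x ^ Suc m" "exp (- (of_nat (Suc m) * x)) = exp (- x) ^ Suc m"
        using exp_of_nat_mult[of "Suc m" x] exp_of_nat_mult[of "Suc m" "-x"] by simp_all
      then show ?thesis
        unfolding p case_prod_conv power_mult_distrib power_mult by (simp add: distrib_left mult_ac)
    qed
    finally show "((\<lambda>k. case (p, k) of (p, k) \<Rightarrow> F (k, p)) has_sum ?H p) UNIV"
      by simp
  qed (use s in simp)
  then have "((\<lambda>n. koebe (q ^ Suc n * exp x) + koebe (q ^ Suc n * exp (- x))) has_sum s) UNIV"
    by (rule has_sum_SigmaD) (unfold case_prod_conv, intro has_sum_add koebe_sums u, use x in auto)
  then have "koebe_tail q x = s"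
    unfolding koebe_tail_def by (intro sums_unique[symmetric] has_sum_imp_sums)
  with 1 show ?thesis by (simp add: mult_ac)
qed

section \<open>The Weierstrass functions as q-series\<close>

text \<open>Taylor expansion with a holomorphic remainder. It lets Laurent expansions be handled as
  identities between finitely many terms, and a remainder stays differentiable.\<close>

lemma power_series_tail_holomorphic:
  fixes f :: "complex \<Rightarrow> complex"
  assumes "r > 0" and f: "\<And>x. x \<in> ball 0 r \<Longrightarrow> (\<lambda>k. a k * x ^ k) sums f x"
  obtains C where "C holomorphic_on ball 0 r"
    "\<And>x. x \<in> ball 0 r \<Longrightarrow> f x = (\<Sum>k<n. a k * x ^ k) + x ^ n * C x"
proof
  define C where "C x = (\<Sum>k. a (k + n) * x ^ k)" for x
  have C: "(\<lambda>k. a (k + n) * x ^ k) sums C x" if "x \<in> ball 0 r" for x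
  proof (cases "x = 0")
    case True
    have "(\<lambda>k. a (k + n) * 0 ^ k) sums a n"
      using powser_sums_zero[of "\<lambda>k. a (k + n)"] by simp
    then show ?thesis unfolding C_def True by (simp add: sums_iff)
  next
    case False
    have "summable (\<lambda>k. a (k + n) * x ^ (k + n))"
      using f[OF that] by (subst summable_iff_shift) (auto simp: summable_def)
    then have "summable (\<lambda>k. (1 / x ^ n) * (a (k + n) * x ^ (k + n)))"
      by (intro summable_mult)
    also have "(\<lambda>k. (1 / x ^ n) * (a (k + n) * x ^ (k + n))) = (\<lambda>k. a (k + n) * x ^ k)"
      using False by (auto simp: power_add)
    finally show ?thesis unfolding C_def by (rule summable_sums)
  qed
  show "C holomorphic_on ball 0 r"
    by (rule power_series_holomorphic[where a = "\<lambda>k. a (k + n)"]) (use C in auto)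
  fix x :: complex assume x: "x \<in> ball 0 r"
  have "(\<lambda>k. a (k + n) * x ^ (k + n)) sums (x ^ n * C x)"
    using sums_mult[OF C[OF x], of "x ^ n"] by (simp add: power_add mult_ac)
  then have "(\<lambda>k. a k * x ^ k) sums (x ^ n * C x + (\<Sum>k<n. a k * x ^ k))"
    by (subst (asm) sums_iff_shift)
  with f[OF x] show "f x = (\<Sum>k<n. a k * x ^ k) + x ^ n * C x"
    using sums_unique2 by fastforce
qed

lemma koebe_exp: "koebe (exp x) = 1 / (exp x + exp (- x) - 2)"
proof -
  have "exp x * exp (-x) = 1" by (simp flip: exp_add)
  then have "(1 - exp x)\<^sup>2 = exp x * (exp x + exp (- x) - 2)"
    by (simp add: power2_eq_square algebra_simps)
  then show ?thesis by (simp add: koebe_def)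
qed

lemma koebe_exp_expansion:
  obtains r C where "r > 0" "C holomorphic_on ball 0 r"
    "\<And>x. x \<in> ball 0 r \<Longrightarrow> x \<noteq> 0 \<Longrightarrow>
       koebe (exp x) = 1 / x\<^sup>2 - 1 / 12 + x\<^sup>2 / 240 - x ^ 4 / 6048 + x ^ 6 * C x"
proof -
  have s: "(\<lambda>k. (1 + (-1) ^ k) / fact k * x ^ k) sums (exp x + exp (- x))" for x :: complex
  proof -
    have "(\<lambda>k. x ^ k / fact k + (- x) ^ k / fact k) sums (exp x + exp (- x))"
      by (intro sums_add has_sum_imp_sums exp_has_sum)
    then show ?thesis
      unfolding power_minus[of x] by (simp add: field_simps)
  qed
  \<comment> \<open>Order 10 is dictated by the desired remainder x^6: one factor x^2 is lost in
    forming \<open>K\<close>, another in the final division by x^2. The coefficients 1/12, 1/360,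
    1/20160 of \<open>K\<close> are 2/4!, 2/6!, 2/8!.\<close>
  obtain R where R: "R holomorphic_on ball 0 1"
    "\<And>x. x \<in> ball 0 1 \<Longrightarrow> exp x + exp (- x) = (\<Sum>k<10. (1 + (-1) ^ k) / fact k * x ^ k) + x ^ 10 * R x"
    by (rule power_series_tail_holomorphic[OF zero_less_one s, of 10]) (rule that, assumption, blast)
  define K where "K x = 1 + x\<^sup>2 / 12 + x ^ 4 / 360 + x ^ 6 / 20160 + x ^ 8 * R x" for x
  have K: "exp x + exp (- x) - 2 = x\<^sup>2 * K x" if "x \<in> ball 0 1" for x
  proof -
    have "(\<Sum>k<10. (1 + (-1) ^ k) / fact k * x ^ k) =
        2 + x\<^sup>2 + x ^ 4 / 12 + x ^ 6 / 360 + x ^ 8 / 20160"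
      by (simp add: lessThan_nat_numeral lessThan_Suc fact_numeral)
    then show ?thesis
      unfolding R(2)[OF that] K_def by (simp add: algebra_simps flip: power_add)
  qed
  have holK: "K holomorphic_on ball 0 1"
    unfolding K_def by (intro holomorphic_intros R) auto
  have "isCont K 0"
    using holomorphic_on_imp_continuous_on[OF holK] by (simp add: continuous_on_eq_continuous_at)
  moreover have "K 0 = 1" by (simp add: K_def)
  ultimately have "\<forall>\<^sub>F x in at 0. K x \<noteq> 0"
    unfolding isCont_def by (metis one_neq_zero tendsto_imp_eventually_ne)
  then obtain e where e: "e > 0" "\<And>x. x \<noteq> 0 \<Longrightarrow> dist x 0 < e \<Longrightarrow> K x \<noteq> 0"
    unfolding eventually_at by auto
  define r where "r = min 1 e"
  have nz: "K x \<noteq> 0" if "x \<in> ball 0 r" for x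
    using e(2)[of x] that \<open>K 0 = 1\<close> by (cases "x = 0") (auto simp: r_def)
  \<comment> \<open>\<open>p\<close> is the reciprocal power series of \<open>K\<close> cut off
    after x^6, and \<open>Q\<close> is 1 - K p divided by x^8. Hence 1 / K = p + x^8 Q / K.\<close>
  define p where "p x = 1 - x\<^sup>2 / 12 + x ^ 4 / 240 - x ^ 6 / 6048" for x :: complex
  define Q where "Q x = - R x * p x - (1 / (360 * 240) - 1 / (12 * 6048) - 1 / (12 * 20160))
      - (1 / (20160 * 240) - 1 / (360 * 6048)) * x\<^sup>2 + x ^ 4 / (20160 * 6048)" for x
  define C where "C x = Q x / K x" for x
  have KQ: "K x * p x + x ^ 8 * Q x = 1" for x
  proof -
    define X S where "X = x\<^sup>2" and "S = R x"
    have X: "x ^ 4 = X ^ 2" "x ^ 6 = X ^ 3" "x ^ 8 = X ^ 4"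
      by (simp_all add: X_def flip: power_mult)
    have poly: "(1 + X / 12 + X ^ 2 / 360 + X ^ 3 / 20160) * (1 - X / 12 + X ^ 2 / 240 - X ^ 3 / 6048) =
        1 + X ^ 4 * ((1 / (360 * 240) - 1 / (12 * 6048) - 1 / (12 * 20160))
          + (1 / (20160 * 240) - 1 / (360 * 6048)) * X - X ^ 2 / (20160 * 6048))"
      by (simp add: algebra_simps power2_eq_square power3_eq_cube power4_eq_xxxx)
    have ring: "a * p = 1 + Y * (A + B - D) \<Longrightarrow> (a + Y * S) * p + Y * (- S * p - A - B + D) = 1"
      for a p Y A B D :: complex
      by (simp add: algebra_simps)
    show ?thesis
      unfolding K_def Q_def p_def X S_def[symmetric] X_def[symmetric] by (rule ring[OF poly])
  qed
  show thesis
  proof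
    show "r > 0" using e by (simp add: r_def)
    have "R holomorphic_on ball 0 r" "K holomorphic_on ball 0 r"
      using R(1) holK by (auto intro: holomorphic_on_subset simp: r_def)
    then show "C holomorphic_on ball 0 r"
      unfolding C_def Q_def p_def using nz by (intro holomorphic_intros) auto
    fix x :: complex assume x: "x \<in> ball 0 r" "x \<noteq> 0"
    have "p x + x ^ 8 * C x = 1 / K x"
      using KQ[of x] nz[OF x(1)] by (simp add: C_def field_simps)
    then have "koebe (exp x) = (p x + x ^ 8 * C x) / x\<^sup>2"
      using K[of x] x by (simp add: koebe_exp r_def)
    also have "\<dots> = 1 / x\<^sup>2 - 1 / 12 + x\<^sup>2 / 240 - x ^ 4 / 6048 + x ^ 6 * C x"
      using x(2) by (simp add: p_def eval_nat_numeral field_simps)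
    finally show "koebe (exp x) = 1 / x\<^sup>2 - 1 / 12 + x\<^sup>2 / 240 - x ^ 4 / 6048 + x ^ 6 * C x" .
  qed
qed

definition E2 :: "complex \<Rightarrow> complex" where "E2 q = 1 - 24 * sigma_series 1 q"
definition E4 :: "complex \<Rightarrow> complex" where "E4 q = 1 + 240 * sigma_series 3 q"
definition E6 :: "complex \<Rightarrow> complex" where "E6 q = 1 - 504 * sigma_series 5 q"

text \<open>The Weierstrass function of the lattice \<open>2\<pi>i(\<int> + z\<int>)\<close> with \<open>q = exp (2\<pi>iz)\<close>,
  summed first in the direction of the period \<open>2\<pi>i\<close>.\<close>

definition wp :: "complex \<Rightarrow> complex \<Rightarrow> complex" where
  "wp q x = koebe (exp x) + koebe_tail q x + E2 q / 12"

lemma wp_expansion: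
  assumes "norm q < 1"
  obtains r C where "r > 0" "C holomorphic_on ball 0 r"
    "\<And>x. x \<in> ball 0 r \<Longrightarrow> x \<noteq> 0 \<Longrightarrow>
       wp q x = 1 / x\<^sup>2 + E4 q / 240 * x\<^sup>2 - E6 q / 6048 * x ^ 4 + x ^ 6 * C x"
proof -
  obtain r1 C1 where 1: "r1 > 0" "C1 holomorphic_on ball 0 r1"
    "\<And>x. x \<in> ball 0 r1 \<Longrightarrow> x \<noteq> 0 \<Longrightarrow>
       koebe (exp x) = 1 / x\<^sup>2 - 1 / 12 + x\<^sup>2 / 240 - x ^ 4 / 6048 + x ^ 6 * C1 x"
    using koebe_exp_expansion by blast
  have "isCont (\<lambda>r::real. norm q * exp r) 0" by (intro continuous_intros)
  then have "\<forall>\<^sub>F r in at_right 0. norm q * exp r < 1"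
    using assms unfolding isCont_def
    by (intro order_tendstoD(2)[of _ "norm q"]) (auto intro: filterlim_at_split[THEN iffD1, THEN conjunct2])
  then have "\<forall>\<^sub>F r in at_right 0. norm q * exp r < 1 \<and> r > (0::real)"
    by (intro eventually_conj) (auto simp: eventually_at_right_less)
  then obtain r2 where r2: "r2 > 0" "norm q * exp r2 < 1"
    using eventually_happens trivial_limit_at_right_real by blast
  obtain C2 where 2: "C2 holomorphic_on ball 0 r2"
    "\<And>x. x \<in> ball 0 r2 \<Longrightarrow>
      koebe_tail q x = (\<Sum>k<6. (1 + (-1) ^ k) / fact k * sigma_series (Suc k) q * x ^ k) + x ^ 6 * C2 x"
    by (rule power_series_tail_holomorphic[OF r2(1) koebe_tail_expansion[OF r2(2)], of 6])
      (simp, rule that, assumption, blast)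
  show thesis
  proof
    show "min r1 r2 > 0" using 1 r2 by simp
    show "(\<lambda>x. C1 x + C2 x) holomorphic_on ball 0 (min r1 r2)"
      using 1 2 by (intro holomorphic_intros) (auto intro: holomorphic_on_subset)
    fix x :: complex assume "x \<in> ball 0 (min r1 r2)" "x \<noteq> 0"
    moreover have "(\<Sum>k<6. (1 + (-1) ^ k) / fact k * sigma_series (Suc k) q * x ^ k) =
        2 * sigma_series 1 q + sigma_series 3 q * x\<^sup>2 + sigma_series 5 q * x ^ 4 / 12"
      by (simp add: lessThan_nat_numeral lessThan_Suc fact_numeral)
    ultimately show "wp q x = 1 / x\<^sup>2 + E4 q / 240 * x\<^sup>2 - E6 q / 6048 * x ^ 4 + x ^ 6 * (C1 x + C2 x)"
      unfolding wp_def using 1(3)[of x] 2(2)[of x]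
      by (simp add: E2_def E4_def E6_def algebra_simps add_divide_distrib diff_divide_distrib)
  qed
qed

section \<open>The zeta function: convergence, poles and quasi-periods\<close>

definition geom :: "complex \<Rightarrow> complex" where "geom u = u / (1 - u)"

text \<open>Termwise primitive of \<open>wp\<close> without the constant \<open>E2 q / 12\<close>.
  It is the Weierstrass zeta function with reversed sign, corrected by a linear term that makes it
  periodic under 2 \<pi> i.\<close>

definition wzeta :: "complex \<Rightarrow> complex \<Rightarrow> complex" where
  "wzeta q x = 1 / (1 - exp x) + (\<Sum>n. geom (q ^ Suc n * exp x) - geom (q ^ Suc n * exp (- x)))"

text \<open>The zeros of the denominators, written without a period ratio so that q = 0 is included:
  there 0^0 = 1 leaves just the multiples of 2 \<pi> i.\<close>

definition poles :: "complex \<Rightarrow> complex set" where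
  "poles q = {x. \<exists>n. q ^ n * exp x = 1 \<or> q ^ n * exp (- x) = 1}"

lemma norm_geom_le: "norm u \<le> 1 / 2 \<Longrightarrow> norm (geom u) \<le> 2 * norm u"
proof -
  assume "norm u \<le> 1 / 2"
  then have "1 / 2 \<le> norm (1 - u)"
    using norm_triangle_ineq2[of 1 u] by simp
  then have "norm u / norm (1 - u) \<le> norm u / (1 / 2)"
    by (intro divide_left_mono) (auto intro!: mult_pos_pos)
  then show ?thesis by (simp add: geom_def norm_divide)
qed

lemma norm_koebe_le: "norm u \<le> 1 / 2 \<Longrightarrow> norm (koebe u) \<le> 4 * norm u"
proof -
  assume "norm u \<le> 1 / 2"
  then have "1 / 2 \<le> norm (1 - u)"
    using norm_triangle_ineq2[of 1 u] by simp
  then have "(1 / 2)\<^sup>2 \<le> norm (1 - u) ^ 2"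
    by (intro power_mono) auto
  then have "norm u / norm (1 - u) ^ 2 \<le> norm u / (1 / 2)\<^sup>2"
    by (intro divide_left_mono) (auto intro!: mult_pos_pos simp: power2_eq_square)
  then show ?thesis by (simp add: koebe_def norm_divide norm_power field_simps)
qed

text \<open>On a bounded set all but finitely many arguments have modulus at most 1/2, where
  \<open>geom\<close> and \<open>koebe\<close> are bounded by a multiple of their argument. So the
  tails converge uniformly there, and only finitely many n can produce poles.\<close>

lemma eventually_small:
  fixes q :: complex
  assumes "norm q < 1"
  obtains N where "\<And>n y. n \<ge> N \<Longrightarrow> norm y \<le> R \<Longrightarrow> norm (q ^ n * exp y) \<le> 1 / 2"
proof -
  have "(\<lambda>n. norm q ^ n * exp R) \<longlonglongrightarrow> 0 * exp R"
    by (intro tendsto_mult LIMSEQ_realpow_zero tendsto_const) (use assms in auto)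
  then have "\<forall>\<^sub>F n in sequentially. norm q ^ n * exp R < 1 / 2"
    by (rule order_tendstoD(2)) auto
  then obtain N where N: "\<And>n. n \<ge> N \<Longrightarrow> norm q ^ n * exp R < 1 / 2"
    by (auto simp: eventually_sequentially)
  show thesis
  proof (rule that[of N])
    fix n and y :: complex
    assume "n \<ge> N" "norm y \<le> R"
    have "norm (q ^ n * exp y) \<le> norm q ^ n * exp R"
      using \<open>norm y \<le> R\<close> norm_exp[of y]
      by (auto simp: norm_mult norm_power intro!: mult_left_mono order_trans[OF norm_exp])
    then show "norm (q ^ n * exp y) \<le> 1 / 2"
      using N[OF \<open>n \<ge> N\<close>] by linarith
  qed
qed

lemma summable_koebe_geom:
  assumes "norm q < 1"
  shows "summable (\<lambda>n. koebe (q ^ n * exp y))" "summable (\<lambda>n. geom (q ^ n * exp y))"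
proof -
  obtain N where N: "\<And>n. n \<ge> N \<Longrightarrow> norm (q ^ n * exp y) \<le> 1 / 2"
    using eventually_small[OF assms, of "norm y"] by (metis order_refl)
  have s: "summable (\<lambda>n. c * norm (q ^ n * exp y))" for c
    using assms by (intro summable_mult) (auto simp: norm_mult norm_power intro!: summable_mult2)
  show "summable (\<lambda>n. koebe (q ^ n * exp y))"
    by (rule summable_comparison_test'[OF s[of 4]]) (use N norm_koebe_le in auto)
  show "summable (\<lambda>n. geom (q ^ n * exp y))"
    by (rule summable_comparison_test'[OF s[of 2]]) (use N norm_geom_le in auto)
qed

lemma poles_avoiding_nhd:
  assumes "norm q < 1" "x \<notin> poles q"
  obtains U R where "open U" "x \<in> U" "U \<inter> poles q = {}" "\<And>y. y \<in> U \<Longrightarrow> norm y < R"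
proof -
  define R where "R = norm x + 1"
  obtain N where N: "\<And>n y. n \<ge> N \<Longrightarrow> norm y \<le> R \<Longrightarrow> norm (q ^ n * exp y) \<le> 1 / 2"
    using eventually_small[OF assms(1), of R] by metis
  define U where "U = ball 0 R \<inter> (\<Inter>n<N. {y. q ^ n * exp y \<noteq> 1 \<and> q ^ n * exp (- y) \<noteq> 1})"
  show thesis
  proof
    show "open U" unfolding U_def
      by (intro open_Int open_INT) (auto intro!: open_Collect_conj open_Collect_neq continuous_intros)
    show "x \<in> U" using assms(2) by (auto simp: U_def R_def poles_def)
    show "U \<inter> poles q = {}"
    proof safe
      fix y assume y: "y \<in> U" "y \<in> poles q"
      then obtain n where n: "q ^ n * exp y = 1 \<or> q ^ n * exp (- y) = 1" by (auto simp: poles_def)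
      then have "n \<ge> N" using y(1) by (auto simp: U_def not_le)
      then show "y \<in> {}"
        using N[of n y] N[of n "-y"] n y(1) by (auto simp: U_def)
    qed
    show "\<And>y. y \<in> U \<Longrightarrow> norm y < R" by (auto simp: U_def)
  qed
qed

lemma closed_poles: "norm q < 1 \<Longrightarrow> closed (poles q)"
  unfolding closed_def open_subopen[of "- poles q"]
  by (metis ComplD disjoint_eq_subset_Compl poles_avoiding_nhd)

text \<open>Locally uniform convergence has to be estimated for the primitives \<open>geom\<close>
  only: termwise differentiation of holomorphic functions supplies the convergence of the
  \<open>koebe\<close> series. Holomorphy of \<open>wp\<close> follows, as it is a derivative up to
  a constant.\<close>

lemma wzeta_has_field_derivative:
  assumes "norm q < 1" "x \<notin> poles q"
  shows "(wzeta q has_field_derivative (wp q x - E2 q / 12)) (at x)"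
proof -
  obtain U R where U: "open U" "x \<in> U" "U \<inter> poles q = {}" "\<And>y. y \<in> U \<Longrightarrow> norm y < R"
    using poles_avoiding_nhd[OF assms] by blast
  obtain N where N: "\<And>n y. n \<ge> N \<Longrightarrow> norm y \<le> R \<Longrightarrow> norm (q ^ n * exp y) \<le> 1 / 2"
    using eventually_small[OF assms(1), of R] by metis
  have nz: "q ^ n * exp y \<noteq> 1 \<and> q ^ n * exp (-y) \<noteq> 1" if "y \<in> U" for n y
    using U(3) that by (auto simp: poles_def)
  define f where "f n y = geom (q ^ Suc n * exp y) - geom (q ^ Suc n * exp (- y))" for n y
  define f' where "f' n y = koebe (q ^ Suc n * exp y) + koebe (q ^ Suc n * exp (- y))" for n y
  have d: "(f n has_field_derivative f' n y) (at y)" if "y \<in> U" for n y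
    unfolding f_def f'_def geom_def koebe_def using nz[OF that, of "Suc n"]
    by (auto intro!: derivative_eq_intros simp del: power_Suc) (simp add: field_simps power2_eq_square)
  have sm: "summable (\<lambda>n. 4 * exp R * norm q ^ Suc n)"
    using assms(1) by (intro summable_mult) (subst summable_Suc_iff, simp)
  have ev: "\<forall>\<^sub>F n in sequentially. \<forall>y\<in>U. norm (f n y) \<le> 4 * exp R * norm q ^ Suc n"
    unfolding eventually_sequentially
  proof (intro exI[of _ N] allI impI ballI)
    fix n y assume "N \<le> n" "y \<in> U"
    have *: "norm (geom (q ^ Suc n * exp v)) \<le> 2 * (norm q ^ Suc n * exp R)" if "norm v \<le> R" for v
    proof -
      have "norm (geom (q ^ Suc n * exp v)) \<le> 2 * norm (q ^ Suc n * exp v)"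
        using N[of "Suc n" v] that \<open>N \<le> n\<close> by (intro norm_geom_le) auto
      also have "\<dots> \<le> 2 * (norm q ^ Suc n * exp R)"
        unfolding norm_mult norm_power using norm_exp[of v] that
        by (intro mult_left_mono) (auto intro: order_trans)
      finally show ?thesis .
    qed
    have "norm (f n y) \<le> 2 * (norm q ^ Suc n * exp R) + 2 * (norm q ^ Suc n * exp R)"
      unfolding f_def using U(4)[OF \<open>y \<in> U\<close>]
      by (intro order_trans[OF norm_triangle_ineq4] add_mono *) auto
    then show "norm (f n y) \<le> 4 * exp R * norm q ^ Suc n" by (simp add: mult_ac)
  qed
  obtain s s' where s: "\<forall>y \<in> U. (\<lambda>n. f n y) sums s y \<and> (\<lambda>n. f' n y) sums s' y \<and>
      (s has_field_derivative s' y) (at y)"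
    by (rule series_and_derivative_comparison[OF U(1) sm d ev]) (assumption, rule that)
  have "exp x \<noteq> 1" using nz[OF U(2), of 0] by simp
  then have "((\<lambda>y. 1 / (1 - exp y) + s y) has_field_derivative (koebe (exp x) + s' x)) (at x)"
    using s U(2) by (auto intro!: derivative_eq_intros simp: koebe_def power2_eq_square)
  moreover have "s' x = koebe_tail q x"
    using s U(2) by (auto simp: koebe_tail_def f'_def sums_iff)
  ultimately have "((\<lambda>y. 1 / (1 - exp y) + s y) has_field_derivative (wp q x - E2 q / 12)) (at x)"
    by (simp add: wp_def)
  then show ?thesis
  proof (rule has_field_derivative_transform_within_open[OF _ U(1,2)])
    fix y assume "y \<in> U"
    then show "1 / (1 - exp y) + s y = wzeta q y"
      using s by (auto simp: wzeta_def f_def sums_iff)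
  qed
qed

lemma wp_holomorphic:
  assumes "norm q < 1"
  shows "wp q holomorphic_on - poles q"
proof -
  have "open (- poles q)" using closed_poles[OF assms] by auto
  have "wzeta q holomorphic_on - poles q"
    using wzeta_has_field_derivative[OF assms] \<open>open (- poles q)\<close> by (auto simp: holomorphic_on_open)
  then have "(\<lambda>x. deriv (wzeta q) x + E2 q / 12) holomorphic_on - poles q"
    using \<open>open (- poles q)\<close> by (intro holomorphic_intros holomorphic_deriv)
  then show ?thesis
    by (rule holomorphic_transform) (simp add: DERIV_imp_deriv[OF wzeta_has_field_derivative[OF assms]])
qed

lemma koebe_inverse: "koebe (inverse u) = koebe u"
  by (cases "u = 0"; cases "u = 1") (auto simp: koebe_def field_simps power2_eq_square)

lemma wp_plus_2pi: "wp q (x + 2 * of_real pi * \<i>) = wp q x"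
  and wzeta_plus_2pi: "wzeta q (x + 2 * of_real pi * \<i>) = wzeta q x"
proof -
  have "exp (x + 2 * of_real pi * \<i>) = exp x" "exp (- (x + 2 * of_real pi * \<i>)) = exp (- x)"
    by (simp_all add: exp_add exp_diff exp_minus)
  then show "wp q (x + 2 * of_real pi * \<i>) = wp q x" "wzeta q (x + 2 * of_real pi * \<i>) = wzeta q x"
    by (simp_all only: wp_def wzeta_def koebe_tail_def)
qed

text \<open>Adding p multiplies exp x by q, which shifts the two half-series by one index in
  opposite directions; one boundary term passes across each. For \<open>koebe\<close> these terms
  and the central one match by the symmetry u to 1/u. For \<open>geom\<close> they match up to geom
  u = 1 / (1 - u) - 1, and this -1 is the quasi-period. At a pole \<open>koebe 1\<close> is 0, so
  the periodicity of \<open>wp\<close> extends to all arguments.\<close>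

lemma
  assumes "norm q < 1" "q = exp p"
  shows wp_plus_period: "wp q (x + p) = wp q x"
    and wzeta_plus_period: "x \<notin> poles q \<Longrightarrow> wzeta q (x + p) = wzeta q x + 1"
proof -
  have [simp]: "q \<noteq> 0" using assms by simp
  have e: "q ^ n * exp (x + p) = q ^ Suc n * exp x" "q ^ Suc n * exp (- (x + p)) = q ^ n * exp (- x)" for n
    by (simp_all add: assms(2) exp_add exp_minus exp_diff field_simps)
  have *: "(\<Sum>n. f (q ^ Suc n * exp (x + p))) + f (q * exp x) = (\<Sum>n. f (q ^ Suc n * exp x))"
     "(\<Sum>n. f (q ^ Suc n * exp (- (x + p)))) = f (exp (- x)) + (\<Sum>n. f (q ^ Suc n * exp (- x)))"
    if "\<And>y. summable (\<lambda>n. f (q ^ n * exp y))" for f :: "complex \<Rightarrow> complex"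
    unfolding e
    using suminf_split_head[of "\<lambda>n. f (q ^ Suc n * exp x)"] suminf_split_head[OF that[of "-x"]]
      that[of x] summable_Suc_iff[of "\<lambda>n. f (q ^ n * exp x)"] by simp_all
  have S: "summable (\<lambda>n. f (q ^ Suc n * exp y))"
    if "\<And>y. summable (\<lambda>n. f (q ^ n * exp y))" for f :: "complex \<Rightarrow> complex" and y
    using that[of y] by (subst summable_Suc_iff)
  note sk = summable_koebe_geom[OF assms(1)]
  have split:
    "(\<Sum>n. koebe (q ^ Suc n * exp y) + koebe (q ^ Suc n * exp (- y))) =
       (\<Sum>n. koebe (q ^ Suc n * exp y)) + (\<Sum>n. koebe (q ^ Suc n * exp (- y)))"
    "(\<Sum>n. geom (q ^ Suc n * exp y) - geom (q ^ Suc n * exp (- y))) =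
       (\<Sum>n. geom (q ^ Suc n * exp y)) - (\<Sum>n. geom (q ^ Suc n * exp (- y)))" for y
    by (rule suminf_add[symmetric] suminf_diff[symmetric]; rule S, rule sk)+
  have qx: "exp (x + p) = q * exp x" using e(1)[of 0] by simp
  have "koebe (exp (- x)) = koebe (exp x)" by (simp add: exp_minus koebe_inverse)
  then show "wp q (x + p) = wp q x"
    unfolding wp_def koebe_tail_def split *(2)[OF sk(1)] *(1)[OF sk(1), symmetric] unfolding qx by simp
  assume x: "x \<notin> poles q"
  then have "exp x \<noteq> 1" "q ^ 1 * exp x \<noteq> 1" unfolding poles_def by (force dest: spec[of _ 0], blast)
  then have "geom (exp (- x)) = 1 / (exp x - 1)" "geom (q * exp x) = 1 / (1 - q * exp x) - 1"
    by (auto simp: geom_def exp_minus field_simps)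
  moreover have "1 / (exp x - 1) = - (1 / (1 - exp x))"
    by (metis minus_diff_eq minus_divide_right)
  ultimately show "wzeta q (x + p) = wzeta q x + 1"
    unfolding wzeta_def split *(2)[OF sk(2)] *(1)[OF sk(2), symmetric] unfolding qx by simp
qed

lemma sigma_series_holomorphic: "sigma_series k holomorphic_on ball 0 1"
proof (rule power_series_holomorphic[where a = "\<lambda>n. of_nat (divisor_sigma k n)"])
  fix q :: complex assume "q \<in> ball 0 1"
  then have q: "norm q < 1" by simp
  have le: "divisor_sigma k n \<le> n ^ Suc k" for n
  proof (cases "n = 0")
    case False
    have "divisor_sigma k n \<le> (\<Sum>d | d dvd n. n ^ k)"
      unfolding divisor_sigma_def using False by (intro sum_mono power_mono) (auto dest: dvd_imp_le)
    also have "\<dots> \<le> n * n ^ k"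
    proof -
      have "{d. d dvd n} \<subseteq> {1..n}" using False by (auto dest: dvd_imp_le intro!: Suc_leI Nat.gr0I)
      from card_mono[OF _ this] show ?thesis by simp
    qed
    finally show ?thesis by simp
  qed (simp add: divisor_sigma_def)
  have "norm (of_nat (divisor_sigma k n) * q ^ n) \<le> real n ^ Suc k * norm q ^ n" for n
    unfolding norm_mult norm_power norm_of_nat
    using of_nat_mono[OF le[of n], where 'a = real] by (intro mult_right_mono) auto
  then have "summable (\<lambda>n. of_nat (divisor_sigma k n) * q ^ n)"
    using q by (intro summable_comparison_test'[OF summable_power_geometric[of "norm q" "Suc k"]]) auto
  \<comment> \<open>The coefficient of q^0 is 0 by default: every number divides 0, and the sum over
    an infinite set is 0. Thus prepending index 0 does not change the series.\<close>
  then show "(\<lambda>n. of_nat (divisor_sigma k n) * (q - 0) ^ n) sums sigma_series k q"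
    unfolding sigma_series_def using summable_sums[of "\<lambda>n. of_nat (divisor_sigma k n) * q ^ n"]
    by (subst suminf_split_head) (auto simp: divisor_sigma_def)
qed

section \<open>Periodicity and the differential equation\<close>

definition nome :: "complex \<Rightarrow> complex" where
  "nome z = exp (2 * of_real pi * \<i> * z)"

lemma norm_nome: "Im z > 0 \<Longrightarrow> norm (nome z) < 1"
  by (simp add: nome_def norm_exp_eq_Re)

lemma complex_real_basis:
  assumes "Im z > 0"
  shows "u = of_real (Re u - Im u / Im z * Re z) + of_real (Im u / Im z) * z"
  using assms by (simp add: complex_eq_iff)

lemma int_basis_eq_iff:
  assumes "Im z > 0"
  shows "of_int m + of_int n * z = of_int m' + of_int n' * z \<longleftrightarrow> m = m' \<and> n = n'"
proof
  assume eq: "of_int m + of_int n * z = of_int m' + of_int n' * z"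
  then have "of_int n * Im z = of_int n' * Im z" by (auto simp: complex_eq_iff)
  with assms have "n = n'" by simp
  with eq show "m = m' \<and> n = n'" by simp
qed auto

text \<open>The two conditions read exp (2 \<pi> i n z + x) = 1 and exp (2 \<pi> i n z - x) = 1;
  with n a natural number they account for the nonpositive and the nonnegative multiples of
  z.\<close>

lemma poles_nome_iff:
  "x \<in> poles (nome z) \<longleftrightarrow> (\<exists>m n::int. x = 2 * of_real pi * \<i> * (of_int m + of_int n * z))"
proof
  have e: "nome z ^ n * exp y = exp (2 * of_real pi * \<i> * z * of_nat n + y)" for n y
    by (simp add: nome_def exp_add mult.commute flip: exp_of_nat_mult)
  {
    assume "x \<in> poles (nome z)"
    then obtain n k where "2 * of_real pi * \<i> * z * of_nat n + x = 2 * of_int k * of_real pi * \<i> \<or>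
        2 * of_real pi * \<i> * z * of_nat n - x = 2 * of_int k * of_real pi * \<i>"
      unfolding poles_def e using exp_eq[of _ 0] by (auto; metis)
    then have "x = 2 * of_real pi * \<i> * (of_int k + of_int (- int n) * z) \<or>
        x = 2 * of_real pi * \<i> * (of_int (- k) + of_int (int n) * z)"
      by (auto simp: algebra_simps)
    then show "\<exists>m n::int. x = 2 * of_real pi * \<i> * (of_int m + of_int n * z)" by blast
  }
  assume "\<exists>m n::int. x = 2 * of_real pi * \<i> * (of_int m + of_int n * z)"
  then obtain m n :: int where x: "x = 2 * of_real pi * \<i> * (of_int m + of_int n * z)" by blast
  have one: "exp (2 * of_real pi * \<i> * of_int k) = 1" for k
    using exp_eq[of "2 * of_real pi * \<i> * of_int k" 0] by (auto simp: mult_ac)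
  show "x \<in> poles (nome z)"
  proof (cases "n \<ge> 0")
    case True
    have "2 * of_real pi * \<i> * z * of_nat (nat n) + - x = 2 * of_real pi * \<i> * of_int (- m)"
      unfolding x using True by (simp add: algebra_simps)
    then show ?thesis unfolding poles_def e mem_Collect_eq using one by metis
  next
    case False
    have "2 * of_real pi * \<i> * z * of_nat (nat (- n)) + x = 2 * of_real pi * \<i> * of_int m"
      unfolding x using False by (simp add: algebra_simps)
    then show ?thesis unfolding poles_def e mem_Collect_eq using one by metis
  qed
qed

lemma poles_nomeI [intro]: "2 * of_real pi * \<i> * (of_int m + of_int n * z) \<in> poles (nome z)"
  unfolding poles_nome_iff by blast

lemma poles_add: "x \<in> poles (nome z) \<Longrightarrow> y \<in> poles (nome z) \<Longrightarrow> x + y \<in> poles (nome z)"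
  unfolding poles_nome_iff
proof safe
  fix m n m' n' :: int
  show "\<exists>k l::int. 2 * of_real pi * \<i> * (of_int m + of_int n * z) +
      2 * of_real pi * \<i> * (of_int m' + of_int n' * z) = 2 * of_real pi * \<i> * (of_int k + of_int l * z)"
    by (rule exI[of _ "m + m'"], rule exI[of _ "n + n'"]) (simp add: algebra_simps)
qed

lemma poles_uminus: "x \<in> poles q \<Longrightarrow> - x \<in> poles q"
  by (auto simp: poles_def)

lemma poles_add_iff: "\<omega> \<in> poles (nome z) \<Longrightarrow> x + \<omega> \<in> poles (nome z) \<longleftrightarrow> x \<in> poles (nome z)"
  using poles_add[of "x + \<omega>" z "- \<omega>"] poles_uminus[of \<omega>] poles_add[of x z \<omega>] by auto

lemma zero_in_poles: "0 \<in> poles q"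
  unfolding poles_def by (auto intro: exI[of _ 0])

lemma poles_discrete:
  assumes "Im z > 0"
  obtains \<delta> where "\<delta> > 0" "\<And>\<omega> x. \<omega> \<in> poles (nome z) \<Longrightarrow> x \<in> poles (nome z) \<Longrightarrow> x \<in> ball \<omega> \<delta> \<Longrightarrow> x = \<omega>"
proof -
  \<comment> \<open>A nonzero m + n z has modulus at least min 1 (Im z): by its imaginary part if n
    is nonzero, and because m is a nonzero integer otherwise.\<close>
  define U where "U = ball (0::complex) (2 * pi * min 1 (Im z))"
  have "U \<inter> (poles (nome z) - {0}) = {}"
  proof (rule equals0I)
    fix x assume "x \<in> U \<inter> (poles (nome z) - {0})"
    then have x: "x \<in> U" "x \<in> poles (nome z)" "x \<noteq> 0" by auto
    obtain m n :: int where mn: "x = 2 * of_real pi * \<i> * (of_int m + of_int n * z)"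
      using x(2) unfolding poles_nome_iff by blast
    have "min 1 (Im z) \<le> norm (of_int m + of_int n * z)"
    proof (cases "n = 0")
      case True
      then have "m \<noteq> 0" using x(3) mn by auto
      then have "1 \<le> \<bar>m\<bar>" by linarith
      then have "1 \<le> \<bar>of_int m :: real\<bar>" by linarith
      then show ?thesis using True by (simp add: norm_of_int)
    next
      case False
      then have "1 \<le> \<bar>n\<bar>" by linarith
      then have "1 \<le> \<bar>of_int n :: real\<bar>" by linarith
      then have "1 * Im z \<le> \<bar>of_int n\<bar> * Im z" using assms by (intro mult_right_mono) auto
      also have "\<dots> = \<bar>Im (of_int m + of_int n * z)\<bar>" using assms by (simp add: abs_mult)
      also have "\<dots> \<le> norm (of_int m + of_int n * z)" by (rule abs_Im_le_cmod)
      finally show ?thesis by simp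
    qed
    then have "2 * pi * min 1 (Im z) \<le> norm x"
      unfolding mn norm_mult by simp
    then show False using x(1) by (simp add: U_def)
  qed
  then have "open U" "0 \<in> U" "U \<inter> (poles (nome z) - {0}) = {}"
    using assms by (auto simp: U_def)
  then obtain e where e: "e > 0" "ball 0 e \<subseteq> U" using open_contains_ball by metis
  show thesis
  proof
    show "e > 0" by fact
    fix \<omega> x assume x: "\<omega> \<in> poles (nome z)" "x \<in> poles (nome z)" "x \<in> ball \<omega> e"
    then have "x - \<omega> \<in> poles (nome z)" using poles_add[of x z "-\<omega>"] poles_uminus[of \<omega>] by simp
    moreover have "x - \<omega> \<in> U" using e(2) x(3) by (auto simp: dist_norm norm_minus_commute)
    ultimately show "x = \<omega>" using \<open>U \<inter> _ = {}\<close> by auto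
  qed
qed

text \<open>Serves to connect the complement: a plane minus a countable set is path connected, so
  analytic continuation and constancy arguments reach every point off the poles.\<close>

lemma countable_poles: "countable (poles (nome z))"
proof -
  have "poles (nome z) = (\<lambda>(m,n::int). 2 * of_real pi * \<i> * (of_int m + of_int n * z)) ` UNIV"
    using poles_nome_iff[of _ z] by force
  then show ?thesis by simp
qed

lemma int_shift:
  fixes f :: "complex \<Rightarrow> complex"
  assumes f: "\<And>x. x \<in> S \<Longrightarrow> f (x + p) = f x + c"
    and S: "\<And>x. x \<in> S \<Longrightarrow> x + p \<in> S" "\<And>x. x \<in> S \<Longrightarrow> x - p \<in> S"
    and "x \<in> S"
  shows "f (x + of_int n * p) = f x + of_int n * c \<and> x + of_int n * p \<in> S"
proof (induction n rule: int_induct[of _ 0])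
  case base
  then show ?case using \<open>x \<in> S\<close> by simp
next
  case (step1 i)
  then show ?case using f[of "x + of_int i * p"] S(1)[of "x + of_int i * p"]
    by (simp add: algebra_simps)
next
  case (step2 i)
  have "x + of_int (i - 1) * p \<in> S" using S(2)[of "x + of_int i * p"] step2 by (simp add: algebra_simps)
  then show ?case using f[of "x + of_int (i - 1) * p"] step2
    by (simp add: algebra_simps)
qed

lemma
  assumes "Im z > 0"
  shows wp_periodic: "\<omega> \<in> poles (nome z) \<Longrightarrow> wp (nome z) (x + \<omega>) = wp (nome z) x"
    and wzeta_quasiperiodic: "x \<notin> poles (nome z) \<Longrightarrow>
      wzeta (nome z) (x + 2 * of_real pi * \<i> * (of_int m + of_int n * z)) = wzeta (nome z) x + of_int n"
proof -
  let ?p = "2 * of_real pi * \<i> * z" and ?t = "2 * of_real pi * \<i> :: complex"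
  note q = norm_nome[OF assms]
  note per = wp_plus_period[OF q nome_def] wp_plus_2pi
  note per' = wzeta_plus_period[OF q nome_def] wzeta_plus_2pi
  have t: "?t \<in> poles (nome z)" and p: "?p \<in> poles (nome z)"
    using poles_nomeI[of 1 0 z] poles_nomeI[of 0 1 z] by simp_all
  have split: "x + 2 * of_real pi * \<i> * (of_int m + of_int n * z) = x + of_int m * ?t + of_int n * ?p" for x m n
    by (simp add: algebra_simps)
  {
    assume "\<omega> \<in> poles (nome z)"
    then obtain m n :: int where \<omega>: "\<omega> = 2 * of_real pi * \<i> * (of_int m + of_int n * z)"
      unfolding poles_nome_iff by blast
    have "wp (nome z) (x + of_int m * ?t) = wp (nome z) x"
      using int_shift[of UNIV "wp (nome z)" ?t 0 x m] per by simp
    moreover have "wp (nome z) (x + of_int m * ?t + of_int n * ?p) = wp (nome z) (x + of_int m * ?t)"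
      using int_shift[of UNIV "wp (nome z)" ?p 0 "x + of_int m * ?t" n] per by simp
    ultimately show "wp (nome z) (x + \<omega>) = wp (nome z) x" unfolding \<omega> split by simp
  }
  assume x: "x \<notin> poles (nome z)"
  have S: "y + \<omega> \<in> - poles (nome z)" "y - \<omega> \<in> - poles (nome z)"
    if "y \<in> - poles (nome z)" "\<omega> \<in> poles (nome z)" for y \<omega>
    using that poles_add_iff[of \<omega> z y] poles_add_iff[of \<omega> z "y - \<omega>"] by auto
  have 1: "wzeta (nome z) (x + of_int m * ?t) = wzeta (nome z) x + of_int m * 0 \<and> x + of_int m * ?t \<in> - poles (nome z)"
    by (rule int_shift[OF _ S(1)[OF _ t] S(2)[OF _ t]]) (use per' x in auto)
  have "wzeta (nome z) (x + of_int m * ?t + of_int n * ?p) = wzeta (nome z) (x + of_int m * ?t) + of_int n * 1 \<and>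
     x + of_int m * ?t + of_int n * ?p \<in> - poles (nome z)"
    by (rule int_shift[OF _ S(1)[OF _ p] S(2)[OF _ p]]) (use per' 1 in auto)
  then show "wzeta (nome z) (x + 2 * of_real pi * \<i> * (of_int m + of_int n * z)) = wzeta (nome z) x + of_int n"
    using 1 unfolding split by simp
qed

text \<open>Periodicity carries the limit c from 0 to every lattice point, so all singularities are
  removable with the same value. The extension takes all its values on the compact fundamental
  parallelogram, is thus bounded, and Liouville's theorem applies.\<close>

lemma elliptic_constant:
  assumes z: "Im z > 0" and hol: "f holomorphic_on - poles (nome z)"
    and per: "\<And>x \<omega>. x \<notin> poles (nome z) \<Longrightarrow> \<omega> \<in> poles (nome z) \<Longrightarrow> f (x + \<omega>) = f x"
    and lim: "(f \<longlongrightarrow> c) (at 0)" and "x \<notin> poles (nome z)"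
  shows "f x = c"
proof -
  let ?L = "poles (nome z)"
  define F where "F x = (if x \<in> ?L then c else f x)" for x
  obtain \<delta> where \<delta>: "\<delta> > 0" "\<And>\<omega> x. \<omega> \<in> ?L \<Longrightarrow> x \<in> ?L \<Longrightarrow> x \<in> ball \<omega> \<delta> \<Longrightarrow> x = \<omega>"
    using poles_discrete[OF z] by metis
  have op: "open (- ?L)" using closed_poles[OF norm_nome[OF z]] by auto
  have holF: "F holomorphic_on - ?L"
    using hol by (rule holomorphic_transform) (auto simp: F_def)
  have per_F: "F (x + \<omega>) = F x" if "\<omega> \<in> ?L" for x \<omega>
    using per[OF _ that] poles_add_iff[OF that, of x] by (simp add: F_def)
  have limF: "(F \<longlongrightarrow> c) (at \<omega>)" if "\<omega> \<in> ?L" for \<omega>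
  proof -
    have "\<forall>\<^sub>F x in at 0. f x = F x"
      using \<delta>(1) \<delta>(2)[OF zero_in_poles] unfolding eventually_at F_def
      by (intro exI[of _ \<delta>]) (auto simp: dist_commute)
    then have "(F \<longlongrightarrow> c) (at 0)" using lim by (rule Lim_transform_eventually[rotated])
    then have "((\<lambda>x. F (x + \<omega>)) \<longlongrightarrow> c) (at 0)" using per_F[OF that] by simp
    then show ?thesis using LIM_offset_zero_iff[of \<omega> F c] by (simp add: add.commute)
  qed
  have "F holomorphic_on ball \<omega> \<delta>" if "\<omega> \<in> ?L" for \<omega>
  proof (rule no_isolated_singularity'[of "{\<omega>}"])
    fix y assume "y \<in> {\<omega>}"
    then show "(F \<longlongrightarrow> F y) (at y within ball \<omega> \<delta>)"
      using limF[OF that] that by (auto simp: F_def intro: tendsto_within_subset)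
  next
    have "ball \<omega> \<delta> - {\<omega>} \<subseteq> - ?L" using \<delta>(2)[OF that] by auto
    then show "F holomorphic_on ball \<omega> \<delta> - {\<omega>}" using holF holomorphic_on_subset by blast
  qed auto
  then have "F field_differentiable at y" for y
    using holF op \<delta>(1) unfolding holomorphic_on_def
    by (cases "y \<in> ?L") (metis centre_in_ball at_within_open open_ball, metis ComplI at_within_open)
  then have F: "F holomorphic_on UNIV" by (simp add: holomorphic_on_def)
  define K where "K = (\<lambda>(s,t). 2 * of_real pi * \<i> * (of_real s + of_real t * z)) ` ({0..1} \<times> {0..1})"
  have "compact K" unfolding K_def case_prod_unfold
    by (intro compact_continuous_image compact_Times continuous_intros) auto
  moreover have "continuous_on K F"
    using holomorphic_on_imp_continuous_on[OF F] continuous_on_subset by blast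
  ultimately have "bounded (F ` K)" by (intro compact_imp_bounded compact_continuous_image)
  moreover have "range F \<subseteq> F ` K"
  proof safe
    fix y
    define u where "u = y / (2 * of_real pi * \<i>)"
    define t where "t = Im u / Im z"
    define s where "s = Re u - t * Re z"
    have u: "u = of_real s + of_real t * z"
      using complex_real_basis[OF z, of u] by (simp add: s_def t_def)
    have y: "y = 2 * of_real pi * \<i> * (of_real (frac s) + of_real (frac t) * z) +
        2 * of_real pi * \<i> * (of_int \<lfloor>s\<rfloor> + of_int \<lfloor>t\<rfloor> * z)"
    proof -
      have "of_real s = of_real (frac s) + (of_int \<lfloor>s\<rfloor> :: complex)" "of_real t = of_real (frac t) + (of_int \<lfloor>t\<rfloor> :: complex)"
        by (simp_all add: frac_def)
      moreover have "y = 2 * of_real pi * \<i> * u" by (simp add: u_def)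
      ultimately show ?thesis unfolding u by (simp add: algebra_simps)
    qed
    have "(2 * of_real pi * \<i> * (of_real (frac s) + of_real (frac t) * z)) \<in> K"
      unfolding K_def by (rule image_eqI[of _ _ "(frac s, frac t)"]) (auto intro: less_imp_le frac_lt_1)
    then show "F y \<in> F ` K" unfolding y per_F[OF poles_nomeI] by blast
  qed
  ultimately have "bounded (range F)" using bounded_subset by blast
  with F have "F constant_on UNIV" by (rule Liouville_theorem)
  then have "F x = F 0" by (metis UNIV_I constant_on_def)
  then show ?thesis using \<open>x \<notin> ?L\<close> zero_in_poles[of "nome z"] by (simp add: F_def)
qed

section \<open>The differential equation of the Weierstrass function\<close>

lemma has_field_derivative_inverse_square_add:
  assumes "A holomorphic_on ball 0 r" "x \<in> ball 0 r" "x \<noteq> 0"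
  shows "((\<lambda>x. 1 / x\<^sup>2 + A x) has_field_derivative (- 2 / x ^ 3 + deriv A x)) (at x)"
proof -
  have "(A has_field_derivative deriv A x) (at x)"
    using assms holomorphic_derivI[OF assms(1) open_ball] by blast
  then show ?thesis using assms(3)
    by (auto intro!: derivative_eq_intros simp: field_simps eval_nat_numeral)
qed

lemma deriv_punctured:
  assumes "\<And>x. x \<in> ball 0 r \<Longrightarrow> x \<noteq> 0 \<Longrightarrow> Y x = 1 / x\<^sup>2 + A x"
    and "A holomorphic_on ball 0 r" "x \<in> ball 0 r" "x \<noteq> 0"
  shows "deriv Y x = - 2 / x ^ 3 + deriv A x"
proof (rule DERIV_imp_deriv, rule has_field_derivative_transform_within_open)
  show "((\<lambda>x. 1 / x\<^sup>2 + A x) has_field_derivative (- 2 / x ^ 3 + deriv A x)) (at x)"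
    by (rule has_field_derivative_inverse_square_add) fact+
  show "open (ball (0::complex) r - {0})" by (intro open_Diff) auto
qed (use assms in auto)

text \<open>The defect of the equation is elliptic and has a double zero at 0, hence vanishes. With
  the expansion x^-2 + a x^2 - b x^4 + ... the coefficients must be 20 a and -28 b, and 20/240 =
  1/12, 28/6048 = 1/216.\<close>

lemma wp_ode:
  assumes z: "Im z > 0" and x: "x \<notin> poles (nome z)"
  defines "q \<equiv> nome z"
  shows "(deriv (wp q) x)\<^sup>2 = 4 * wp q x ^ 3 - E4 q / 12 * wp q x + E6 q / 216"
proof -
  let ?L = "poles q"
  have q: "norm q < 1" unfolding q_def by (rule norm_nome[OF z])
  have op: "open (- ?L)" using closed_poles[OF q] by auto
  define f where "f x = (deriv (wp q) x)\<^sup>2 - 4 * wp q x ^ 3 + E4 q / 12 * wp q x - E6 q / 216" for x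
  obtain r C where r: "r > 0" and C: "C holomorphic_on ball 0 r"
    and wp: "\<And>x. x \<in> ball 0 r \<Longrightarrow> x \<noteq> 0 \<Longrightarrow>
       wp q x = 1 / x\<^sup>2 + E4 q / 240 * x\<^sup>2 - E6 q / 6048 * x ^ 4 + x ^ 6 * C x"
    using wp_expansion[OF q] by metis
  define a b where "a = E4 q / 240" and "b = E6 q / 6048"
  define A where "A x = a * x\<^sup>2 - b * x ^ 4 + x ^ 6 * C x" for x
  define D where "D x = 6 * C x + x * deriv C x" for x
  \<comment> \<open>\<open>u\<close> and \<open>v\<close> collect the regular parts: the function is
    1/x^2 + x^2 u and its derivative -2/x^3 + x v. \<open>G\<close> is then the quotient of the
    defect by x^2.\<close>
  define u where "u x = a - b * x\<^sup>2 + x ^ 4 * C x" for x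
  define v where "v x = 2 * a - 4 * b * x\<^sup>2 + x ^ 4 * D x" for x
  define G where "G x = - 4 * D x - 12 * C x + (v x)\<^sup>2 - 12 * (u x)\<^sup>2 - 4 * x ^ 4 * u x ^ 3 + 20 * a * u x" for x
  have Ahol: "A holomorphic_on ball 0 r" unfolding A_def by (intro holomorphic_intros C)
  have dA: "deriv A x = x * v x" if "x \<in> ball 0 r" for x
  proof -
    have "(C has_field_derivative deriv C x) (at x)"
      using that holomorphic_derivI[OF C open_ball] by blast
    then have "(A has_field_derivative x * v x) (at x)"
      unfolding A_def v_def D_def
      by (auto intro!: derivative_eq_intros simp: eval_nat_numeral algebra_simps)
    then show ?thesis by (rule DERIV_imp_deriv)
  qed
  have f_near: "f x = x\<^sup>2 * G x" if "x \<in> ball 0 r" "x \<noteq> 0" for x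
  proof -
    have y: "wp q x = 1 / x\<^sup>2 + x\<^sup>2 * u x"
      using wp[OF that] by (simp add: u_def a_def b_def algebra_simps flip: power_add)
    have y': "deriv (wp q) x = - 2 / x ^ 3 + x * v x"
      using deriv_punctured[of r "wp q" A x] wp Ahol dA that by (simp add: A_def a_def b_def algebra_simps)
    have "(- 2 / x ^ 3 + x * V)\<^sup>2 - 4 * (1 / x\<^sup>2 + x\<^sup>2 * U) ^ 3 =
        (- 4 * V - 12 * U) / x\<^sup>2 + x\<^sup>2 * (V\<^sup>2 - 12 * U\<^sup>2 - 4 * x ^ 4 * U ^ 3)" for U V
      using that(2) by (simp add: field_simps eval_nat_numeral)
    then have "f x = (- 4 * v x - 12 * u x) / x\<^sup>2 + x\<^sup>2 * ((v x)\<^sup>2 - 12 * (u x)\<^sup>2 - 4 * x ^ 4 * u x ^ 3)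
        + 20 * a * (1 / x\<^sup>2 + x\<^sup>2 * u x) - 28 * b"
      unfolding f_def y y' by (simp add: a_def b_def)
    \<comment> \<open>The remaining pole and constant: -4 v - 12 u starts with -20 a + 28 b x^2,
      which cancels against the linear and the constant term of the equation.\<close>
    also have "(- 4 * v x - 12 * u x) / x\<^sup>2 = - 20 * a / x\<^sup>2 + 28 * b + x\<^sup>2 * (- 4 * D x - 12 * C x)"
      using that(2) unfolding u_def v_def by (simp add: field_simps eval_nat_numeral)
    finally show ?thesis by (simp add: G_def algebra_simps)
  qed
  have lim: "(f \<longlongrightarrow> 0) (at 0)"
  proof -
    have "(\<lambda>x. x\<^sup>2 * G x) holomorphic_on ball 0 r"
      unfolding G_def u_def v_def D_def by (intro holomorphic_intros C holomorphic_deriv) auto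
    then have "isCont (\<lambda>x. x\<^sup>2 * G x) 0"
      using r by (metis centre_in_ball continuous_on_eq_continuous_at holomorphic_on_imp_continuous_on open_ball)
    then have "((\<lambda>x. x\<^sup>2 * G x) \<longlongrightarrow> 0) (at 0)" by (simp add: isCont_def)
    moreover have "\<forall>\<^sub>F x in at 0. x\<^sup>2 * G x = f x"
      using r f_near unfolding eventually_at by (intro exI[of _ r]) auto
    ultimately show ?thesis by (rule Lim_transform_eventually)
  qed
  have "f x = 0"
  proof (rule elliptic_constant[OF z _ _ lim x])
    show "f holomorphic_on - poles (nome z)"
      unfolding f_def q_def[symmetric] using op wp_holomorphic[OF q]
      by (intro holomorphic_intros holomorphic_deriv) auto
    fix y \<omega> assume y: "y \<notin> poles (nome z)" "\<omega> \<in> poles (nome z)"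
    have "deriv (wp q) (y + \<omega>) = deriv (wp q) y"
    proof (rule DERIV_imp_deriv)
      have "(wp q has_field_derivative deriv (wp q) y) (at y)"
        using y(1) holomorphic_derivI[OF wp_holomorphic[OF q] op] by (auto simp: q_def)
      then have "((\<lambda>x. wp q (x + \<omega>)) has_field_derivative deriv (wp q) y) (at y)"
        using wp_periodic[OF z y(2)] by (simp add: q_def)
      then show "(wp q has_field_derivative deriv (wp q) y) (at (y + \<omega>))"
        by (simp add: DERIV_at_within_shift DERIV_shift)
    qed
    then show "f (y + \<omega>) = f y"
      using wp_periodic[OF z y(2)] by (simp add: f_def q_def)
  qed
  then show ?thesis unfolding f_def by (simp add: algebra_simps)
qed

section \<open>Lattices are determined by their invariants\<close>

lemma holomorphic_on_ball_isCont: "f holomorphic_on ball 0 r \<Longrightarrow> r > 0 \<Longrightarrow> isCont f (0 :: complex)"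
  by (metis centre_in_ball continuous_on_eq_continuous_at holomorphic_on_imp_continuous_on open_ball)

lemma holomorphic_eq_at_0:
  assumes "f holomorphic_on ball 0 r" "h holomorphic_on ball 0 r" "r > 0"
    and eq: "\<And>x. x \<in> ball 0 r \<Longrightarrow> x \<noteq> 0 \<Longrightarrow> f x = h x"
  shows "f 0 = (h 0 :: complex)"
proof -
  have "(f \<longlongrightarrow> f 0) (at 0)" "(h \<longlongrightarrow> h 0) (at 0)"
    using holomorphic_on_ball_isCont assms(1-3) by (auto simp: isCont_def)
  moreover have "\<forall>\<^sub>F x in at 0. f x = h x"
    using \<open>r > 0\<close> eq unfolding eventually_at by (intro exI[of _ r]) auto
  ultimately have "(h \<longlongrightarrow> f 0) (at 0)" by (blast intro: Lim_transform_eventually)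
  with \<open>(h \<longlongrightarrow> h 0) (at 0)\<close> show ?thesis using LIM_unique by blast
qed

text \<open>Writing the difference of two solutions as \<open>D = x\<^sup>n u\<close> with \<open>u 0 \<noteq> 0\<close>, the lowest order
  terms of the difference of the two equations give \<open>- 4 n = 12\<close>.\<close>

lemma weierstrass_ode_unique:
  assumes A: "A holomorphic_on ball 0 r" "B holomorphic_on ball 0 r" and "r > 0"
    and odeA: "\<And>x. x \<in> ball 0 r \<Longrightarrow> x \<noteq> 0 \<Longrightarrow>
      (- 2 / x ^ 3 + deriv A x)\<^sup>2 = 4 * (1 / x\<^sup>2 + A x) ^ 3 - g2 * (1 / x\<^sup>2 + A x) - g3"
    and odeB: "\<And>x. x \<in> ball 0 r \<Longrightarrow> x \<noteq> 0 \<Longrightarrow>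
      (- 2 / x ^ 3 + deriv B x)\<^sup>2 = 4 * (1 / x\<^sup>2 + B x) ^ 3 - g2 * (1 / x\<^sup>2 + B x) - g3"
    and x: "x \<in> ball 0 r"
  shows "A x = B x"
proof -
  define D where "D x = A x - B x" for x
  define S where "S x = deriv A x + deriv B x" for x
  define N where "N x = 4 * ((1 + x\<^sup>2 * A x)\<^sup>2 + (1 + x\<^sup>2 * A x) * (1 + x\<^sup>2 * B x) + (1 + x\<^sup>2 * B x)\<^sup>2) - g2 * x ^ 4" for x
  have hol: "D holomorphic_on ball 0 r" "S holomorphic_on ball 0 r" "N holomorphic_on ball 0 r"
      "deriv D holomorphic_on ball 0 r"
    unfolding D_def S_def N_def by (intro holomorphic_intros A holomorphic_deriv; simp)+
  have dD: "deriv D x = deriv A x - deriv B x" if "x \<in> ball 0 r" for x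
    unfolding D_def using A that
    by (intro deriv_diff) (metis holomorphic_on_imp_differentiable_at open_ball)+
  have diff_cubic: "4 * (s + a) ^ 3 - g2 * (s + a) - g3 - (4 * (s + b) ^ 3 - g2 * (s + b) - g3) =
      (a - b) * (4 * ((s + a)\<^sup>2 + (s + a) * (s + b) + (s + b)\<^sup>2) - g2)" for s a b :: complex
    by (simp add: algebra_simps power2_eq_square power3_eq_cube)
  have cancel: "d * p * y = D * Q * y \<Longrightarrow> p * y = x * s \<Longrightarrow> Q * y = n \<Longrightarrow> d * x * s = D * n"
    for d p y D Q x s n :: complex
    by (metis mult.assoc)
  have diff_square: "(p + a)\<^sup>2 - (p + b)\<^sup>2 = (a - b) * (2 * p + (a + b))" for p a b :: complex
    by (simp add: power2_eq_square algebra_simps)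
  \<comment> \<open>Subtracting the two equations and dividing out D on the cubic side gives a
    linear equation for D. Multiplied by x^4 it is free of poles, and \<open>N 0\<close> is
    12.\<close>
  have key: "deriv D x * x * (- 4 + x ^ 3 * S x) = D x * N x" if "x \<in> ball 0 r" "x \<noteq> 0" for x
  proof -
    have "(- 2 / x ^ 3 + deriv A x)\<^sup>2 - (- 2 / x ^ 3 + deriv B x)\<^sup>2 =
        D x * (4 * ((1 / x\<^sup>2 + A x)\<^sup>2 + (1 / x\<^sup>2 + A x) * (1 / x\<^sup>2 + B x) + (1 / x\<^sup>2 + B x)\<^sup>2) - g2)"
      unfolding odeA[OF that] odeB[OF that] D_def by (rule diff_cubic)
    moreover have "(- 2 / x ^ 3 + deriv A x)\<^sup>2 - (- 2 / x ^ 3 + deriv B x)\<^sup>2 = deriv D x * (- 4 / x ^ 3 + S x)"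
      unfolding dD[OF that(1)] S_def diff_square by simp
    ultimately have "deriv D x * (- 4 / x ^ 3 + S x) * x ^ 4 =
        D x * (4 * ((1 / x\<^sup>2 + A x)\<^sup>2 + (1 / x\<^sup>2 + A x) * (1 / x\<^sup>2 + B x) + (1 / x\<^sup>2 + B x)\<^sup>2) - g2) * x ^ 4"
      by simp
    moreover have "(- 4 / x ^ 3 + S x) * x ^ 4 = x * (- 4 + x ^ 3 * S x)"
      using that(2) by (simp add: field_simps eval_nat_numeral)
    moreover have "(4 * ((1 / x\<^sup>2 + A x)\<^sup>2 + (1 / x\<^sup>2 + A x) * (1 / x\<^sup>2 + B x) + (1 / x\<^sup>2 + B x)\<^sup>2) - g2) * x ^ 4 = N x"
      unfolding N_def using that(2) by (simp add: field_simps eval_nat_numeral)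
    ultimately show ?thesis by (rule cancel)
  qed
  \<comment> \<open>At the origin the left side vanishes, so D 0 = 0, which permits factoring out a
    positive power of x below.\<close>
  have "deriv D 0 * 0 * (- 4 + 0 ^ 3 * S 0) = D 0 * N 0"
    by (rule holomorphic_eq_at_0[OF _ _ \<open>r > 0\<close> key]) (intro holomorphic_intros hol)+
  then have D0: "D 0 = 0" by (simp add: N_def)
  have "D constant_on ball 0 r"
  proof (rule ccontr)
    assume nonconst: "\<not> D constant_on ball 0 r"
    obtain u e n where u: "0 < n" "0 < e" "ball 0 e \<subseteq> ball (0::complex) r" "u holomorphic_on ball 0 e"
      "\<And>w. w \<in> ball 0 e \<Longrightarrow> D w = (w - 0) ^ n * u w" "\<And>w. w \<in> ball 0 e \<Longrightarrow> u w \<noteq> 0"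
      by (rule holomorphic_factor_zero_nonconstant[OF hol(1) open_ball connected_ball _ D0 nonconst])
         (use \<open>r > 0\<close> in simp, rule that)
    have "(of_nat n * u x + x * deriv u x) * (- 4 + x ^ 3 * S x) = u x * N x"
      if "x \<in> ball 0 e" "x \<noteq> 0" for x
    proof -
      have "(u has_field_derivative deriv u x) (at x)"
        using that(1) u(4) holomorphic_derivI open_ball by blast
      then have "((\<lambda>x. x ^ n * u x) has_field_derivative (of_nat n * x ^ (n - 1) * u x + x ^ n * deriv u x)) (at x)"
        by (auto intro!: derivative_eq_intros)
      then have "(D has_field_derivative (of_nat n * x ^ (n - 1) * u x + x ^ n * deriv u x)) (at x)"
        by (rule has_field_derivative_transform_within_open[OF _ open_ball that(1)]) (use u in auto)
      then have "deriv D x = of_nat n * x ^ (n - 1) * u x + x ^ n * deriv u x"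
        by (rule DERIV_imp_deriv)
      also have "\<dots> * x = x ^ n * (of_nat n * u x + x * deriv u x)"
        using u(1) by (simp add: algebra_simps power_eq_if[of x n])
      finally have "x ^ n * (of_nat n * u x + x * deriv u x) * (- 4 + x ^ 3 * S x) = x ^ n * u x * N x"
        using key[of x] u(3,5) that by auto
      then show ?thesis using that(2) by simp
    qed
    then have "(of_nat n * u 0 + 0 * deriv u 0) * (- 4 + 0 ^ 3 * S 0) = u 0 * N 0"
      using u(2,3,4) hol
      by (intro holomorphic_eq_at_0[of _ e "\<lambda>x. u x * N x"])
         (auto intro!: holomorphic_intros holomorphic_deriv intro: holomorphic_on_subset)
    then have 3: "- (of_nat n * u 0) = u 0 * 3" by (simp add: N_def)
    have "u 0 * (of_nat n + 3) = of_nat n * u 0 + u 0 * 3" by (simp add: algebra_simps)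
    also have "\<dots> = 0" unfolding 3[symmetric] by simp
    finally have "u 0 * (of_nat n + 3) = 0" .
    moreover have "u 0 \<noteq> 0" using u(2) by (intro u(6)) simp
    ultimately have "of_nat (n + 3) = (0 :: complex)" by simp
    then show False unfolding of_nat_eq_0_iff by simp
  qed
  then have "D x = D 0" using x \<open>r > 0\<close> by (metis centre_in_ball constant_on_def)
  with D0 show ?thesis by (simp add: D_def)
qed

text \<open>The properties common to actual lattices and to the degenerate value q = 0. Comparing a
  lattice with q = 0 is what excludes a vanishing discriminant.\<close>

definition weierstrass_nome :: "complex \<Rightarrow> bool" where
  "weierstrass_nome q \<longleftrightarrow> norm q < 1 \<and> countable (poles q) \<and>
     (\<exists>\<delta>>0. \<forall>x\<in>ball 0 \<delta>. x \<in> poles q \<longrightarrow> x = 0) \<and>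
     (\<forall>x. x \<notin> poles q \<longrightarrow> (deriv (wp q) x)\<^sup>2 = 4 * wp q x ^ 3 - E4 q / 12 * wp q x + E6 q / 216)"

lemma weierstrass_nome_nome: "Im z > 0 \<Longrightarrow> weierstrass_nome (nome z)"
  unfolding weierstrass_nome_def
  by (metis norm_nome countable_poles wp_ode poles_discrete zero_in_poles)

lemma sigma_series_0: "sigma_series k 0 = 0"
  by (simp add: sigma_series_def)

lemma poles_0: "poles 0 = {x. exp x = 1}"
proof -
  have "exp (- x) = 1 \<longleftrightarrow> exp x = (1 :: complex)" for x by (simp add: exp_minus)
  moreover have "(0 :: complex) ^ n * y = 1 \<longleftrightarrow> n = 0 \<and> y = 1" for n y by (cases n) auto
  ultimately show ?thesis by (auto simp: poles_def)
qed

text \<open>Here \<open>wp\<close> degenerates to koebe (exp x) + 1/12 and both Eisenstein values to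
  1; with f = 1 - exp x the differential equation is an identity of rational functions in f.\<close>

lemma weierstrass_nome_0: "weierstrass_nome 0"
  unfolding weierstrass_nome_def poles_0
proof (intro conjI allI impI)
  have "{x. exp x = 1} = range (\<lambda>k::int. of_int (2 * k) * complex_of_real pi * \<i>)"
    using exp_eq[of _ 0] by auto
  then show "countable {x :: complex. exp x = 1}" by simp
  show "\<exists>\<delta>>0. \<forall>x\<in>ball 0 \<delta>. x \<in> {x :: complex. exp x = 1} \<longrightarrow> x = 0"
  proof (intro exI[of _ 1] conjI ballI impI)
    fix x :: complex assume x: "x \<in> ball 0 1" "x \<in> {x. exp x = 1}"
    then obtain k :: int where k: "x = 2 * of_int k * complex_of_real pi * \<i>"
      using exp_eq[of x 0] by auto
    have "norm x = 2 * pi * \<bar>of_int k\<bar>" unfolding k by (simp add: norm_mult)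
    then have "2 * pi * \<bar>of_int k\<bar> < 1" using x(1) by simp
    moreover have "2 * pi * 1 \<le> 2 * pi * \<bar>of_int k\<bar>" if "k \<noteq> 0"
      using that by (intro mult_left_mono) auto
    ultimately show "x = 0" using k pi_ge_two by fastforce
  qed simp
  fix x :: complex assume x: "x \<notin> {x. exp x = 1}"
  have wp: "wp 0 = (\<lambda>x. koebe (exp x) + 1 / 12)"
    by (simp add: fun_eq_iff wp_def koebe_tail_def E2_def sigma_series_0 koebe_def)
  define f where "f = 1 - exp x"
  have f: "f \<noteq> 0" "exp x = 1 - f" using x by (simp_all add: f_def)
  have "((\<lambda>x. koebe (exp x) + 1 / 12) has_field_derivative ((1 - f) * (2 - f) / f ^ 3)) (at x)"
    unfolding koebe_def using f(1)
    by (auto intro!: derivative_eq_intros simp: f(2)) (simp add: field_simps eval_nat_numeral)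
  then have d: "deriv (wp 0) x = (1 - f) * (2 - f) / f ^ 3"
    unfolding wp by (rule DERIV_imp_deriv)
  then show "(deriv (wp 0) x)\<^sup>2 = 4 * wp 0 x ^ 3 - E4 0 / 12 * wp 0 x + E6 0 / 216"
    unfolding d unfolding wp koebe_def f(2) using f(1)
    by (simp add: E4_def E6_def sigma_series_0 field_simps eval_nat_numeral)
qed simp

text \<open>Homogeneity: l^2 \<open>wp\<close> (l x) belongs to the lattice divided by l, and the
  coefficients scale with weights 4 and 6. The remainder acquires l^8, two powers from the prefactor
  and six from x^6.\<close>

lemma scaled_wp_expansion:
  assumes "weierstrass_nome q" "l \<noteq> 0"
  obtains r C where "r > 0" "C holomorphic_on ball 0 r"
    "\<And>x. x \<in> ball 0 r \<Longrightarrow> x \<noteq> 0 \<Longrightarrow>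
       l\<^sup>2 * wp q (l * x) = 1 / x\<^sup>2 + (l ^ 4 * E4 q / 240 * x\<^sup>2 - l ^ 6 * E6 q / 6048 * x ^ 4 + x ^ 6 * C x)"
    "\<And>x. x \<in> ball 0 r \<Longrightarrow> x \<noteq> 0 \<Longrightarrow> l * x \<notin> poles q"
proof -
  obtain r C where r: "r > 0" and C: "C holomorphic_on ball 0 r"
    and wp: "\<And>x. x \<in> ball 0 r \<Longrightarrow> x \<noteq> 0 \<Longrightarrow>
       wp q x = 1 / x\<^sup>2 + E4 q / 240 * x\<^sup>2 - E6 q / 6048 * x ^ 4 + x ^ 6 * C x"
    using wp_expansion[of q] assms(1) unfolding weierstrass_nome_def by metis
  obtain \<delta> where \<delta>: "\<delta> > 0" "\<And>x. x \<in> ball 0 \<delta> \<Longrightarrow> x \<in> poles q \<Longrightarrow> x = 0"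
    using assms(1) unfolding weierstrass_nome_def by metis
  define e where "e = min r \<delta> / norm l"
  have e: "l * x \<in> ball 0 r \<and> l * x \<in> ball 0 \<delta>" if "x \<in> ball 0 e" for x
    using that assms(2) by (auto simp: e_def norm_mult field_simps)
  show thesis
  proof
    show "e > 0" using r \<delta> assms(2) by (simp add: e_def)
    have "(C \<circ> (\<lambda>x. l * x)) holomorphic_on ball 0 e"
      using e by (intro holomorphic_on_compose_gen[OF _ C] holomorphic_intros) auto
    then show "(\<lambda>x. l ^ 8 * C (l * x)) holomorphic_on ball 0 e"
      unfolding o_def by (intro holomorphic_intros)
    fix x :: complex assume x: "x \<in> ball 0 e" "x \<noteq> 0"
    have "l * x \<noteq> 0" using x assms by simp
    show "l * x \<notin> poles q" using e[OF x(1)] \<delta>(2) \<open>l * x \<noteq> 0\<close> by blast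
    have "wp q (l * x) = 1 / (l * x)\<^sup>2 + E4 q / 240 * (l * x)\<^sup>2 - E6 q / 6048 * (l * x) ^ 4 + (l * x) ^ 6 * C (l * x)"
      using wp e[OF x(1)] \<open>l * x \<noteq> 0\<close> by blast
    moreover have "l\<^sup>2 * (1 / (l * x)\<^sup>2) = 1 / x\<^sup>2" using assms x by (simp add: power_mult_distrib)
    moreover have "l\<^sup>2 * (u + E / 240 * (l * x)\<^sup>2 - F / 6048 * (l * x) ^ 4 + (l * x) ^ 6 * c) =
      l\<^sup>2 * u + (l ^ 4 * E / 240 * x\<^sup>2 - l ^ 6 * F / 6048 * x ^ 4 + x ^ 6 * (l ^ 8 * c))" for u E F c
      by (simp add: power_mult_distrib algebra_simps flip: power_add)
    ultimately show "l\<^sup>2 * wp q (l * x) = 1 / x\<^sup>2 + (l ^ 4 * E4 q / 240 * x\<^sup>2 - l ^ 6 * E6 q / 6048 * x ^ 4 + x ^ 6 * (l ^ 8 * C (l * x)))"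
      by simp
  qed
qed

lemma wp_has_field_derivative:
  assumes "norm q < 1" "x \<notin> poles q"
  shows "(wp q has_field_derivative deriv (wp q) x) (at x)"
  using holomorphic_derivI[OF wp_holomorphic[OF assms(1)]] closed_poles[OF assms(1)] assms(2)
  by (auto simp: closed_def)

lemma scaled_wp_ode:
  "weierstrass_nome q \<Longrightarrow> l \<noteq> 0 \<Longrightarrow> l * x \<notin> poles q \<Longrightarrow>
    (deriv (\<lambda>x. l\<^sup>2 * wp q (l * x)) x)\<^sup>2 =
      4 * (l\<^sup>2 * wp q (l * x)) ^ 3 - l ^ 4 * E4 q / 12 * (l\<^sup>2 * wp q (l * x)) + l ^ 6 * E6 q / 216"
proof -
  assume q: "weierstrass_nome q" and l: "l \<noteq> 0" "l * x \<notin> poles q"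
  have "((\<lambda>x. l\<^sup>2 * wp q (l * x)) has_field_derivative l\<^sup>2 * (deriv (wp q) (l * x) * l)) (at x)"
    using q l by (intro DERIV_cmult DERIV_chain'[of "\<lambda>x. l * x", OF _ wp_has_field_derivative])
      (auto simp: weierstrass_nome_def intro!: derivative_eq_intros)
  then have "deriv (\<lambda>x. l\<^sup>2 * wp q (l * x)) x = l ^ 3 * deriv (wp q) (l * x)"
    by (simp add: DERIV_imp_deriv power2_eq_square power3_eq_cube)
  then have "(deriv (\<lambda>x. l\<^sup>2 * wp q (l * x)) x)\<^sup>2 = l ^ 6 * (deriv (wp q) (l * x))\<^sup>2"
    by (simp add: power_mult_distrib flip: power_mult)
  also have "(deriv (wp q) (l * x))\<^sup>2 = 4 * wp q (l * x) ^ 3 - E4 q / 12 * wp q (l * x) + E6 q / 216"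
    using q l by (auto simp: weierstrass_nome_def)
  also have "l ^ 6 * (4 * W ^ 3 - E / 12 * W + F / 216) =
      4 * (l\<^sup>2 * W) ^ 3 - l ^ 4 * E / 12 * (l\<^sup>2 * W) + l ^ 6 * F / 216" for W E F
    by (simp add: algebra_simps eval_nat_numeral)
  finally show ?thesis .
qed

text \<open>The invariants determine the function, by uniqueness for the differential equation near \<open>0\<close> and
  analytic continuation; since it blows up at its poles, they also determine the poles.\<close>

lemma poles_determined:
  assumes z: "Im z > 0" and S: "closed S" "countable S" and Y: "Y holomorphic_on - S"
    and r: "r > 0" "A holomorphic_on ball 0 r"
    and near: "\<And>x. x \<in> ball 0 r \<Longrightarrow> x \<noteq> 0 \<Longrightarrow> x \<notin> S \<and> Y x = 1 / x\<^sup>2 + A x"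
    and ode: "\<And>x. x \<in> ball 0 r \<Longrightarrow> x \<noteq> 0 \<Longrightarrow>
      (deriv Y x)\<^sup>2 = 4 * Y x ^ 3 - E4 (nome z) / 12 * Y x + E6 (nome z) / 216"
  shows "poles (nome z) \<subseteq> S" "\<And>x. x \<notin> S \<Longrightarrow> x \<notin> poles (nome z) \<Longrightarrow> Y x = wp (nome z) x"
proof -
  let ?q = "nome z"
  let ?L = "poles ?q"
  have q: "norm ?q < 1" by (rule norm_nome[OF z])
  obtain r2 C where C: "r2 > 0" "C holomorphic_on ball 0 r2"
    "\<And>x. x \<in> ball 0 r2 \<Longrightarrow> x \<noteq> 0 \<Longrightarrow>
       1\<^sup>2 * wp ?q (1 * x) = 1 / x\<^sup>2 + (1 ^ 4 * E4 ?q / 240 * x\<^sup>2 - 1 ^ 6 * E6 ?q / 6048 * x ^ 4 + x ^ 6 * C x)"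
    "\<And>x. x \<in> ball 0 r2 \<Longrightarrow> x \<noteq> 0 \<Longrightarrow> 1 * x \<notin> ?L"
    using scaled_wp_expansion[OF weierstrass_nome_nome[OF z], of 1] by auto
  define B where "B x = E4 ?q / 240 * x\<^sup>2 - E6 ?q / 6048 * x ^ 4 + x ^ 6 * C x" for x
  have B: "B holomorphic_on ball 0 r2" unfolding B_def by (intro holomorphic_intros C) auto
  have wp: "wp ?q x = 1 / x\<^sup>2 + B x" "x \<notin> ?L" if "x \<in> ball 0 r2" "x \<noteq> 0" for x
    using C(3,4)[OF that] by (simp_all add: B_def)
  define e where "e = min r r2"
  have e: "e > 0" "ball 0 e \<subseteq> ball (0::complex) r" "ball 0 e \<subseteq> ball (0::complex) r2" using r C by (auto simp: e_def)
  have AB: "A x = B x" if x: "x \<in> ball 0 e" for x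
  proof (rule weierstrass_ode_unique[OF _ _ e(1) _ _ x, of _ _ "E4 ?q / 12" "- E6 ?q / 216"])
    fix x :: complex assume x: "x \<in> ball 0 e" "x \<noteq> 0"
    have x1: "x \<in> ball 0 r" by (rule subsetD[OF e(2) x(1)])
    have x2: "x \<in> ball 0 r2" by (rule subsetD[OF e(3) x(1)])
    show "(- 2 / x ^ 3 + deriv A x)\<^sup>2 = 4 * (1 / x\<^sup>2 + A x) ^ 3 - E4 ?q / 12 * (1 / x\<^sup>2 + A x) - - E6 ?q / 216"
      using ode[OF x1 x(2)] near[OF x1 x(2)] deriv_punctured[OF _ r(2) x1 x(2), of Y] near by simp
    show "(- 2 / x ^ 3 + deriv B x)\<^sup>2 = 4 * (1 / x\<^sup>2 + B x) ^ 3 - E4 ?q / 12 * (1 / x\<^sup>2 + B x) - - E6 ?q / 216"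
      using wp_ode[OF z wp(2)[OF x2 x(2)]] deriv_punctured[OF _ B x2 x(2), of "wp ?q"] wp(1)[OF x2 x(2)] wp(1) by simp
  qed (use r B e in \<open>auto intro: holomorphic_on_subset\<close>)
  define U where "U = - (S \<union> ?L)"
  have U: "open U" using S closed_poles[OF q] by (auto simp: U_def)
  have "connected U" unfolding U_def
    using S countable_poles by (intro path_connected_imp_connected path_connected_complement_countable) auto
  define x0 where "x0 = complex_of_real (e / 2)"
  have x0: "x0 \<in> ball 0 e - {0}" using e by (auto simp: x0_def)
  have sub: "ball 0 e - {0} \<subseteq> U" using near wp(2) e unfolding U_def by blast
  have eqU: "Y x = wp ?q x" if "x \<in> U" for x
  proof -
    have "(\<lambda>x. Y x - wp ?q x) holomorphic_on U"
      using Y wp_holomorphic[OF q] by (auto intro!: holomorphic_intros intro: holomorphic_on_subset simp: U_def)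
    moreover have "x0 islimpt (ball 0 e - {0})"
      using x0 by (intro interior_limit_point) (simp add: interior_open open_Diff)
    moreover have "Y y - wp ?q y = 0" if "y \<in> ball 0 e - {0}" for y
    proof -
      have "y \<in> ball 0 r" "y \<in> ball 0 r2" using that e(2,3) by auto
      then show ?thesis using near[of y] wp[of y] AB[of y] that by auto
    qed
    ultimately have "Y x - wp ?q x = 0"
      using analytic_continuation[OF _ U \<open>connected U\<close> sub _ _ _ that] x0 sub by blast
    then show ?thesis by simp
  qed
  then show "\<And>x. x \<notin> S \<Longrightarrow> x \<notin> ?L \<Longrightarrow> Y x = wp ?q x" by (auto simp: U_def)
  show "?L \<subseteq> S"
  proof
    fix \<omega> assume \<omega>: "\<omega> \<in> ?L"
    show "\<omega> \<in> S"
    proof (rule ccontr)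
      \<comment> \<open>Continuity of Y at \<omega> makes x^2 Y(\<omega> + x) tend to 0, whereas by
        periodicity of \<open>wp\<close> it equals 1 + x^2 B x near 0 and tends to 1.\<close>
      assume nS: "\<omega> \<notin> S"
      have opS: "open (- S)" using S by auto
      have "isCont Y \<omega>"
        using holomorphic_on_imp_continuous_on[OF Y] nS opS by (metis ComplI continuous_on_eq_continuous_at)
      then have "((\<lambda>x. Y (\<omega> + x)) \<longlongrightarrow> Y \<omega>) (at 0)"
        by (simp add: isCont_def LIM_offset_zero)
      then have "((\<lambda>x. x\<^sup>2 * Y (\<omega> + x)) \<longlongrightarrow> 0\<^sup>2 * Y \<omega>) (at 0)"
        by (intro tendsto_intros)
      moreover have "\<forall>\<^sub>F x in at 0. x\<^sup>2 * Y (\<omega> + x) = 1 + x\<^sup>2 * B x"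
      proof -
        obtain d where d: "d > 0" "ball \<omega> d \<subseteq> - S" using opS nS open_contains_ball by (metis ComplI)
        have "x\<^sup>2 * Y (\<omega> + x) = 1 + x\<^sup>2 * B x" if "x \<noteq> 0" "norm x < min d e" for x
        proof -
          have x: "x \<in> ball 0 r2" using that e by auto
          have "\<omega> + x \<notin> S" using d(2) that by (auto simp: subset_iff dist_norm)
          moreover have "\<omega> + x \<notin> ?L" using poles_add_iff[OF \<omega>, of x] wp(2)[OF x that(1)] by (simp add: add.commute)
          ultimately have "Y (\<omega> + x) = wp ?q x" using eqU wp_periodic[OF z \<omega>, of x] by (simp add: U_def add.commute)
          then show ?thesis using wp(1)[OF x that(1)] that(1) by (simp add: algebra_simps)
        qed
        then show ?thesis using d e unfolding eventually_at
          by (intro exI[of _ "min d e"]) (auto simp: dist_norm)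
      qed
      ultimately have "((\<lambda>x. 1 + x\<^sup>2 * B x) \<longlongrightarrow> 0) (at 0)"
        using Lim_transform_eventually by fastforce
      moreover have "isCont B 0"
        using B C(1) by (rule holomorphic_on_ball_isCont)
      then have "((\<lambda>x. 1 + x\<^sup>2 * B x) \<longlongrightarrow> 1 + 0\<^sup>2 * B 0) (at 0)"
        unfolding isCont_def by (intro tendsto_intros)
      ultimately show False using LIM_unique by fastforce
    qed
  qed
qed

lemma poles_scaled:
  assumes w: "Im w > 0" and q: "weierstrass_nome q" and l: "l \<noteq> 0"
    and eq: "E4 (nome w) = l ^ 4 * E4 q" "E6 (nome w) = l ^ 6 * E6 q"
  shows "\<And>x. x \<in> poles (nome w) \<Longrightarrow> l * x \<in> poles q"
    "\<And>x. x \<notin> poles (nome w) \<Longrightarrow> l * x \<notin> poles q \<Longrightarrow> l\<^sup>2 * wp q (l * x) = wp (nome w) x"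
proof -
  have q1: "norm q < 1" and cq: "countable (poles q)" using q by (auto simp: weierstrass_nome_def)
  obtain r C where C: "r > 0" "C holomorphic_on ball 0 r"
    "\<And>x. x \<in> ball 0 r \<Longrightarrow> x \<noteq> 0 \<Longrightarrow>
       l\<^sup>2 * wp q (l * x) = 1 / x\<^sup>2 + (l ^ 4 * E4 q / 240 * x\<^sup>2 - l ^ 6 * E6 q / 6048 * x ^ 4 + x ^ 6 * C x)"
    "\<And>x. x \<in> ball 0 r \<Longrightarrow> x \<noteq> 0 \<Longrightarrow> l * x \<notin> poles q"
    using scaled_wp_expansion[OF q l] by metis
  define A where "A x = l ^ 4 * E4 q / 240 * x\<^sup>2 - l ^ 6 * E6 q / 6048 * x ^ 4 + x ^ 6 * C x" for x
  define S where "S = (\<lambda>x. l * x) -` poles q"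
  define Y where "Y x = l\<^sup>2 * wp q (l * x)" for x
  have "closed S" unfolding S_def using closed_poles[OF q1] by (intro closed_vimage continuous_intros)
  have "S = (\<lambda>x. x / l) ` poles q" using l by (force simp: S_def)
  then have "countable S" using cq by simp
  have "(wp q \<circ> (\<lambda>x. l * x)) holomorphic_on - S"
    by (intro holomorphic_on_compose_gen[OF _ wp_holomorphic[OF q1]] holomorphic_intros) (auto simp: S_def)
  then have "Y holomorphic_on - S" unfolding Y_def o_def by (intro holomorphic_intros)
  have "A holomorphic_on ball 0 r" unfolding A_def by (intro holomorphic_intros C) auto
  note * = poles_determined[OF w \<open>closed S\<close> \<open>countable S\<close> \<open>Y holomorphic_on - S\<close> C(1) this]
  have near: "x \<notin> S \<and> Y x = 1 / x\<^sup>2 + A x" if "x \<in> ball 0 r" "x \<noteq> 0" for x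
    using C(3,4)[OF that] by (simp add: S_def Y_def A_def)
  have ode: "(deriv Y x)\<^sup>2 = 4 * Y x ^ 3 - E4 (nome w) / 12 * Y x + E6 (nome w) / 216"
    if "x \<in> ball 0 r" "x \<noteq> 0" for x
    using scaled_wp_ode[OF q l C(4)[OF that]] unfolding eq Y_def .
  show "\<And>x. x \<in> poles (nome w) \<Longrightarrow> l * x \<in> poles q"
    using *(1)[OF near ode] by (auto simp: S_def)
  show "\<And>x. x \<notin> poles (nome w) \<Longrightarrow> l * x \<notin> poles q \<Longrightarrow> l\<^sup>2 * wp q (l * x) = wp (nome w) x"
    using *(2)[OF near ode] by (auto simp: S_def Y_def)
qed

text \<open>Using \<open>poles_scaled\<close> in both directions, multiplication by l maps the
  lattice of w onto that of z; the coordinates of l and l w form the matrix. The rule for E2 arises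
  because \<open>wzeta\<close> for w and its rescaled counterpart for z have derivatives that differ
  by a constant, while their increments under translation are known.\<close>

lemma E4_E6_eq_imp_modular:
  assumes z: "Im z > 0" and w: "Im w > 0" and l: "l \<noteq> 0"
    and eq: "E4 (nome w) = l ^ 4 * E4 (nome z)" "E6 (nome w) = l ^ 6 * E6 (nome z)"
  obtains a b c d :: int where "l = of_int c * z + of_int d" "l * w = of_int a * z + of_int b"
    "a * d - b * c = 1" "E2 (nome w) = l\<^sup>2 * E2 (nome z) + 12 * of_int c * l / (2 * of_real pi * \<i>)"
proof -
  let ?t = "2 * of_real pi * \<i> :: complex"
  note Z = weierstrass_nome_nome[OF z] and W = weierstrass_nome_nome[OF w]
  note p = poles_scaled[OF w Z l eq]
  have eq': "E4 (nome z) = (1 / l) ^ 4 * E4 (nome w)" "E6 (nome z) = (1 / l) ^ 6 * E6 (nome w)"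
    using eq l by (simp_all add: power_divide)
  have p': "1 / l * x \<in> poles (nome w)" if "x \<in> poles (nome z)" for x
    using poles_scaled(1)[OF z W _ eq' that] l by simp
  have coord: "\<exists>m n::int. l * (of_int i + of_int j * w) = of_int m + of_int n * z" for i j :: int
    using p(1)[OF poles_nomeI[of i j w]] unfolding poles_nome_iff by (auto simp: mult.left_commute[of l])
  have coord': "\<exists>m n::int. of_int i + of_int j * z = l * (of_int m + of_int n * w)" for i j :: int
  proof -
    obtain m n :: int where "1 / l * (?t * (of_int i + of_int j * z)) = ?t * (of_int m + of_int n * w)"
      using p'[OF poles_nomeI[of i j z]] unfolding poles_nome_iff by blast
    then have "?t * (1 / l * (of_int i + of_int j * z)) = ?t * (of_int m + of_int n * w)"
      by (simp only: mult.left_commute)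
    then have "1 / l * (of_int i + of_int j * z) = of_int m + of_int n * w"
      by (subst (asm) mult_cancel_left) simp
    then have "l * (1 / l * (of_int i + of_int j * z)) = l * (of_int m + of_int n * w)" by simp
    then show ?thesis using l by auto
  qed
  obtain c d :: int where cd: "l = of_int d + of_int c * z" using coord[of 1 0] by auto
  obtain a b :: int where ab: "l * w = of_int b + of_int a * z" using coord[of 0 1] by auto
  obtain m n :: int where "of_int 1 + of_int 0 * z = l * (of_int m + of_int n * w)" using coord'[of 1 0] by blast
  also have "\<dots> = of_int m * l + of_int n * (l * w)" by (simp add: algebra_simps)
  also have "\<dots> = of_int (m * d + n * b) + of_int (m * c + n * a) * z"
    unfolding ab unfolding cd by (simp add: algebra_simps)
  finally have mn: "1 = m * d + n * b" "0 = m * c + n * a" using int_basis_eq_iff[OF z] by blast+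
  obtain i j :: int where "of_int 0 + of_int 1 * z = l * (of_int i + of_int j * w)" using coord'[of 0 1] by blast
  also have "\<dots> = of_int i * l + of_int j * (l * w)" by (simp add: algebra_simps)
  also have "\<dots> = of_int (i * d + j * b) + of_int (i * c + j * a) * z"
    unfolding ab unfolding cd by (simp add: algebra_simps)
  finally have ij: "0 = i * d + j * b" "1 = i * c + j * a" using int_basis_eq_iff[OF z] by blast+
  \<comment> \<open>The matrix and its inverse are both integral, so the determinant is a unit. Its
    sign is positive because it is the ratio of Im (l w cnj l) to Im z.\<close>
  have "(m * j - n * i) * (a * d - b * c) = (m * d + n * b) * (i * c + j * a) - (m * c + n * a) * (i * d + j * b)"
    by (simp add: algebra_simps)
  then have "(m * j - n * i) * (a * d - b * c) = 1" using mn ij by simp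
  then have unit: "a * d - b * c dvd 1" by (metis dvd_triv_right)
  have "Im (l * w * cnj l) = of_int (a * d - b * c) * Im z"
    unfolding ab unfolding cd by (simp add: algebra_simps)
  moreover have "l * w * cnj l = of_real ((norm l)\<^sup>2) * w" by (simp add: complex_norm_square[symmetric])
  then have "Im (l * w * cnj l) = (norm l)\<^sup>2 * Im w" by (metis Im_complex_of_real Re_complex_of_real mult_zero_left
        add.right_neutral times_complex.simps(2))
  ultimately have "of_int (a * d - b * c) * Im z > 0" using w l by simp
  then have "0 < real_of_int (a * d - b * c)" by (rule zero_less_mult_pos2[OF _ z])
  then have "a * d - b * c > 0" by (rule of_int_0_less_iff[THEN iffD1])
  with unit have det: "a * d - b * c = 1" by (simp add: zdvd1_eq)
  define U where "U = - poles (nome w)"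
  have U: "open U" "connected U"
    unfolding U_def using closed_poles[OF norm_nome[OF w]] countable_poles
    by (auto intro!: path_connected_imp_connected path_connected_complement_countable)
  have lU: "l * x \<notin> poles (nome z)" if "x \<in> U" for x
    using p'[of "l * x"] that l by (auto simp: U_def)
  \<comment> \<open>The constant difference of the two derivatives, chosen so that D has derivative
    0 on the connected set U.\<close>
  define K where "K = - (E2 (nome w) - l\<^sup>2 * E2 (nome z)) / 12"
  define D where "D x = wzeta (nome w) x - l * wzeta (nome z) (l * x) - K * x" for x
  have "(D has_field_derivative 0) (at x)" if "x \<in> U" for x
  proof -
    have "((\<lambda>x. wzeta (nome z) (l * x)) has_field_derivative (wp (nome z) (l * x) - E2 (nome z) / 12) * l) (at x)"
      by (rule DERIV_chain'[of "\<lambda>x. l * x", OF _ wzeta_has_field_derivative[OF norm_nome[OF z] lU[OF that]]])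
         (auto intro!: derivative_eq_intros)
    moreover have "(wzeta (nome w) has_field_derivative (wp (nome w) x - E2 (nome w) / 12)) (at x)"
      using that by (intro wzeta_has_field_derivative norm_nome w) (auto simp: U_def)
    ultimately have "(D has_field_derivative (wp (nome w) x - E2 (nome w) / 12 -
        l * ((wp (nome z) (l * x) - E2 (nome z) / 12) * l) - K * 1)) (at x)"
      unfolding D_def by (intro DERIV_diff DERIV_cmult DERIV_ident)
    also have "wp (nome w) x - E2 (nome w) / 12 - l * ((wp (nome z) (l * x) - E2 (nome z) / 12) * l) - K * 1 = 0"
      using p(2)[OF _ lU[OF that]] that by (simp add: U_def K_def field_simps power2_eq_square)
    finally show ?thesis .
  qed
  then have const: "D x = D y" if "x \<in> U" "y \<in> U" for x y
  proof -
    have "continuous_on U D"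
      using \<open>\<And>x. x \<in> U \<Longrightarrow> (D has_field_derivative 0) (at x)\<close>
      by (intro continuous_at_imp_continuous_on ballI DERIV_isCont)
    then obtain k where "\<And>x. x \<in> U \<Longrightarrow> D x = k"
      using DERIV_zero_connected_constant[OF U(2,1) finite.emptyI]
        \<open>\<And>x. x \<in> U \<Longrightarrow> (D has_field_derivative 0) (at x)\<close> by (metis Diff_empty)
    then show ?thesis using that by simp
  qed
  obtain x where x: "x \<in> U"
    using poles_discrete[OF w]
  proof -
    have "U \<noteq> {}"
      using countable_poles[of w] uncountable_UNIV_complex unfolding U_def by (metis Compl_empty_eq double_compl)
    then show ?thesis using that by blast
  qed
  \<comment> \<open>The translation 2 \<pi> i is a true period of \<open>wzeta\<close> for w, but l
    times it is 2 \<pi> i (d + c z), whose quasi-period for z is c. Equality of D at both points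
    therefore determines K.\<close>
  have "x + ?t \<in> U" using x poles_add_iff[OF poles_nomeI[of 1 0 w], of x] by (simp add: U_def)
  then have "D (x + ?t) = D x" using const x by blast
  moreover have "l * (x + ?t) = l * x + ?t * (of_int d + of_int c * z)"
    using cd by (simp add: algebra_simps)
  then have "wzeta (nome z) (l * (x + ?t)) = wzeta (nome z) (l * x) + of_int c"
    using wzeta_quasiperiodic[OF z lU[OF x]] by metis
  ultimately have "l * of_int c + K * ?t = 0"
    unfolding D_def wzeta_plus_2pi by (simp add: algebra_simps)
  then have "- l * of_int c = K * ?t" by (simp add: add_eq_0_iff)
  then have "K = - l * of_int c / ?t" by simp
  moreover have "E2 (nome w) = l\<^sup>2 * E2 (nome z) - 12 * K" by (simp add: K_def field_simps)
  ultimately have "E2 (nome w) = l\<^sup>2 * E2 (nome z) + 12 * of_int c * l / ?t" by simp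
  with cd ab det show thesis by (intro that[of c d a b]) (simp_all add: add.commute)
qed

text \<open>The lattice of w is that of z divided by l, so l^2 \<open>wp\<close> (l x) minus
  \<open>wp\<close> for w is elliptic. The double poles at 0 cancel and the difference tends to 0
  there; hence it vanishes identically, and so do its coefficients of x^2 and x^4.\<close>

lemma E4_E6_modular:
  fixes a b c d :: int
  assumes z: "Im z > 0" and det: "a * d - b * c = 1"
  defines "l \<equiv> of_int c * z + of_int d"
  defines "w \<equiv> (of_int a * z + of_int b) / l"
  shows "l \<noteq> 0" "Im w = Im z / (norm l)\<^sup>2" "E4 (nome w) = l ^ 4 * E4 (nome z)" "E6 (nome w) = l ^ 6 * E6 (nome z)"
proof -
  show l: "l \<noteq> 0"
  proof
    assume "l = 0"
    then have "of_int d + of_int c * z = of_int 0 + of_int 0 * z" by (simp add: l_def add.commute)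
    then have "d = 0 \<and> c = 0" using int_basis_eq_iff[OF z] by blast
    with det show False by simp
  qed
  have "w = (of_int a * z + of_int b) * cnj l / of_real ((norm l)\<^sup>2)"
    using l by (simp only: w_def complex_norm_square) simp
  then have "Im w = Im ((of_int a * z + of_int b) * cnj l) / (norm l)\<^sup>2" by (metis Im_divide_of_real)
  also have "Im ((of_int a * z + of_int b) * cnj l) = of_int (a * d - b * c) * Im z"
    by (simp add: l_def algebra_simps)
  finally show Imw: "Im w = Im z / (norm l)\<^sup>2" using det by simp
  have w: "Im w > 0" using Imw z l by simp
  have lw: "l * w = of_int a * z + of_int b" using l by (simp add: w_def)
  have iff: "l * x \<in> poles (nome z) \<longleftrightarrow> x \<in> poles (nome w)" for x
  proof
    assume "l * x \<in> poles (nome z)"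
    then obtain m n :: int where mn: "l * x = 2 * of_real pi * \<i> * (of_int m + of_int n * z)"
      unfolding poles_nome_iff by blast
    \<comment> \<open>The adjugate matrix recovers 1 and z from l and l w, which gives integral
      coordinates for the converse inclusion of lattices.\<close>
    have 1: "of_int a * l - of_int c * (l * w) = of_int (a * d - b * c)"
      unfolding lw unfolding l_def by (simp add: algebra_simps)
    have 2: "of_int d * (l * w) - of_int b * l = of_int (a * d - b * c) * z"
      unfolding lw unfolding l_def by (simp add: algebra_simps)
    have "of_int m + of_int n * z = of_int m * (of_int a * l - of_int c * (l * w)) + of_int n * (of_int d * (l * w) - of_int b * l)"
      unfolding 1 2 det by simp
    also have "\<dots> = l * (of_int (m * a - n * b) + of_int (n * d - m * c) * w)" by (simp add: algebra_simps)
    finally have "x = 2 * of_real pi * \<i> * (of_int (m * a - n * b) + of_int (n * d - m * c) * w)"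
      using mn l by simp
    then show "x \<in> poles (nome w)" by blast
  next
    assume "x \<in> poles (nome w)"
    then obtain m n :: int where mn: "x = 2 * of_real pi * \<i> * (of_int m + of_int n * w)"
      unfolding poles_nome_iff by blast
    have "l * x = 2 * of_real pi * \<i> * (of_int m * l + of_int n * (l * w))"
      unfolding mn by (simp add: algebra_simps)
    also have "\<dots> = 2 * of_real pi * \<i> * (of_int (m * d + n * b) + of_int (m * c + n * a) * z)"
      unfolding lw unfolding l_def by (simp add: algebra_simps)
    finally show "l * x \<in> poles (nome z)" by (metis poles_nomeI)
  qed
  note Z = weierstrass_nome_nome[OF z] and W = weierstrass_nome_nome[OF w]
  obtain r1 C1 where 1: "r1 > 0" "C1 holomorphic_on ball 0 r1"
    "\<And>x. x \<in> ball 0 r1 \<Longrightarrow> x \<noteq> 0 \<Longrightarrow>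
       l\<^sup>2 * wp (nome z) (l * x) = 1 / x\<^sup>2 + (l ^ 4 * E4 (nome z) / 240 * x\<^sup>2 - l ^ 6 * E6 (nome z) / 6048 * x ^ 4 + x ^ 6 * C1 x)"
    using scaled_wp_expansion[OF Z l] by metis
  obtain r2 C2 where 2: "r2 > 0" "C2 holomorphic_on ball 0 r2"
    "\<And>x. x \<in> ball 0 r2 \<Longrightarrow> x \<noteq> 0 \<Longrightarrow>
       1\<^sup>2 * wp (nome w) (1 * x) = 1 / x\<^sup>2 + (1 ^ 4 * E4 (nome w) / 240 * x\<^sup>2 - 1 ^ 6 * E6 (nome w) / 6048 * x ^ 4 + x ^ 6 * C2 x)"
    "\<And>x. x \<in> ball 0 r2 \<Longrightarrow> x \<noteq> 0 \<Longrightarrow> 1 * x \<notin> poles (nome w)"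
    using scaled_wp_expansion[OF W, of 1] by auto
  define e where "e = min r1 r2"
  define \<alpha> where "\<alpha> = (l ^ 4 * E4 (nome z) - E4 (nome w)) / 240"
  define \<beta> where "\<beta> = (l ^ 6 * E6 (nome z) - E6 (nome w)) / 6048"
  define C where "C x = C1 x - C2 x" for x
  have C: "C holomorphic_on ball 0 e" unfolding C_def
    using 1 2 by (intro holomorphic_intros) (auto intro: holomorphic_on_subset simp: e_def)
  define f where "f x = l\<^sup>2 * wp (nome z) (l * x) - wp (nome w) x" for x
  have e: "e > 0" using 1 2 by (simp add: e_def)
  have f: "f x = x\<^sup>2 * (\<alpha> - \<beta> * x\<^sup>2 + x ^ 4 * C x)" if "x \<in> ball 0 e" "x \<noteq> 0" for x
  proof -
    have poly: "(u + (A / 240 * x\<^sup>2 - B / 6048 * x ^ 4 + x ^ 6 * s)) - (u + (A' / 240 * x\<^sup>2 - B' / 6048 * x ^ 4 + x ^ 6 * s')) =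
        x\<^sup>2 * ((A - A') / 240 - (B - B') / 6048 * x\<^sup>2 + x ^ 4 * (s - s'))" for u A B s A' B' s'
      by (simp add: algebra_simps diff_divide_distrib flip: power_add)
    have "x \<in> ball 0 r1" "x \<in> ball 0 r2" using that by (auto simp: e_def)
    then show ?thesis
      using 1(3)[OF _ that(2)] 2(3)[OF _ that(2)] unfolding f_def \<alpha>_def \<beta>_def C_def
      by (simp only: power_one mult_1_left poly)
  qed
  have f0: "f x = 0" if "x \<notin> poles (nome w)" for x
  proof (rule elliptic_constant[OF w _ _ _ that])
    have "(wp (nome z) \<circ> (\<lambda>x. l * x)) holomorphic_on - poles (nome w)"
      by (intro holomorphic_on_compose_gen[OF _ wp_holomorphic[OF norm_nome[OF z]]] holomorphic_intros) (auto simp: iff)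
    then show "f holomorphic_on - poles (nome w)"
      unfolding f_def o_def by (intro holomorphic_intros wp_holomorphic norm_nome w)
    show "f (x + \<omega>) = f x" if "\<omega> \<in> poles (nome w)" for x \<omega>
      unfolding f_def using wp_periodic[OF w that] wp_periodic[OF z, of "l * \<omega>" "l * x"] that iff
      by (simp add: distrib_left)
    have "(\<lambda>x. x\<^sup>2 * (\<alpha> - \<beta> * x\<^sup>2 + x ^ 4 * C x)) holomorphic_on ball 0 e"
      by (intro holomorphic_intros C)
    then have "isCont (\<lambda>x. x\<^sup>2 * (\<alpha> - \<beta> * x\<^sup>2 + x ^ 4 * C x)) 0"
      using e by (rule holomorphic_on_ball_isCont)
    then have "((\<lambda>x. x\<^sup>2 * (\<alpha> - \<beta> * x\<^sup>2 + x ^ 4 * C x)) \<longlongrightarrow> 0) (at 0)" by (simp add: isCont_def)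
    moreover have "\<forall>\<^sub>F x in at 0. x\<^sup>2 * (\<alpha> - \<beta> * x\<^sup>2 + x ^ 4 * C x) = f x"
      using e f unfolding eventually_at by (intro exI[of _ e]) auto
    ultimately show "(f \<longlongrightarrow> 0) (at 0)" by (rule Lim_transform_eventually)
  qed
  have z1: "\<alpha> - \<beta> * x\<^sup>2 + x ^ 4 * C x = 0" if "x \<in> ball 0 e" "x \<noteq> 0" for x
    using f[OF that] f0[of x] 2(4)[of x] that by (auto simp: e_def)
  have "\<alpha> - \<beta> * 0\<^sup>2 + 0 ^ 4 * C 0 = 0"
    by (rule holomorphic_eq_at_0[OF _ _ e z1]) (intro holomorphic_intros C)+
  then have \<alpha>: "\<alpha> = 0" by simp
  have z2: "- \<beta> + x ^ 2 * C x = 0" if "x \<in> ball 0 e" "x \<noteq> 0" for x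
  proof -
    have "x\<^sup>2 * (- \<beta> + x ^ 2 * C x) = 0"
      using z1[OF that] \<alpha> by (simp add: algebra_simps flip: power_add)
    with that show ?thesis by simp
  qed
  have "- \<beta> + 0\<^sup>2 * C 0 = 0"
    by (rule holomorphic_eq_at_0[OF _ _ e z2]) (intro holomorphic_intros C)+
  then show "E4 (nome w) = l ^ 4 * E4 (nome z)" "E6 (nome w) = l ^ 6 * E6 (nome z)"
    using \<alpha> by (simp_all add: \<alpha>_def \<beta>_def)
qed

text \<open>If the discriminant vanished, the Weierstrass function would be a rescaling of its degeneration
  at \<open>q = 0\<close> or at \<open>\<infinity>\<close>, whose poles have rank at most one.\<close>

lemma discriminant_nonzero:
  assumes z: "Im z > 0"
  shows "E4 (nome z) ^ 3 \<noteq> E6 (nome z) ^ 2"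
proof
  let ?q = "nome z" and ?t = "2 * of_real pi * \<i> :: complex"
  assume eq: "E4 ?q ^ 3 = E6 ?q ^ 2"
  have t: "?t \<in> poles ?q" and tz: "?t * z \<in> poles ?q"
    using poles_nomeI[of 1 0 z] poles_nomeI[of 0 1 z] by simp_all
  show False
  proof (cases "E4 ?q = 0")
    case True
    then have 0: "E6 ?q = 0" using eq by simp
    have "poles ?q \<subseteq> {0}"
    proof (rule poles_determined(1)[OF z, of _ "\<lambda>x. 1 / x\<^sup>2" 1 "\<lambda>_. 0"])
      show "(\<lambda>x. 1 / x\<^sup>2 :: complex) holomorphic_on - {0}" by (intro holomorphic_intros) auto
      fix x :: complex assume x: "x \<in> ball 0 1" "x \<noteq> 0"
      then have "deriv (\<lambda>x. 1 / x\<^sup>2) x = - 2 / x ^ 3"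
        using deriv_punctured[of 1 "\<lambda>x. 1 / x\<^sup>2" "\<lambda>_. 0" x] by simp
      then show "(deriv (\<lambda>x. 1 / x\<^sup>2) x)\<^sup>2 = 4 * (1 / x\<^sup>2) ^ 3 - E4 ?q / 12 * (1 / x\<^sup>2) + E6 ?q / 216"
        using True 0 by (simp add: power_divide flip: power_mult)
    qed auto
    with t show False by auto
  next
    case False
    \<comment> \<open>When E4^3 = E6^2, a square root of E6/E4 has fourth power E4 and sixth power
      E6, so the lattice has the invariants of q = 0 rescaled by l.\<close>
    define l where "l = csqrt (E6 ?q / E4 ?q)"
    have l2: "l\<^sup>2 = E6 ?q / E4 ?q" by (simp add: l_def)
    have "E6 ?q \<noteq> 0" using eq False by auto
    then have l: "l \<noteq> 0" using l2 False by auto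
    have "l ^ 4 = (l\<^sup>2)\<^sup>2" "l ^ 6 = (l\<^sup>2) ^ 3" by (simp_all flip: power_mult)
    moreover have "(E6 ?q / E4 ?q)\<^sup>2 = E4 ?q"
      unfolding power_divide eq[symmetric] using False by (simp add: eval_nat_numeral)
    moreover have "(E6 ?q / E4 ?q) ^ 3 = E6 ?q"
      unfolding power_divide eq using \<open>E6 ?q \<noteq> 0\<close> by (simp add: eval_nat_numeral)
    ultimately have "E4 ?q = l ^ 4" "E6 ?q = l ^ 6" unfolding l2 by simp_all
    then have "E4 ?q = l ^ 4 * E4 0" "E6 ?q = l ^ 6 * E6 0" by (simp_all add: E4_def E6_def sigma_series_0)
    note p = poles_scaled(1)[OF z weierstrass_nome_0 l this]
    \<comment> \<open>Both l and l z turn out to be integers, with l nonzero, which would make z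
      real.\<close>
    have "exp (l * ?t) = exp 0" "exp (l * (?t * z)) = exp 0" using p[OF t] p[OF tz] by (simp_all add: poles_0)
    then obtain j k :: int where "l * ?t = 0 + of_real (of_int (2 * j) * pi) * \<i>" "l * (?t * z) = 0 + of_real (of_int (2 * k) * pi) * \<i>"
      unfolding exp_eq by blast
    then have "l = of_int j" "l * z = of_int k" by (simp_all add: field_simps)
    then have "Im (of_int j * z) = 0" by simp
    then show False using z l \<open>l = of_int j\<close> by simp
  qed
qed

section \<open>Surjectivity of the modular invariant\<close>

text \<open>The classical j divided by 1728.\<close>

definition modular_J :: "complex \<Rightarrow> complex" where
  "modular_J z = E4 (nome z) ^ 3 / (E4 (nome z) ^ 3 - E6 (nome z) ^ 2)"

lemma nome_holomorphic: "nome holomorphic_on A"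
  unfolding nome_def by (intro holomorphic_intros)

lemma
  assumes "\<And>z. z \<in> A \<Longrightarrow> Im z > 0"
  shows E2_nome_holomorphic: "(\<lambda>z. E2 (nome z)) holomorphic_on A"
    and E4_nome_holomorphic: "(\<lambda>z. E4 (nome z)) holomorphic_on A"
    and E6_nome_holomorphic: "(\<lambda>z. E6 (nome z)) holomorphic_on A"
proof -
  have "nome ` A \<subseteq> ball 0 1" using assms norm_nome by auto
  then have "(sigma_series k \<circ> nome) holomorphic_on A" for k
    by (intro holomorphic_on_compose_gen[OF nome_holomorphic sigma_series_holomorphic])
  then have *: "(\<lambda>z. sigma_series k (nome z)) holomorphic_on A" for k by (simp add: o_def)
  show "(\<lambda>z. E2 (nome z)) holomorphic_on A" "(\<lambda>z. E4 (nome z)) holomorphic_on A" "(\<lambda>z. E6 (nome z)) holomorphic_on A"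
    unfolding E2_def E4_def E6_def by (intro holomorphic_intros *)+
qed

lemma modular_J_holomorphic: "modular_J holomorphic_on {z. Im z > 0}"
  unfolding modular_J_def
  by (intro holomorphic_intros E4_nome_holomorphic E6_nome_holomorphic) (auto simp: discriminant_nonzero)

text \<open>The shortest nonzero lattice vector \<open>c z + d\<close> yields the reduction to the fundamental domain.\<close>

lemma modular_J_reduction:
  assumes z: "Im z > 0"
  obtains w where "1 / 2 \<le> Im w" "\<bar>Re w\<bar> \<le> 1 / 2" "modular_J w = modular_J z"
proof -
  define N where "N = (\<lambda>(c::int,d::int). norm (of_int c * z + of_int d))"
  define M where "M = \<lceil>1 / Im z\<rceil> + \<lceil>1 + (1 / Im z) * norm z\<rceil>"
  \<comment> \<open>Restricting to length at most 1 makes the set finite, and it contains (0, 1); so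
    a minimum over it is a minimum over all nonzero vectors.\<close>
  define V where "V = {p. N p \<le> 1 \<and> p \<noteq> (0,0)}"
  have "V \<subseteq> {-M..M} \<times> {-M..M}"
  proof
    fix p assume "p \<in> V"
    then obtain c d where p: "p = (c,d)" "norm (of_int c * z + of_int d) \<le> 1" by (cases p) (auto simp: V_def N_def)
    have "\<bar>of_int c\<bar> * Im z = \<bar>Im (of_int c * z + of_int d)\<bar>" using z by (simp add: abs_mult)
    also have "\<dots> \<le> 1" using abs_Im_le_cmod p(2) by (rule order_trans)
    finally have c: "\<bar>of_int c\<bar> \<le> 1 / Im z" using z by (simp add: field_simps)
    have "\<bar>of_int d\<bar> = norm ((of_int c * z + of_int d) - of_int c * z)" by simp
    also have "\<dots> \<le> 1 + \<bar>of_int c\<bar> * norm z"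
      by (rule order_trans[OF norm_triangle_ineq4]) (use p(2) in \<open>simp add: norm_mult\<close>)
    also have "\<dots> \<le> 1 + (1 / Im z) * norm z" using c by (intro add_left_mono mult_right_mono) auto
    finally have d: "\<bar>of_int d\<bar> \<le> 1 + (1 / Im z) * norm z" .
    have ceil: "0 \<le> \<lceil>x\<rceil>" if "0 \<le> x" for x :: real using that by linarith
    have "0 \<le> \<lceil>1 / Im z\<rceil>" "0 \<le> \<lceil>1 + (1 / Im z) * norm z\<rceil>" by (rule ceil; use z in simp)+
    moreover have "\<bar>c\<bar> \<le> \<lceil>1 / Im z\<rceil>" "\<bar>d\<bar> \<le> \<lceil>1 + (1 / Im z) * norm z\<rceil>"
      using c d by (simp_all add: le_ceiling_iff)
    ultimately show "p \<in> {-M..M} \<times> {-M..M}" unfolding p M_def by auto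
  qed
  then have "finite V" by (rule finite_subset) auto
  moreover have "(0,1) \<in> V" by (simp add: V_def N_def)
  ultimately obtain p where p: "p \<in> V" "\<And>v. v \<in> V \<Longrightarrow> N p \<le> N v"
    using ex_min_if_finite[of "N ` V"] by (metis (no_types, lifting) empty_iff finite_imageI image_iff image_is_empty not_le)
  obtain c d where cd: "p = (c,d)" by force
  define l where "l = of_int c * z + of_int d"
  have min: "norm l \<le> norm (of_int c' * z + of_int d')" if "(c',d') \<noteq> (0,0)" for c' d' :: int
  proof -
    have N: "N (c',d') = norm (of_int c' * z + of_int d')" "N p = norm l" by (simp_all add: N_def l_def cd)
    show ?thesis
    proof (cases "N (c',d') \<le> 1")
      case True
      then show ?thesis using p(2)[of "(c',d')"] that N by (simp add: V_def)
    next
      case False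
      then show ?thesis using p(1) N by (simp add: V_def)
    qed
  qed
  have l0: "l \<noteq> 0"
  proof
    assume "l = 0"
    then have "of_int d + of_int c * z = of_int 0 + of_int 0 * z" by (simp add: l_def add.commute)
    then have "d = 0 \<and> c = 0" using int_basis_eq_iff[OF z] by blast
    with p(1) cd show False by (simp add: V_def)
  qed
  \<comment> \<open>A shortest vector is primitive, since dividing by the gcd would shorten it. By
    Bezout it is the bottom row of an integer matrix of determinant 1.\<close>
  define e where "e = gcd c d"
  obtain c' d' where c'd': "c = e * c'" "d = e * d'" unfolding e_def by (meson dvdE gcd_dvd1 gcd_dvd2)
  have "c' \<noteq> 0 \<or> d' \<noteq> 0" using c'd' p(1) cd by (auto simp: V_def)
  then have "norm l \<le> norm (of_int c' * z + of_int d')" by (intro min) auto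
  moreover have le: "l = of_int e * (of_int c' * z + of_int d')" by (simp add: l_def c'd' algebra_simps)
  then have "norm l = of_int e * norm (of_int c' * z + of_int d')"
    by (simp add: norm_mult e_def)
  moreover have "norm (of_int c' * z + of_int d') > 0" using le l0 by auto
  ultimately have "real_of_int e \<le> 1" by simp
  moreover have "e > 0" using le l0 unfolding e_def by (metis gcd_eq_0_iff gcd_pos_int mult_zero_left of_int_0)
  ultimately have "e = 1" by linarith
  then obtain u v where uv: "u * c + v * d = 1" using bezout_int[of c d] e_def by metis
  \<comment> \<open>Subtracting k times the bottom row from the top row translates w by -k, with k
    the integer nearest to the real part.\<close>
  define k where "k = \<lfloor>Re ((of_int v * z + of_int (- u)) / l) + 1 / 2\<rfloor>"
  define a b where "a = v - k * c" and "b = - u - k * d"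
  have det: "a * d - b * c = 1" using uv by (simp add: a_def b_def algebra_simps)
  define w where "w = (of_int a * z + of_int b) / l"
  have "of_int a * z + of_int b = of_int v * z + of_int (- u) - of_int k * l"
    by (simp add: l_def a_def b_def algebra_simps)
  then have "w = (of_int v * z + of_int (- u)) / l - of_int k"
    using l0 by (simp add: w_def diff_divide_distrib)
  then have "Re w = Re ((of_int v * z + of_int (- u)) / l) - of_int k" by simp
  then have Re: "\<bar>Re w\<bar> \<le> 1 / 2" unfolding k_def by linarith
  note m = E4_E6_modular[OF z det, folded l_def, folded w_def]
  have Im: "Im w > 0" using m(2) z l0 by simp
  \<comment> \<open>Minimality is now applied to the top row: l w is no shorter than l, so w has
    modulus at least 1, and the bound on Re w keeps Im w away from 0.\<close>
  have "a \<noteq> 0 \<or> b \<noteq> 0" using det by auto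
  then have "norm l \<le> norm (of_int a * z + of_int b)" by (intro min) auto
  then have "1 \<le> norm w" using l0 by (simp add: w_def norm_divide)
  then have "1 \<le> (Re w)\<^sup>2 + (Im w)\<^sup>2" by (simp add: cmod_def)
  moreover have "(Re w)\<^sup>2 \<le> (1 / 2)\<^sup>2" using Re power_mono[of "\<bar>Re w\<bar>" "1 / 2" 2] by simp
  ultimately have "(1 / 2)\<^sup>2 \<le> (Im w)\<^sup>2" by (simp add: power2_eq_square)
  then have "1 / 2 \<le> Im w" by (rule power2_le_imp_le) (use Im in simp)
  moreover have "modular_J w = modular_J z"
  proof -
    have "(l ^ 4 * x) ^ 3 = l ^ 12 * x ^ 3" "(l ^ 6 * x)\<^sup>2 = l ^ 12 * x\<^sup>2" for x
      by (simp_all add: power_mult_distrib flip: power_mult)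
    then show ?thesis unfolding modular_J_def m(3,4)
      using l0 by (simp flip: right_diff_distrib)
  qed
  ultimately show thesis using Re that by blast
qed

text \<open>As Im z grows the nome tends to 0, where E4 and E6 are 1: the numerator stays near 1 and
  the nonzero denominator tends to 0.\<close>

lemma modular_J_at_cusp: "\<exists>M. \<forall>z. Im z > M \<longrightarrow> norm (modular_J z) > R"
proof -
  define D where "D q = E4 q ^ 3 - E6 q ^ 2" for q
  have "E4 holomorphic_on ball 0 1" "E6 holomorphic_on ball 0 1"
    unfolding E4_def E6_def by (intro holomorphic_intros sigma_series_holomorphic)+
  then have c: "isCont E4 0" "isCont E6 0" by (auto intro: holomorphic_on_ball_isCont)
  have [simp]: "E4 0 = 1" "E6 0 = 1" by (simp_all add: E4_def E6_def sigma_series_0)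
  define R' where "R' = max R 1"
  have "(E4 \<longlongrightarrow> 1) (nhds 0)" "(D \<longlongrightarrow> 0) (nhds 0)"
    using c[unfolded isCont_def tendsto_at_iff_tendsto_nhds]
      tendsto_diff[OF tendsto_power[of E4 1 "nhds 0" 3] tendsto_power[of E6 1 "nhds 0" 2]]
    by (simp_all add: D_def[abs_def])
  from tendsto_norm[OF tendsto_power[OF this(1), of 3]] tendsto_norm[OF this(2)]
  have lims: "((\<lambda>q. norm (E4 q ^ 3)) \<longlongrightarrow> 1) (nhds 0)" "((\<lambda>q. norm (D q)) \<longlongrightarrow> 0) (nhds 0)" by simp_all
  have "\<forall>\<^sub>F q in nhds 0. 1 / 2 < norm (E4 q ^ 3)" by (rule order_tendstoD(1)[OF lims(1)]) simp
  moreover have "\<forall>\<^sub>F q in nhds 0. norm (D q) < 1 / (2 * R')"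
    by (rule order_tendstoD(2)[OF lims(2)]) (simp add: R'_def)
  ultimately have "\<forall>\<^sub>F q in nhds 0. 1 / 2 < norm (E4 q ^ 3) \<and> norm (D q) < 1 / (2 * R')"
    by (rule eventually_conj)
  then obtain \<delta> where \<delta>: "\<delta> > 0" "\<And>q. dist q 0 < \<delta> \<Longrightarrow> 1 / 2 < norm (E4 q ^ 3) \<and> norm (D q) < 1 / (2 * R')"
    unfolding eventually_nhds_metric by blast
  show ?thesis
  proof (intro exI[of _ "max 0 (- ln \<delta> / (2 * pi))"] allI impI)
    fix z assume "max 0 (- ln \<delta> / (2 * pi)) < Im z"
    then have z: "Im z > 0" "- ln \<delta> < 2 * pi * Im z" by (auto simp: field_simps)
    have "norm (nome z) = exp (- (2 * pi * Im z))" by (simp add: nome_def norm_exp_eq_Re)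
    also have "\<dots> < exp (ln \<delta>)" using z by (subst exp_less_cancel_iff) linarith
    finally have "dist (nome z) 0 < \<delta>" using \<delta> by simp
    then have 1: "1 / 2 < norm (E4 (nome z) ^ 3)" and 2: "norm (D (nome z)) < 1 / (2 * R')" using \<delta>(2) by auto
    have 3: "norm (D (nome z)) > 0" using discriminant_nonzero[OF z(1)] by (simp add: D_def)
    have R': "R' > 0" "R \<le> R'" by (auto simp: R'_def)
    have "R' * norm (D (nome z)) < 1 / 2" using 2 R' by (simp add: field_simps)
    then have "R' * norm (D (nome z)) < norm (E4 (nome z) ^ 3)" using 1 by linarith
    then have "R' < norm (modular_J z)" using 3 by (simp add: modular_J_def D_def norm_divide field_simps)
    then show "R < norm (modular_J z)" using R' by linarith
  qed
qed

lemma modular_J_surj: "\<exists>z. Im z > 0 \<and> modular_J z = c"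
proof -
  let ?H = "{z. Im z > 0}"
  have conn: "connected ?H" using convex_halfspace_Im_gt[of 0] convex_connected by auto
  have op: "open ?H" by (rule open_halfspace_Im_gt)
  have nonconst: "\<not> modular_J constant_on ?H"
  proof
    assume "modular_J constant_on ?H"
    then obtain k where k: "\<And>z. Im z > 0 \<Longrightarrow> modular_J z = k" by (auto simp: constant_on_def)
    obtain M where M: "\<And>z. Im z > M \<Longrightarrow> norm (modular_J z) > norm k" using modular_J_at_cusp by blast
    define z where "z = Complex 0 (max M 0 + 1)"
    have "Im z > 0" "Im z > M" by (auto simp: z_def)
    then show False using k M by fastforce
  qed
  have 1: "open (modular_J ` ?H)"
    by (rule open_mapping_thm[OF modular_J_holomorphic op conn op subset_refl nonconst])
  have 2: "closed (modular_J ` ?H)"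
  proof (subst closure_subset_eq[symmetric], rule subsetI)
    fix c assume c: "c \<in> closure (modular_J ` ?H)"
    obtain M where M: "\<And>z. Im z > M \<Longrightarrow> norm (modular_J z) > norm c + 1" using modular_J_at_cusp by blast
    \<comment> \<open>Values of J near c come, after reduction, from points of height at most M,
      since above M the modulus exceeds \<open>norm c + 1\<close>. They all lie in this rectangle,
      whose image is compact.\<close>
    define K where "K = cbox (Complex (- 1 / 2) (1 / 2)) (Complex (1 / 2) M)"
    have K: "K \<subseteq> ?H" by (auto simp: K_def in_cbox_complex_iff)
    have "compact (modular_J ` K)"
      using K modular_J_holomorphic
      by (intro compact_continuous_image) (auto simp: K_def intro: continuous_on_subset holomorphic_on_imp_continuous_on)
    then have closed: "closed (modular_J ` K)" by (rule compact_imp_closed)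
    have "c \<in> closure (modular_J ` K)"
      unfolding closure_approachable
    proof (intro allI impI)
      fix e :: real assume "e > 0"
      then obtain z where z: "Im z > 0" "dist (modular_J z) c < min e 1"
        using c unfolding closure_approachable by (metis (mono_tags, lifting) imageE mem_Collect_eq min_less_iff_conj zero_less_one)
      obtain w where w: "1 / 2 \<le> Im w" "\<bar>Re w\<bar> \<le> 1 / 2" "modular_J w = modular_J z"
        using modular_J_reduction[OF z(1)] by blast
      have "norm (modular_J w) \<le> norm c + 1"
        using z(2) w(3) norm_triangle_ineq2[of "modular_J w" c] by (simp add: dist_norm)
      then have "Im w \<le> M" using M[of w] by linarith
      then have "w \<in> K" using w by (auto simp: K_def in_cbox_complex_iff)
      then show "\<exists>y\<in>modular_J ` K. dist y c < e"
        using z(2) w(3) by (auto intro!: bexI[of _ w])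
    qed
    then show "c \<in> modular_J ` ?H" using closed K by (auto simp: closure_closed)
  qed
  have "\<i> \<in> ?H" by simp
  moreover have "modular_J ` ?H = {} \<or> modular_J ` ?H = UNIV" using conjI[OF 2 1] unfolding clopen .
  ultimately have "modular_J ` ?H = UNIV" by blast
  then have "c \<in> modular_J ` ?H" by simp
  then show ?thesis by auto
qed

section \<open>The components of the period map, their range and their fibres\<close>

definition G1 :: "complex \<Rightarrow> complex" where "G1 z = (2 * of_real pi * \<i> / 12) * E2 (nome z)"
definition G2 :: "complex \<Rightarrow> complex" where "G2 z = 12 * (2 * of_real pi * \<i> / 12) ^ 2 * E4 (nome z)"
definition G3 :: "complex \<Rightarrow> complex" where "G3 z = 8 * (2 * of_real pi * \<i> / 12) ^ 3 * E6 (nome z)"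

lemma g_eq: "g z = (G1 z, G2 z, G3 z)"
proof -
  have "exp (2 * of_real pi * \<i> * z * of_nat (Suc n)) = nome z ^ Suc n" for n
    unfolding nome_def by (metis exp_of_nat_mult mult.commute)
  then show ?thesis
    by (simp add: g_def eisenstein_def G1_def G2_def G3_def E2_def E4_def E6_def sigma_series_def del: power_Suc of_nat_Suc)
qed

lemma G2_or_G3_nonzero: "Im z > 0 \<Longrightarrow> G2 z \<noteq> 0 \<or> G3 z \<noteq> 0"
  using discriminant_nonzero[of z] by (auto simp: G2_def G3_def)

lemma complex_root_exists:
  fixes c :: complex
  assumes "c \<noteq> 0" "n > 0"
  obtains m where "m \<noteq> 0" "m ^ n = c"
proof
  show "exp (Ln c / of_nat n) ^ n = c"
    using assms by (simp flip: exp_of_nat_mult)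
qed simp

text \<open>Choosing z by the value of J makes (t2, t3) and (G2 z, G3 z) agree in the ratio of t2^3
  to t3^2. A fourth root then adjusts t2 and fixes t3 up to sign, and replacing m by i m flips that
  sign. If t2 = 0, a sixth root adjusts t3.\<close>

lemma G_surj:
  assumes "27 * t3\<^sup>2 \<noteq> t2 ^ 3"
  obtains z m where "Im z > 0" "m \<noteq> 0" "t2 = G2 z * m ^ 4" "t3 = G3 z * m ^ 6"
proof -
  obtain z where z: "Im z > 0" "modular_J z = t2 ^ 3 / (t2 ^ 3 - 27 * t3\<^sup>2)" using modular_J_surj by blast
  have "E4 (nome z) ^ 3 * (t2 ^ 3 - 27 * t3\<^sup>2) = t2 ^ 3 * (E4 (nome z) ^ 3 - E6 (nome z) ^ 2)"
    using z(2) assms discriminant_nonzero[OF z(1)] by (simp add: modular_J_def frac_eq_eq)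
  then have eq: "27 * t3\<^sup>2 * E4 (nome z) ^ 3 = t2 ^ 3 * E6 (nome z) ^ 2" by (simp add: algebra_simps)
  have cross: "t3\<^sup>2 * G2 z ^ 3 = t2 ^ 3 * G3 z ^ 2"
  proof -
    define s where "s = 2 * of_real pi * \<i> / (12::complex)"
    have "t3\<^sup>2 * G2 z ^ 3 = 64 * s ^ 6 * (27 * t3\<^sup>2 * E4 (nome z) ^ 3)"
      unfolding G2_def s_def[symmetric] by (simp add: power_mult_distrib flip: power_mult)
    also have "\<dots> = t2 ^ 3 * G3 z ^ 2"
      unfolding eq G3_def s_def[symmetric] by (simp add: power_mult_distrib flip: power_mult)
    finally show ?thesis .
  qed
  show thesis
  proof (cases "t2 = 0")
    case True
    then have "t3 \<noteq> 0" using assms by simp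
    then have 2: "G2 z = 0" using cross True by simp
    then have 3: "G3 z \<noteq> 0" using G2_or_G3_nonzero[OF z(1)] by simp
    obtain m where "m \<noteq> 0" "m ^ 6 = t3 / G3 z"
      using complex_root_exists[of "t3 / G3 z" 6] 3 \<open>t3 \<noteq> 0\<close> by auto
    then show thesis using that[of z m] z 2 3 True by simp
  next
    case False
    then have 2: "G2 z \<noteq> 0" using cross G2_or_G3_nonzero[OF z(1)] by auto
    obtain m where m: "m \<noteq> 0" "m ^ 4 = t2 / G2 z"
      using complex_root_exists[of "t2 / G2 z" 4] 2 False by auto
    have "(G3 z * m ^ 6)\<^sup>2 = G3 z ^ 2 * (m ^ 4) ^ 3" by (simp add: power_mult_distrib flip: power_mult)
    also have "\<dots> = t3\<^sup>2" unfolding m(2) using 2 cross by (simp add: power_divide field_simps)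
    finally have "t3 = G3 z * m ^ 6 \<or> t3 = - (G3 z * m ^ 6)" using power2_eq_iff by metis
    then show thesis
    proof
      assume "t3 = G3 z * m ^ 6"
      then show thesis using that[of z m] z m 2 by simp
    next
      assume "t3 = - (G3 z * m ^ 6)"
      moreover have "(\<i> * m) ^ 4 = m ^ 4" "(\<i> * m) ^ 6 = - (m ^ 6)"
        by (simp_all add: power_mult_distrib i_even_power[of 2, simplified] i_even_power[of 3, simplified])
      ultimately show thesis using that[of z "\<i> * m"] z m 2 by simp
    qed
  qed
qed

text \<open>The normalising factor 2 \<pi> i / 12 of \<open>G1\<close> cancels the factor 12 / (2
  \<pi> i) in the rule for E2, so the defect becomes the integer c times m n.\<close>

lemma G_modular:
  assumes z: "Im z > 0" and w: "Im w > 0" and m: "m \<noteq> 0" and n: "n \<noteq> 0"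
    and eq: "G2 z * m ^ 4 = G2 w * n ^ 4" "G3 z * m ^ 6 = G3 w * n ^ 6"
  obtains a b c d :: int where "a * d - b * c = 1" "m = (of_int c * z + of_int d) * n"
    "(of_int c * z + of_int d) * w = of_int a * z + of_int b"
    "G1 w * n\<^sup>2 = G1 z * m\<^sup>2 + of_int c * m * n"
    "Im w * (norm (of_int c * z + of_int d))\<^sup>2 = Im z"
proof -
  define l where "l = m / n"
  have l: "l \<noteq> 0" and ml: "m = l * n" using m n by (simp_all add: l_def)
  have "E4 (nome w) = l ^ 4 * E4 (nome z)" "E6 (nome w) = l ^ 6 * E6 (nome z)"
    using eq n by (simp_all add: G2_def G3_def l_def power_divide field_simps)
  then obtain a b c d :: int where *: "l = of_int c * z + of_int d" "l * w = of_int a * z + of_int b"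
    "a * d - b * c = 1" "E2 (nome w) = l\<^sup>2 * E2 (nome z) + 12 * of_int c * l / (2 * of_real pi * \<i>)"
    using E4_E6_eq_imp_modular[OF z w l] by metis
  have "G1 w = l\<^sup>2 * G1 z + of_int c * l"
    unfolding G1_def *(4) by (simp add: field_simps)
  then have "G1 w * n\<^sup>2 = G1 z * m\<^sup>2 + of_int c * m * n"
    by (simp add: ml algebra_simps power2_eq_square)
  moreover have "w = (of_int a * z + of_int b) / l" using * l by (simp add: field_simps)
  then have "Im w = Im z / (norm l)\<^sup>2"
    using E4_E6_modular(2)[OF z *(3)] *(1) by simp
  then have "Im w * (norm l)\<^sup>2 = Im z" using l by simp
  ultimately show thesis using that[of a d b c] * ml by metis
qed

section \<open>Germs of real analytic functions\<close>

abbreviation multi_indices :: "('a::euclidean_space \<Rightarrow> nat) set" where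
  "multi_indices \<equiv> Basis \<rightarrow>\<^sub>E UNIV"

definition monomial_at :: "'a::euclidean_space \<Rightarrow> ('a \<Rightarrow> nat) \<Rightarrow> real" where
  "monomial_at v \<alpha> = (\<Prod>b\<in>Basis. (v \<bullet> b) ^ \<alpha> b)"

definition mdegree :: "('a::euclidean_space \<Rightarrow> nat) \<Rightarrow> nat" where
  "mdegree \<alpha> = (\<Sum>b\<in>Basis. \<alpha> b)"

text \<open>\<open>f\<close> has a power series at \<open>a\<close> whose majorant of radius \<open>r\<close> has sum at most \<open>M\<close>; these sums
  are submultiplicative, which makes the composition with a holomorphic function converge.\<close>

definition majorized_at :: "'a::euclidean_space \<Rightarrow> real \<Rightarrow> real \<Rightarrow> ('a \<Rightarrow> complex) \<Rightarrow> bool" where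
  "majorized_at a r M f \<longleftrightarrow> r > 0 \<and> (\<exists>c S. S \<le> M \<and>
     ((\<lambda>\<alpha>. norm (c \<alpha>) * r ^ mdegree \<alpha>) has_sum S) multi_indices \<and>
     (\<forall>x\<in>ball a r. ((\<lambda>\<alpha>. monomial_at (x - a) \<alpha> *\<^sub>R c \<alpha>) has_sum f x) multi_indices))"

lemma abs_monomial_at_le:
  assumes "norm v \<le> r"
  shows "\<bar>monomial_at v \<alpha>\<bar> \<le> r ^ mdegree \<alpha>"
proof -
  have "\<bar>monomial_at v \<alpha>\<bar> = (\<Prod>b\<in>Basis. \<bar>v \<bullet> b\<bar> ^ \<alpha> b)"
    by (simp add: monomial_at_def abs_prod power_abs)
  also have "\<dots> \<le> (\<Prod>b\<in>Basis. r ^ \<alpha> b)"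
    using Basis_le_norm[of _ v] assms by (intro prod_mono conjI power_mono) (auto intro: order_trans)
  also have "\<dots> = r ^ mdegree \<alpha>" by (simp add: mdegree_def power_sum)
  finally show ?thesis .
qed

lemma norm_monomial_scaleR_le:
  assumes "x \<in> ball a r"
  shows "norm (monomial_at (x - a) \<alpha> *\<^sub>R (c :: complex)) \<le> norm c * r ^ mdegree \<alpha>"
  using abs_monomial_at_le[of "x - a" r \<alpha>] assms
  by (simp add: dist_norm norm_minus_commute mult.commute mult_left_mono)

text \<open>Series indexed by any set with a map to multi-indices: terms with the same monomial are
  collected, and the triangle inequality keeps the majorant below S. Sums, products and compositions
  can thus use their natural index sets (two copies, pairs, exponent and multi-index).\<close>

lemma majorized_atI:
  fixes c :: "'i \<Rightarrow> complex"
  assumes r: "r > 0" and m: "\<And>i. i \<in> I \<Longrightarrow> m i \<in> multi_indices"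
    and S: "((\<lambda>i. norm (c i) * r ^ mdegree (m i)) has_sum S) I" "S \<le> M"
    and f: "\<And>x. x \<in> ball a r \<Longrightarrow> ((\<lambda>i. monomial_at (x - a) (m i) *\<^sub>R c i) has_sum f x) I"
  shows "majorized_at a r M f"
proof -
  define J where "J \<alpha> = {i \<in> I. m i = \<alpha>}" for \<alpha>
  define C where "C \<alpha> = infsum c (J \<alpha>)" for \<alpha>
  have split: "(u has_sum s) I \<longleftrightarrow> ((\<lambda>(\<alpha>,i). u i) has_sum s) (Sigma multi_indices J)"
    for u :: "'i \<Rightarrow> 'b::topological_comm_monoid_add" and s
    by (rule has_sum_reindex_bij_witness[where i = snd and j = "\<lambda>i. (m i, i)"]) (auto simp: J_def m)
  define N where "N \<alpha> = infsum (\<lambda>i. norm (c i) * r ^ mdegree (m i)) (J \<alpha>)" for \<alpha>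
  have N: "((\<lambda>i. norm (c i) * r ^ mdegree (m i)) has_sum N \<alpha>) (J \<alpha>)" for \<alpha>
    unfolding N_def by (intro has_sum_infsum summable_on_subset_banach[OF has_sum_imp_summable[OF S(1)]]) (auto simp: J_def)
  have "((\<lambda>i. r ^ mdegree \<alpha> * norm (c i)) has_sum N \<alpha>) (J \<alpha>)" for \<alpha>
    using N[of \<alpha>] by (rule has_sum_cong[THEN iffD1, rotated]) (auto simp: J_def)
  then have "((\<lambda>i. inverse (r ^ mdegree \<alpha>) * (r ^ mdegree \<alpha> * norm (c i))) has_sum inverse (r ^ mdegree \<alpha>) * N \<alpha>) (J \<alpha>)" for \<alpha>
    by (rule has_sum_cmult_right)
  then have nC: "((\<lambda>i. norm (c i)) has_sum N \<alpha> / r ^ mdegree \<alpha>) (J \<alpha>)" for \<alpha>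
    using r by (simp add: field_simps)
  then have sC: "c summable_on J \<alpha>" for \<alpha>
    using abs_summable_summable has_sum_imp_summable by blast
  then have C: "(c has_sum C \<alpha>) (J \<alpha>)" for \<alpha> unfolding C_def by (rule has_sum_infsum)
  have "norm (C \<alpha>) \<le> N \<alpha> / r ^ mdegree \<alpha>" for \<alpha>
    using norm_infsum_bound[of c "J \<alpha>"] nC[of \<alpha>] infsumI[OF nC[of \<alpha>]] has_sum_imp_summable
    unfolding C_def by fastforce
  then have CN: "norm (C \<alpha>) * r ^ mdegree \<alpha> \<le> N \<alpha>" for \<alpha> using r by (simp add: field_simps)
  have NS: "(N has_sum S) multi_indices"
    by (rule has_sum_SigmaD[OF S(1)[unfolded split]]) (simp add: N)
  have "(\<lambda>\<alpha>. norm (norm (C \<alpha>) * r ^ mdegree \<alpha>)) summable_on multi_indices"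
    by (rule abs_summable_comparison[OF has_sum_imp_summable[OF NS]])
      (use CN r in \<open>simp add: abs_mult\<close>)
  then have "(\<lambda>\<alpha>. norm (C \<alpha>) * r ^ mdegree \<alpha>) summable_on multi_indices"
    using r by (simp add: abs_mult)
  then obtain S' where S': "((\<lambda>\<alpha>. norm (C \<alpha>) * r ^ mdegree \<alpha>) has_sum S') multi_indices"
    by (auto simp: summable_on_def)
  have "S' \<le> S" by (rule has_sum_mono[OF S' NS CN])
  moreover have "((\<lambda>\<alpha>. monomial_at (x - a) \<alpha> *\<^sub>R C \<alpha>) has_sum f x) multi_indices" if "x \<in> ball a r" for x
  proof (rule has_sum_SigmaD[OF f[OF that, unfolded split]])
    fix \<alpha> :: "'a \<Rightarrow> nat"
    have "((\<lambda>i. monomial_at (x - a) \<alpha> *\<^sub>R c i) has_sum monomial_at (x - a) \<alpha> *\<^sub>R C \<alpha>) (J \<alpha>)"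
      by (rule has_sum_scaleR[OF C])
    then show "((\<lambda>i. case (\<alpha>, i) of (\<alpha>, i) \<Rightarrow> monomial_at (x - a) (m i) *\<^sub>R c i) has_sum monomial_at (x - a) \<alpha> *\<^sub>R C \<alpha>) (J \<alpha>)"
      by (rule has_sum_cong[THEN iffD1, rotated]) (auto simp: J_def)
  qed
  ultimately show ?thesis unfolding majorized_at_def using r S(2) S'
    by (intro conjI exI[of _ C] exI[of _ S']) auto
qed

lemma majorized_at_pos: "majorized_at a r M f \<Longrightarrow> r > 0"
  by (simp add: majorized_at_def)

lemma majorized_at_norm_le:
  assumes "majorized_at a r M f" "x \<in> ball a r"
  shows "norm (f x) \<le> M"
proof -
  obtain c S where c: "S \<le> M" "((\<lambda>\<alpha>. norm (c \<alpha>) * r ^ mdegree \<alpha>) has_sum S) multi_indices"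
    "((\<lambda>\<alpha>. monomial_at (x - a) \<alpha> *\<^sub>R c \<alpha>) has_sum f x) multi_indices"
    using assms unfolding majorized_at_def by blast
  have s: "(\<lambda>\<alpha>. norm (monomial_at (x - a) \<alpha> *\<^sub>R c \<alpha>)) summable_on multi_indices"
    by (rule abs_summable_comparison[OF has_sum_imp_summable[OF c(2)]])
      (rule norm_monomial_scaleR_le[OF assms(2)])
  have "norm (f x) \<le> infsum (\<lambda>\<alpha>. norm (monomial_at (x - a) \<alpha> *\<^sub>R c \<alpha>)) multi_indices"
    using norm_infsum_bound[OF s] infsumI[OF c(3)] by simp
  also have "\<dots> \<le> infsum (\<lambda>\<alpha>. norm (c \<alpha>) * r ^ mdegree \<alpha>) multi_indices"
    by (rule infsum_mono[OF s has_sum_imp_summable[OF c(2)]]) (rule norm_monomial_scaleR_le[OF assms(2)])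
  also have "\<dots> \<le> M" using infsumI[OF c(2)] c(1) by simp
  finally show ?thesis .
qed

lemma majorized_at_subradius:
  assumes "majorized_at a r M f" "0 < r'" "r' \<le> r"
  shows "majorized_at a r' M f"
proof -
  obtain c S where c: "S \<le> M" "((\<lambda>\<alpha>. norm (c \<alpha>) * r ^ mdegree \<alpha>) has_sum S) multi_indices"
    "\<And>x. x \<in> ball a r \<Longrightarrow> ((\<lambda>\<alpha>. monomial_at (x - a) \<alpha> *\<^sub>R c \<alpha>) has_sum f x) multi_indices"
    using assms(1) unfolding majorized_at_def by blast
  have le: "norm (c \<alpha>) * r' ^ mdegree \<alpha> \<le> norm (c \<alpha>) * r ^ mdegree \<alpha>" for \<alpha>
    using assms by (intro mult_left_mono power_mono) auto
  have "(\<lambda>\<alpha>. norm (norm (c \<alpha>) * r' ^ mdegree \<alpha>)) summable_on multi_indices"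
    by (rule abs_summable_comparison[OF has_sum_imp_summable[OF c(2)]])
      (use le assms in \<open>simp add: abs_mult\<close>)
  then have "(\<lambda>\<alpha>. norm (c \<alpha>) * r' ^ mdegree \<alpha>) summable_on multi_indices"
    using assms by (simp add: abs_mult)
  then obtain S' where S': "((\<lambda>\<alpha>. norm (c \<alpha>) * r' ^ mdegree \<alpha>) has_sum S') multi_indices"
    by (auto simp: summable_on_def)
  have "S' \<le> S" by (rule has_sum_mono[OF S' c(2) le])
  then show ?thesis unfolding majorized_at_def using assms c S'
    by (intro conjI exI[of _ c] exI[of _ S']) auto
qed

lemma monomial_zero_index [simp]: "monomial_at v (restrict (\<lambda>_. 0) Basis) = 1"
  by (simp add: monomial_at_def)

lemma mdegree_zero_index [simp]: "mdegree (restrict (\<lambda>_. 0) Basis) = 0"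
  by (simp add: mdegree_def)

lemma majorized_at_const: "r > 0 \<Longrightarrow> majorized_at a r (norm k) (\<lambda>_. k)"
  by (rule majorized_atI[where I = "{()}" and m = "\<lambda>_. restrict (\<lambda>_. 0) Basis" and c = "\<lambda>_. k" and S = "norm k"])
     (auto intro!: has_sum_finiteI)

lemma majorized_at_coord:
  assumes b: "b \<in> Basis" and r: "r > 0"
  shows "majorized_at a r (\<bar>a \<bullet> b\<bar> + r) (\<lambda>x. of_real (x \<bullet> b))"
proof (rule majorized_atI[where I = UNIV and S = "\<bar>a \<bullet> b\<bar> + r"
      and m = "\<lambda>i. restrict (\<lambda>b'. if i \<and> b' = b then 1 else 0) Basis"
      and c = "\<lambda>i. if i then 1 else of_real (a \<bullet> b)"])
  have 1: "mdegree (restrict (\<lambda>b'. if b' = b then 1 else 0) Basis) = 1"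
    using b by (simp add: mdegree_def)
  have 2: "monomial_at v (restrict (\<lambda>b'. if b' = b then 1 else 0) Basis) = v \<bullet> b" for v
  proof -
    have "monomial_at v (restrict (\<lambda>b'. if b' = b then 1 else 0) Basis) = (\<Prod>b'\<in>Basis. if b' = b then v \<bullet> b' else 1)"
      unfolding monomial_at_def by (intro prod.cong) auto
    then show ?thesis using b by simp
  qed
  show "((\<lambda>i. norm (if i then 1 else of_real (a \<bullet> b) :: complex) * r ^ mdegree (restrict (\<lambda>b'. if i \<and> b' = b then 1 else 0) Basis)) has_sum \<bar>a \<bullet> b\<bar> + r) UNIV"
    by (rule has_sum_finiteI) (auto simp: UNIV_bool 1)
  show "((\<lambda>i. monomial_at (x - a) (restrict (\<lambda>b'. if i \<and> b' = b then 1 else 0) Basis) *\<^sub>R (if i then 1 else of_real (a \<bullet> b) :: complex)) has_sum of_real (x \<bullet> b)) UNIV" for x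
    by (rule has_sum_finiteI) (auto simp: UNIV_bool 2 scaleR_conv_of_real inner_diff_left)
qed (use r in auto)

lemma majorized_at_add:
  assumes "majorized_at a r M f" "majorized_at a r N h"
  shows "majorized_at a r (M + N) (\<lambda>x. f x + h x)"
proof -
  obtain c S where c: "S \<le> M" "((\<lambda>\<alpha>. norm (c \<alpha>) * r ^ mdegree \<alpha>) has_sum S) multi_indices"
    "\<And>x. x \<in> ball a r \<Longrightarrow> ((\<lambda>\<alpha>. monomial_at (x - a) \<alpha> *\<^sub>R c \<alpha>) has_sum f x) multi_indices" "r > 0"
    using assms(1) unfolding majorized_at_def by blast
  obtain d S' where d: "S' \<le> N" "((\<lambda>\<alpha>. norm (d \<alpha>) * r ^ mdegree \<alpha>) has_sum S') multi_indices"
    "\<And>x. x \<in> ball a r \<Longrightarrow> ((\<lambda>\<alpha>. monomial_at (x - a) \<alpha> *\<^sub>R d \<alpha>) has_sum h x) multi_indices"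
    using assms(2) unfolding majorized_at_def by blast
  have disj: "(f has_sum s) multi_indices \<Longrightarrow> (u has_sum t) multi_indices \<Longrightarrow>
      ((\<lambda>(i,\<alpha>). if i then f \<alpha> else u \<alpha>) has_sum (s + t)) (UNIV \<times> multi_indices)"
    for f u :: "('a \<Rightarrow> nat) \<Rightarrow> 'b::topological_comm_monoid_add" and s t
  proof -
    assume fg: "(f has_sum s) multi_indices" "(u has_sum t) multi_indices"
    have "((\<lambda>(i,\<alpha>). if i then f \<alpha> else u \<alpha>) has_sum s) (Pair True ` multi_indices)"
      using fg(1) by (subst has_sum_reindex) (auto simp: o_def inj_on_def)
    moreover have "((\<lambda>(i,\<alpha>). if i then f \<alpha> else u \<alpha>) has_sum t) (Pair False ` multi_indices)"
      using fg(2) by (subst has_sum_reindex) (auto simp: o_def inj_on_def)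
    ultimately have "((\<lambda>(i,\<alpha>). if i then f \<alpha> else u \<alpha>) has_sum (s + t)) (Pair True ` multi_indices \<union> Pair False ` multi_indices)"
      by (rule has_sum_Un_disjoint) auto
    also have "Pair True ` multi_indices \<union> Pair False ` multi_indices = UNIV \<times> (multi_indices :: ('a \<Rightarrow> nat) set)"
      by (auto simp: UNIV_bool)
    finally show ?thesis .
  qed
  show ?thesis
  proof (rule majorized_atI[where I = "UNIV \<times> multi_indices" and m = snd and S = "S + S'"
        and c = "\<lambda>(i,\<alpha>). if i then c \<alpha> else d \<alpha>"])
    show "((\<lambda>i. norm (case i of (i,\<alpha>) \<Rightarrow> if i then c \<alpha> else d \<alpha>) * r ^ mdegree (snd i)) has_sum S + S') (UNIV \<times> multi_indices)"
      using disj[OF c(2) d(2)] by (rule has_sum_cong[THEN iffD1, rotated]) auto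
    show "((\<lambda>i. monomial_at (x - a) (snd i) *\<^sub>R (case i of (i,\<alpha>) \<Rightarrow> if i then c \<alpha> else d \<alpha>)) has_sum f x + h x) (UNIV \<times> multi_indices)"
      if "x \<in> ball a r" for x
      using disj[OF c(3)[OF that] d(3)[OF that]] by (rule has_sum_cong[THEN iffD1, rotated]) auto
  qed (use c d in auto)
qed

lemma has_sum_product:
  fixes f h :: "_ \<Rightarrow> 'b::{banach,real_normed_algebra}"
  assumes "(f has_sum s) A" "(h has_sum t) B" "(\<lambda>(x,y). f x * h y) summable_on A \<times> B"
  shows "((\<lambda>(x,y). f x * h y) has_sum s * t) (A \<times> B)"
  by (rule has_sum_SigmaI[where g = "\<lambda>x. f x * t"])
     (use assms in \<open>auto intro!: has_sum_cmult_right has_sum_cmult_left\<close>)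

lemma majorized_at_mult:
  assumes "majorized_at a r M f" "majorized_at a r N h"
  shows "majorized_at a r (M * N) (\<lambda>x. f x * h x)"
proof -
  obtain c S where c: "S \<le> M" "((\<lambda>\<alpha>. norm (c \<alpha>) * r ^ mdegree \<alpha>) has_sum S) multi_indices"
    "\<And>x. x \<in> ball a r \<Longrightarrow> ((\<lambda>\<alpha>. monomial_at (x - a) \<alpha> *\<^sub>R c \<alpha>) has_sum f x) multi_indices" and r: "r > 0"
    using assms(1) unfolding majorized_at_def by blast
  obtain d S' where d: "S' \<le> N" "((\<lambda>\<alpha>. norm (d \<alpha>) * r ^ mdegree \<alpha>) has_sum S') multi_indices"
    "\<And>x. x \<in> ball a r \<Longrightarrow> ((\<lambda>\<alpha>. monomial_at (x - a) \<alpha> *\<^sub>R d \<alpha>) has_sum h x) multi_indices"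
    using assms(2) unfolding majorized_at_def by blast
  define m where "m = (\<lambda>(\<alpha>,\<beta>). restrict (\<lambda>b::'a. \<alpha> b + \<beta> b :: nat) Basis)"
  have mon: "monomial_at v (m (\<alpha>,\<beta>)) = monomial_at v \<alpha> * monomial_at v \<beta>" for v \<alpha> \<beta>
    by (simp add: m_def monomial_at_def power_add prod.distrib)
  have deg: "mdegree (m (\<alpha>,\<beta>)) = mdegree \<alpha> + mdegree \<beta>" for \<alpha> \<beta>
    by (simp add: m_def mdegree_def sum.distrib)
  let ?c = "\<lambda>(\<alpha>,\<beta>). c \<alpha> * d \<beta>"
  have "0 \<le> S'" using d(2) by (rule has_sum_nonneg) (use r in auto)
  have "0 \<le> S" using c(2) by (rule has_sum_nonneg) (use r in auto)
  have "(\<lambda>(\<alpha>,\<beta>). (norm (c \<alpha>) * r ^ mdegree \<alpha>) * (norm (d \<beta>) * r ^ mdegree \<beta>)) summable_on multi_indices \<times> multi_indices"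
    using r d(2) has_sum_imp_summable[OF c(2)]
    by (intro summable_on_SigmaI[where g = "\<lambda>\<alpha>. (norm (c \<alpha>) * r ^ mdegree \<alpha>) * S'"])
       (auto intro!: has_sum_cmult_right summable_on_cmult_left)
  from has_sum_product[OF c(2) d(2) this]
  have maj: "((\<lambda>p. norm (?c p) * r ^ mdegree (m p)) has_sum S * S') (multi_indices \<times> multi_indices)"
    by (rule has_sum_cong[THEN iffD1, rotated]) (auto simp: deg norm_mult power_add)
  show ?thesis
  proof (rule majorized_atI[where I = "multi_indices \<times> multi_indices" and m = m and c = ?c and S = "S * S'"])
    show "((\<lambda>p. norm (?c p) * r ^ mdegree (m p)) has_sum S * S') (multi_indices \<times> multi_indices)" by (rule maj)
    show "S * S' \<le> M * N" using c d \<open>0 \<le> S'\<close> \<open>0 \<le> S\<close> by (intro mult_mono) auto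
    fix x assume x: "x \<in> ball a r"
    have "(\<lambda>p. norm (monomial_at (x - a) (m p) *\<^sub>R ?c p)) summable_on multi_indices \<times> multi_indices"
      by (rule abs_summable_comparison[OF has_sum_imp_summable[OF maj]])
         (rule norm_monomial_scaleR_le[OF x])
    then have sm: "(\<lambda>p. monomial_at (x - a) (m p) *\<^sub>R ?c p) summable_on multi_indices \<times> multi_indices"
      by (rule abs_summable_summable)
    have eq: "(\<lambda>p. monomial_at (x - a) (m p) *\<^sub>R ?c p) =
        (\<lambda>(\<alpha>,\<beta>). (monomial_at (x - a) \<alpha> *\<^sub>R c \<alpha>) * (monomial_at (x - a) \<beta> *\<^sub>R d \<beta>))"
      by (auto simp: fun_eq_iff mon scaleR_conv_of_real)
    show "((\<lambda>p. monomial_at (x - a) (m p) *\<^sub>R ?c p) has_sum f x * h x) (multi_indices \<times> multi_indices)"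
      using has_sum_product[OF c(3)[OF x] d(3)[OF x]] sm unfolding eq by blast
  qed (auto simp: m_def r)
qed

lemma majorized_at_power:
  assumes "majorized_at a r M f"
  shows "majorized_at a r (M ^ n) (\<lambda>x. f x ^ n)"
proof (induction n)
  case 0
  then show ?case using majorized_at_const[OF majorized_at_pos[OF assms], of a 1] by simp
next
  case (Suc n)
  from majorized_at_mult[OF assms this] show ?case by simp
qed

lemma majorized_at_cnj:
  assumes "majorized_at a r M f"
  shows "majorized_at a r M (\<lambda>x. cnj (f x))"
proof -
  obtain c S where c: "S \<le> M" "((\<lambda>\<alpha>. norm (c \<alpha>) * r ^ mdegree \<alpha>) has_sum S) multi_indices"
    "\<And>x. x \<in> ball a r \<Longrightarrow> ((\<lambda>\<alpha>. monomial_at (x - a) \<alpha> *\<^sub>R c \<alpha>) has_sum f x) multi_indices" "r > 0"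
    using assms(1) unfolding majorized_at_def by blast
  have "((\<lambda>\<alpha>. monomial_at (x - a) \<alpha> *\<^sub>R cnj (c \<alpha>)) has_sum cnj (f x)) multi_indices" if "x \<in> ball a r" for x
    using has_sum_bounded_linear[OF bounded_linear_cnj c(3)[OF that]] by (simp add: o_def scaleR_conv_of_real)
  then show ?thesis unfolding majorized_at_def using c by (intro conjI exI[of _ "\<lambda>\<alpha>. cnj (c \<alpha>)"] exI[of _ S]) auto
qed

text \<open>Without the constant term every monomial has degree at least 1, so contracting the
  radius by t contracts the majorant at least by t. Continuity and composition both rest on
  this.\<close>

lemma majorized_at_shrink:
  assumes f: "majorized_at a r M f" and t: "0 < t" "t \<le> 1"
  shows "majorized_at a (t * r) (t * M) (\<lambda>x. f x - f a)"
proof -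
  obtain c S where c: "S \<le> M" "((\<lambda>\<alpha>. norm (c \<alpha>) * r ^ mdegree \<alpha>) has_sum S) multi_indices"
    "\<And>x. x \<in> ball a r \<Longrightarrow> ((\<lambda>\<alpha>. monomial_at (x - a) \<alpha> *\<^sub>R c \<alpha>) has_sum f x) multi_indices" and r: "r > 0"
    using f unfolding majorized_at_def by blast
  define o0 where "o0 = restrict (\<lambda>_::'a. 0::nat) Basis"
  have o0: "o0 \<in> multi_indices" "monomial_at v o0 = 1" for v :: 'a by (auto simp: o0_def)
  have deg: "mdegree \<alpha> > 0" if "\<alpha> \<in> multi_indices" "\<alpha> \<noteq> o0" for \<alpha> :: "'a \<Rightarrow> nat"
  proof (rule ccontr)
    assume "\<not> 0 < mdegree \<alpha>"
    then have "\<alpha> b = 0" if "b \<in> Basis" for b using that by (simp add: mdegree_def)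
    then have "\<alpha> = o0" using that(1) by (auto simp: o0_def fun_eq_iff PiE_def extensional_def)
    with that show False by simp
  qed
  have mon0: "monomial_at 0 \<alpha> = 0" if "\<alpha> \<in> multi_indices" "\<alpha> \<noteq> o0" for \<alpha> :: "'a \<Rightarrow> nat"
    using abs_monomial_at_le[of "0::'a" 0 \<alpha>] deg[OF that] by (simp add: zero_power)
  have single: "((\<lambda>\<alpha>. if \<alpha> = o0 then k else 0) has_sum k) multi_indices" for k :: complex
  proof -
    have "((\<lambda>\<alpha>. if \<alpha> = o0 then k else 0) has_sum k) {o0}"
      by (rule has_sum_finiteI) auto
    then show ?thesis by (rule has_sum_cong_neutral[THEN iffD1, rotated 3]) (use o0 in auto)
  qed
  have "((\<lambda>\<alpha>. monomial_at (a - a) \<alpha> *\<^sub>R c \<alpha>) has_sum f a) multi_indices" using c(3)[of a] r by simp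
  then have "((\<lambda>\<alpha>. if \<alpha> = o0 then c o0 else 0) has_sum f a) multi_indices"
    by (rule has_sum_cong[THEN iffD1, rotated]) (use mon0 o0(2) in auto)
  then have fa: "f a = c o0" using single has_sum_unique by blast
  define d where "d \<alpha> = (if \<alpha> = o0 then 0 else c \<alpha>)" for \<alpha>
  have le: "norm (d \<alpha>) * (t * r) ^ mdegree \<alpha> \<le> t * (norm (c \<alpha>) * r ^ mdegree \<alpha>)" if "\<alpha> \<in> multi_indices" for \<alpha>
  proof (cases "\<alpha> = o0")
    case False
    then have "t ^ mdegree \<alpha> \<le> t ^ 1" using deg[OF that] t by (intro power_decreasing) auto
    then have "norm (c \<alpha>) * r ^ mdegree \<alpha> * t ^ mdegree \<alpha> \<le> norm (c \<alpha>) * r ^ mdegree \<alpha> * t"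
      using r by (intro mult_left_mono) auto
    then show ?thesis using False by (simp add: d_def power_mult_distrib mult_ac)
  qed (use t r in \<open>auto simp: d_def\<close>)
  have tS: "((\<lambda>\<alpha>. t * (norm (c \<alpha>) * r ^ mdegree \<alpha>)) has_sum t * S) multi_indices"
    by (rule has_sum_cmult_right[OF c(2)])
  have "(\<lambda>\<alpha>. norm (norm (d \<alpha>) * (t * r) ^ mdegree \<alpha>)) summable_on multi_indices"
    by (rule abs_summable_comparison[OF has_sum_imp_summable[OF tS]])
      (use le t r in \<open>simp add: abs_mult\<close>)
  then have "(\<lambda>\<alpha>. norm (d \<alpha>) * (t * r) ^ mdegree \<alpha>) summable_on multi_indices"
    using t r by (simp add: abs_mult)
  then obtain S' where S': "((\<lambda>\<alpha>. norm (d \<alpha>) * (t * r) ^ mdegree \<alpha>) has_sum S') multi_indices"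
    by (auto simp: summable_on_def)
  have "S' \<le> t * S" by (rule has_sum_mono[OF S' tS le])
  also have "\<dots> \<le> t * M" using c(1) t by simp
  finally have "S' \<le> t * M" .
  moreover have "((\<lambda>\<alpha>. monomial_at (x - a) \<alpha> *\<^sub>R d \<alpha>) has_sum f x - f a) multi_indices" if "x \<in> ball a (t * r)" for x
  proof -
    have "t * r \<le> r" using t r by simp
    then have x: "x \<in> ball a r" using that by auto
    have "((\<lambda>\<alpha>. monomial_at (x - a) \<alpha> *\<^sub>R c \<alpha> + (if \<alpha> = o0 then - c o0 else 0)) has_sum f x + - c o0) multi_indices"
      by (intro has_sum_add c(3)[OF x] single)
    then have "((\<lambda>\<alpha>. monomial_at (x - a) \<alpha> *\<^sub>R c \<alpha> + (if \<alpha> = o0 then - c o0 else 0)) has_sum f x - f a) multi_indices"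
      by (simp add: fa)
    then show ?thesis by (rule has_sum_cong[THEN iffD1, rotated]) (auto simp: d_def o0(2))
  qed
  ultimately show ?thesis unfolding majorized_at_def using t r S'
    by (intro conjI exI[of _ d] exI[of _ S']) auto
qed

text \<open>After contraction f - f a has majorant at most s, less than the radius of convergence of
  h at f a. Its n-th power has majorant at most s^n, so inserting it into the Taylor series of h
  gives an absolutely convergent double family.\<close>

lemma majorized_at_holomorphic_compose:
  assumes f: "majorized_at a r M f" and h: "h holomorphic_on U" "open U" "f a \<in> U"
  shows "\<exists>r M. majorized_at a r M (\<lambda>x. h (f x))"
proof -
  obtain \<rho> where \<rho>: "\<rho> > 0" "ball (f a) \<rho> \<subseteq> U" using h open_contains_ball by blast
  define d where "d n = (deriv ^^ n) h (f a) / fact n" for n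
  have hd: "(\<lambda>n. d n * (u - f a) ^ n) sums h u" if "u \<in> ball (f a) \<rho>" for u
    unfolding d_def using h \<rho> that by (intro holomorphic_power_series) (auto intro: holomorphic_on_subset)
  define s where "s = \<rho> / 2"
  have s: "0 < s" "s < \<rho>" using \<rho> by (auto simp: s_def)
  \<comment> \<open>Convergence at the intermediate radius 3 \<rho> / 4 yields absolute convergence
    at s = \<rho> / 2.\<close>
  have "summable (\<lambda>n. d n * of_real (3 * \<rho> / 4) ^ n)"
    using hd[of "f a + of_real (3 * \<rho> / 4)"] \<rho>(1) by (auto simp: summable_def dist_norm)
  then have "summable (\<lambda>n. norm (d n * of_real s ^ n))"
    by (rule powser_insidea) (use \<rho> in \<open>auto simp: s_def\<close>)
  then have sd: "summable (\<lambda>n. norm (d n) * s ^ n)" using s by (simp add: norm_mult norm_power)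
  have "0 \<le> M" using majorized_at_norm_le[OF f, of a] majorized_at_pos[OF f] norm_ge_zero[of "f a"] by (metis centre_in_ball order_trans)
  \<comment> \<open>Small enough for t M \<le> s; the 1 added to M keeps the quotient meaningful
    when M = 0.\<close>
  define t where "t = min 1 (s / (M + 1))"
  have t: "0 < t" "t \<le> 1" using s \<open>0 \<le> M\<close> by (auto simp: t_def)
  have "t * M \<le> s / (M + 1) * M" using \<open>0 \<le> M\<close> by (intro mult_right_mono) (auto simp: t_def)
  also have "\<dots> \<le> s" using \<open>0 \<le> M\<close> s by (simp add: field_simps)
  finally have tM: "t * M \<le> s" .
  define R where "R = t * r"
  define F where "F x = f x - f a" for x
  have F: "majorized_at a R s F"
    using majorized_at_shrink[OF f t] tM unfolding R_def F_def[abs_def] majorized_at_def by (meson order_trans)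
  note R = majorized_at_pos[OF F]
  have "\<forall>n. \<exists>c S. S \<le> s ^ n \<and> ((\<lambda>\<alpha>. norm (c \<alpha>) * R ^ mdegree \<alpha>) has_sum S) multi_indices \<and>
     (\<forall>x\<in>ball a R. ((\<lambda>\<alpha>. monomial_at (x - a) \<alpha> *\<^sub>R c \<alpha>) has_sum F x ^ n) multi_indices)"
    using majorized_at_power[OF F] unfolding majorized_at_def by blast
  from choice[OF this] obtain c where "\<forall>n. \<exists>S. S \<le> s ^ n \<and> ((\<lambda>\<alpha>. norm (c n \<alpha>) * R ^ mdegree \<alpha>) has_sum S) multi_indices \<and>
     (\<forall>x\<in>ball a R. ((\<lambda>\<alpha>. monomial_at (x - a) \<alpha> *\<^sub>R c n \<alpha>) has_sum F x ^ n) multi_indices)"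
    by (rule exE)
  from choice[OF this] obtain S where "\<forall>n. S n \<le> s ^ n \<and> ((\<lambda>\<alpha>. norm (c n \<alpha>) * R ^ mdegree \<alpha>) has_sum S n) multi_indices \<and>
     (\<forall>x\<in>ball a R. ((\<lambda>\<alpha>. monomial_at (x - a) \<alpha> *\<^sub>R c n \<alpha>) has_sum F x ^ n) multi_indices)"
    by (rule exE)
  then have cS: "\<And>n. S n \<le> s ^ n" "\<And>n. ((\<lambda>\<alpha>. norm (c n \<alpha>) * R ^ mdegree \<alpha>) has_sum S n) multi_indices"
     "\<And>n x. x \<in> ball a R \<Longrightarrow> ((\<lambda>\<alpha>. monomial_at (x - a) \<alpha> *\<^sub>R c n \<alpha>) has_sum F x ^ n) multi_indices"
    by blast+
  have S0: "0 \<le> S n" for n using cS(2) by (rule has_sum_nonneg) (use R in auto)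
  let ?c = "\<lambda>(n,\<alpha>). d n * c n \<alpha>"
  have "(\<lambda>p. norm (?c p) * R ^ mdegree (snd p)) summable_on UNIV \<times> multi_indices"
  proof (rule summable_on_SigmaI)
    fix n
    show "((\<lambda>\<alpha>. norm (?c (n, \<alpha>)) * R ^ mdegree (snd (n, \<alpha>))) has_sum norm (d n) * S n) multi_indices"
      using has_sum_cmult_right[OF cS(2)[of n], of "norm (d n)"] by (simp add: norm_mult mult_ac)
  next
    have "summable (\<lambda>n. norm (norm (d n) * S n))"
      by (rule summable_comparison_test'[OF sd, of 0]) (use cS(1) S0 in \<open>auto simp: abs_mult intro!: mult_left_mono\<close>)
    then show "(\<lambda>n. norm (d n) * S n) summable_on UNIV" by (rule norm_summable_imp_summable_on)
  qed (use R in auto)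
  then obtain S' where S': "((\<lambda>p. norm (?c p) * R ^ mdegree (snd p)) has_sum S') (UNIV \<times> multi_indices)"
    by (auto simp: summable_on_def)
  have "majorized_at a R S' (\<lambda>x. h (f x))"
  proof (rule majorized_atI[OF R _ S' order_refl])
    fix x assume x: "x \<in> ball a R"
    have "(\<lambda>p. norm (monomial_at (x - a) (snd p) *\<^sub>R ?c p)) summable_on UNIV \<times> multi_indices"
      by (rule abs_summable_comparison[OF has_sum_imp_summable[OF S']])
         (rule norm_monomial_scaleR_le[OF x])
    then have "(\<lambda>p. monomial_at (x - a) (snd p) *\<^sub>R ?c p) summable_on UNIV \<times> multi_indices"
      by (rule abs_summable_summable)
    then obtain u where u: "((\<lambda>p. monomial_at (x - a) (snd p) *\<^sub>R ?c p) has_sum u) (UNIV \<times> multi_indices)"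
      by (auto simp: summable_on_def)
    have "((\<lambda>n. d n * F x ^ n) has_sum u) UNIV"
      using u
    proof (rule has_sum_SigmaD)
      fix n
      show "((\<lambda>\<alpha>. monomial_at (x - a) (snd (n, \<alpha>)) *\<^sub>R ?c (n, \<alpha>)) has_sum d n * F x ^ n) multi_indices"
        using has_sum_cmult_right[OF cS(3)[OF x, of n], of "d n"] by simp
    qed
    then have "(\<lambda>n. d n * F x ^ n) sums u" by (rule has_sum_imp_sums)
    moreover have "norm (F x) \<le> s" by (rule majorized_at_norm_le[OF F x])
    then have "f x \<in> ball (f a) \<rho>" using s by (simp add: F_def dist_norm norm_minus_commute)
    then have "(\<lambda>n. d n * F x ^ n) sums h (f x)" using hd by (simp add: F_def)
    ultimately have "u = h (f x)" using sums_unique2 by blast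
    with u show "((\<lambda>p. monomial_at (x - a) (snd p) *\<^sub>R ?c p) has_sum h (f x)) (UNIV \<times> multi_indices)" by simp
  qed auto
  then show ?thesis by blast
qed

section \<open>Closure properties of complex-valued real analytic germs\<close>

definition analytic_germ :: "('a::euclidean_space \<Rightarrow> complex) \<Rightarrow> 'a \<Rightarrow> bool" where
  "analytic_germ f a \<longleftrightarrow> (\<exists>r M. majorized_at a r M f)"

lemma analytic_germ_const [intro]: "analytic_germ (\<lambda>_. k) a"
  unfolding analytic_germ_def using majorized_at_const[of 1] by fastforce

lemma analytic_germ_coord: "b \<in> Basis \<Longrightarrow> analytic_germ (\<lambda>x. of_real (x \<bullet> b)) a"
  unfolding analytic_germ_def using majorized_at_coord[of b 1] by fastforce

lemma analytic_germ_common: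
  assumes "analytic_germ f a" "analytic_germ h a"
  obtains r M N where "majorized_at a r M f" "majorized_at a r N h"
proof -
  obtain r1 M r2 N where 1: "majorized_at a r1 M f" "majorized_at a r2 N h"
    using assms unfolding analytic_germ_def by blast
  note pos = majorized_at_pos[OF 1(1)] majorized_at_pos[OF 1(2)]
  show thesis
    by (rule that[of "min r1 r2" M N]; rule majorized_at_subradius, rule 1) (use pos in auto)
qed

lemma analytic_germ_add [intro]: "analytic_germ f a \<Longrightarrow> analytic_germ h a \<Longrightarrow> analytic_germ (\<lambda>x. f x + h x) a"
  by (erule (1) analytic_germ_common) (auto simp: analytic_germ_def intro: majorized_at_add)

lemma analytic_germ_mult [intro]: "analytic_germ f a \<Longrightarrow> analytic_germ h a \<Longrightarrow> analytic_germ (\<lambda>x. f x * h x) a"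
  by (erule (1) analytic_germ_common) (auto simp: analytic_germ_def intro: majorized_at_mult)

lemma analytic_germ_cnj [intro]: "analytic_germ f a \<Longrightarrow> analytic_germ (\<lambda>x. cnj (f x)) a"
  by (auto simp: analytic_germ_def intro: majorized_at_cnj)

lemma analytic_germ_compose:
  "analytic_germ f a \<Longrightarrow> h holomorphic_on U \<Longrightarrow> open U \<Longrightarrow> f a \<in> U \<Longrightarrow> analytic_germ (\<lambda>x. h (f x)) a"
  unfolding analytic_germ_def using majorized_at_holomorphic_compose by blast

lemma analytic_germ_uminus [intro]: "analytic_germ f a \<Longrightarrow> analytic_germ (\<lambda>x. - f x) a"
  using analytic_germ_mult[OF analytic_germ_const[of "-1"]] by fastforce

lemma analytic_germ_diff [intro]: "analytic_germ f a \<Longrightarrow> analytic_germ h a \<Longrightarrow> analytic_germ (\<lambda>x. f x - h x) a"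
  using analytic_germ_add[OF _ analytic_germ_uminus, of f a h] by simp

lemma analytic_germ_power [intro]: "analytic_germ f a \<Longrightarrow> analytic_germ (\<lambda>x. f x ^ n) a"
  by (auto simp: analytic_germ_def intro: majorized_at_power)

lemma analytic_germ_divide [intro]:
  assumes "analytic_germ f a" "analytic_germ h a" "h a \<noteq> 0"
  shows "analytic_germ (\<lambda>x. f x / h x) a"
proof -
  have "analytic_germ (\<lambda>x. inverse (h x)) a"
    by (rule analytic_germ_compose[OF assms(2), where U = "- {0}"])
       (use assms in \<open>auto intro!: holomorphic_intros\<close>)
  then show ?thesis unfolding divide_inverse by (intro analytic_germ_mult assms)
qed

lemmas analytic_germ_intros = analytic_germ_const analytic_germ_add analytic_germ_diff
  analytic_germ_mult analytic_germ_power analytic_germ_divide analytic_germ_cnj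

text \<open>Provides neighbourhoods on which values of a germ remain in the domain of a branch or of
  a local inverse, where the defining identities hold.\<close>

lemma analytic_germ_isCont:
  assumes "analytic_germ f a"
  shows "isCont f a"
  unfolding continuous_at_eps_delta
proof (intro allI impI)
  fix e :: real assume e: "e > 0"
  obtain r M where f: "majorized_at a r M f" using assms by (auto simp: analytic_germ_def)
  have r: "r > 0" by (rule majorized_at_pos[OF f])
  have M: "0 \<le> M" using majorized_at_norm_le[OF f, of a] r norm_ge_zero[of "f a"] by (metis centre_in_ball order_trans)
  define t where "t = min 1 (e / (2 * (M + 1)))"
  have t: "0 < t" "t \<le> 1" using e M by (auto simp: t_def)
  have "t * M \<le> e / (2 * (M + 1)) * M" using M by (intro mult_right_mono) (auto simp: t_def)
  also have "\<dots> < e" using M e by (simp add: field_simps) (smt (verit) mult_nonneg_nonneg)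
  finally have "t * M < e" .
  then show "\<exists>d>0. \<forall>x. dist x a < d \<longrightarrow> dist (f x) (f a) < e"
    using majorized_at_norm_le[OF majorized_at_shrink[OF f t]] t r
    by (intro exI[of _ "t * r"]) (force simp: dist_norm norm_minus_commute)
qed

text \<open>The linear map L transfers complex germs to the codomain at hand: the real part serves
  for \<open>B1\<close> and \<open>B2\<close>, the identity for \<open>B3\<close>.\<close>

lemma real_analytic_onI:
  fixes f :: "'a::euclidean_space \<Rightarrow> 'b::real_normed_vector"
  assumes L: "bounded_linear L"
    and f: "\<And>a. a \<in> S \<Longrightarrow> \<exists>h. analytic_germ h a \<and> (\<forall>\<^sub>F x in nhds a. f x = L (h x))"
  shows "real_analytic_on f S"
  unfolding real_analytic_on_def
proof
  fix a assume "a \<in> S"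
  then obtain h r M where h: "majorized_at a r M h" "\<forall>\<^sub>F x in nhds a. f x = L (h x)"
    using f unfolding analytic_germ_def by blast
  obtain e where e: "e > 0" "\<And>x. dist x a < e \<Longrightarrow> f x = L (h x)"
    using h(2) unfolding eventually_nhds_metric by blast
  have r: "r > 0" by (rule majorized_at_pos[OF h(1)])
  obtain c where c: "\<And>x. x \<in> ball a r \<Longrightarrow> ((\<lambda>\<alpha>. monomial_at (x - a) \<alpha> *\<^sub>R c \<alpha>) has_sum h x) multi_indices"
    using h(1) unfolding majorized_at_def by blast
  have "((\<lambda>\<alpha>. (\<Prod>b\<in>Basis. ((x - a) \<bullet> b) ^ \<alpha> b) *\<^sub>R L (c \<alpha>)) has_sum f x) multi_indices"
    if "x \<in> ball a (min e r)" for x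
    using has_sum_bounded_linear[OF L c[of x]] that e(2)[of x] linear_scale[OF bounded_linear.linear[OF L]]
    by (simp add: o_def monomial_at_def dist_commute)
  then show "\<exists>r>0. \<exists>c. \<forall>x\<in>ball a r. ((\<lambda>\<alpha>. (\<Prod>b\<in>Basis. ((x - a) \<bullet> b) ^ \<alpha> b) *\<^sub>R c \<alpha>) has_sum f x) multi_indices"
    using e(1) r by (intro exI[of _ "min e r"] conjI exI[of _ "\<lambda>\<alpha>. L (c \<alpha>)"]) auto
qed

section \<open>Construction and uniqueness\<close>

lemma analytic_germ_sum: "finite I \<Longrightarrow> (\<And>i. i \<in> I \<Longrightarrow> analytic_germ (f i) a) \<Longrightarrow> analytic_germ (\<lambda>x. \<Sum>i\<in>I. f i x) a"
  by (induction I rule: finite_induct) auto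

lemma analytic_germ_linear:
  assumes "linear f"
  shows "analytic_germ f a"
proof -
  have "f x = (\<Sum>b\<in>Basis. of_real (x \<bullet> b) * f b)" for x
  proof -
    have "f x = f (\<Sum>b\<in>Basis. (x \<bullet> b) *\<^sub>R b)" by (simp add: euclidean_representation)
    also have "\<dots> = (\<Sum>b\<in>Basis. f ((x \<bullet> b) *\<^sub>R b))" by (rule linear_sum[OF assms])
    also have "\<dots> = (\<Sum>b\<in>Basis. of_real (x \<bullet> b) * f b)"
      by (simp add: linear_scale[OF assms] scaleR_conv_of_real)
    finally show ?thesis .
  qed
  then have eq: "f = (\<lambda>x. \<Sum>b\<in>Basis. of_real (x \<bullet> b) * f b)" by (rule ext)
  show ?thesis
    by (subst eq) (intro analytic_germ_sum analytic_germ_mult analytic_germ_coord analytic_germ_const; simp)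
qed

lemma eventually_germ_in_open:
  "analytic_germ f a \<Longrightarrow> open U \<Longrightarrow> f a \<in> U \<Longrightarrow> \<forall>\<^sub>F x in nhds a. f x \<in> U"
  using analytic_germ_isCont[of f a] unfolding isCont_def tendsto_at_iff_tendsto_nhds
  by (rule topological_tendstoD)

text \<open>Dividing \<open>Q\<close> by the appropriate power of a local \<open>p\<close>-th root of \<open>P\<close> reduces the inversion of
  \<open>(z, m) \<mapsto> (P z m\<^sup>p, Q z m\<^sup>e)\<close> to that of a single injective holomorphic function of \<open>z\<close>.\<close>

lemma local_section:
  fixes u v :: "'a::euclidean_space \<Rightarrow> complex"
  assumes hol: "P holomorphic_on D" "Q holomorphic_on D" "open D" "z0 \<in> D"
    and P0: "P z0 \<noteq> 0" and p: "p > 0" and m0: "m0 \<noteq> 0" and \<epsilon>: "\<epsilon> > 0"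
    and rigid: "\<And>z w l. z \<in> ball z0 \<epsilon> \<Longrightarrow> w \<in> ball z0 \<epsilon> \<Longrightarrow> norm (l - 1) < \<epsilon> \<Longrightarrow>
      P w = l ^ p * P z \<Longrightarrow> Q w = l ^ e * Q z \<Longrightarrow> z = w"
    and uv: "analytic_germ u a" "analytic_germ v a" "u a = P z0 * m0 ^ p" "v a = Q z0 * m0 ^ e"
  obtains Z M where "analytic_germ Z a" "analytic_germ M a" "Z a = z0" "M a = m0"
    "\<forall>\<^sub>F x in nhds a. u x = P (Z x) * M x ^ p \<and> v x = Q (Z x) * M x ^ e"
proof -
  \<comment> \<open>The principal p-th root, holomorphic on the right half-plane and equal to 1 at
    1.\<close>
  define H where "H c = exp (Ln c / of_nat p)" for c :: complex
  have holH: "H holomorphic_on {c. Re c > 0}" unfolding H_def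
    by (intro holomorphic_intros) (use p in \<open>auto simp: complex_nonpos_Reals_iff\<close>)
  have H: "H c ^ p = c" if "Re c > 0" for c
  proof -
    have "c \<noteq> 0" using that by auto
    then show ?thesis using p by (simp add: H_def flip: exp_of_nat_mult)
  qed
  have [simp]: "H 1 = 1" by (simp add: H_def)
  have opRe: "open {c. Re c > 0}" by (rule open_halfspace_Re_gt)
  define G where "G z = H (P z / P z0)" for z
  define E where "E = {z \<in> D. P z / P z0 \<in> {c. Re c > 0}}"
  have "continuous_on D (\<lambda>z. P z / P z0)"
    using holomorphic_on_imp_continuous_on[OF hol(1)] P0 by (intro continuous_intros) auto
  moreover have "E = D \<inter> (\<lambda>z. P z / P z0) -` {c. Re c > 0}" by (auto simp: E_def)
  ultimately have "open E" using continuous_open_preimage[OF _ hol(3) opRe] by simp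
  have "z0 \<in> E" using hol P0 by (simp add: E_def)
  have "(H \<circ> (\<lambda>z. P z / P z0)) holomorphic_on E"
    by (rule holomorphic_on_compose_gen[OF _ holH])
       (use hol P0 in \<open>auto simp: E_def intro!: holomorphic_intros intro: holomorphic_on_subset\<close>)
  then have holG: "G holomorphic_on E" by (simp add: G_def[abs_def] o_def)
  have Gp: "G z ^ p = P z / P z0" if "z \<in> E" for z using that H by (simp add: E_def G_def)
  have G0: "G z \<noteq> 0" for z by (simp add: G_def H_def)
  have Gz0: "G z0 = 1" using P0 by (simp add: G_def)
  \<comment> \<open>The bound 1/2 keeps the modulus of G at least 1/2, and \<epsilon>/8 then places
    G w / G z within \<epsilon> of 1, as \<open>rigid\<close> requires.\<close>
  define \<eta> where "\<eta> = min (1 / 2) (\<epsilon> / 8)"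
  have \<eta>: "\<eta> > 0" using \<epsilon> by (simp add: \<eta>_def)
  have "open (E \<inter> G -` ball 1 \<eta>)"
    by (rule continuous_open_preimage[OF holomorphic_on_imp_continuous_on[OF holG] \<open>open E\<close>]) simp
  then obtain d where d: "d > 0" "ball z0 d \<subseteq> E \<inter> G -` ball 1 \<eta>"
    using open_contains_ball_eq[of "E \<inter> G -` ball 1 \<eta>" z0] \<open>z0 \<in> E\<close> Gz0 \<eta> that
    by (metis IntI centre_in_ball vimageI)
  define B where "B = ball z0 (min d \<epsilon>)"
  have B: "B \<subseteq> E" "\<And>z. z \<in> B \<Longrightarrow> norm (G z - 1) < \<eta>" "B \<subseteq> ball z0 \<epsilon>" "z0 \<in> B" "open B"
    using d \<epsilon> by (auto simp: B_def subset_iff dist_norm norm_minus_commute)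
  \<comment> \<open>Rescaling by l multiplies Q by l^e and G by l up to the choice of root, so the
    quotient has weight zero. Equal values at z and w give the hypotheses of \<open>rigid\<close>
    with l = G w / G z.\<close>
  define \<psi> where "\<psi> z = Q z / G z ^ e" for z
  have "Q holomorphic_on B" "G holomorphic_on B"
    using hol(2) holG B(1) by (auto intro: holomorphic_on_subset simp: E_def)
  then have hol\<psi>: "\<psi> holomorphic_on B"
    unfolding \<psi>_def using G0 by (intro holomorphic_intros) auto
  have inj: "inj_on \<psi> B"
  proof (rule inj_onI)
    fix z w assume zw: "z \<in> B" "w \<in> B" "\<psi> z = \<psi> w"
    define l where "l = G w / G z"
    have "1 / 2 \<le> norm (G z)"
      using B(2)[OF zw(1)] norm_triangle_ineq2[of 1 "1 - G z"] by (simp add: \<eta>_def norm_minus_commute)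
    have "norm (G w - G z) < \<eta> + \<eta>"
      using B(2)[OF zw(1)] B(2)[OF zw(2)] norm_triangle_ineq4[of "G w - 1" "G z - 1"] by simp
    also have "\<dots> \<le> (1 / 2) * \<epsilon>" using \<epsilon> by (simp add: \<eta>_def)
    also have "\<dots> \<le> norm (G z) * \<epsilon>" using \<open>1 / 2 \<le> norm (G z)\<close> \<epsilon> by (intro mult_right_mono) auto
    finally have "norm ((G w - G z) / G z) < \<epsilon>" using G0[of z] by (simp add: norm_divide field_simps)
    then have l1: "norm (l - 1) < \<epsilon>" using G0[of z] by (simp add: l_def diff_divide_distrib)
    have "P z / P z0 \<noteq> 0" using Gp[of z] G0[of z] zw B(1) by (metis power_not_zero subset_iff)
    then have "P w = l ^ p * P z"
      using Gp[of z] Gp[of w] zw B(1) P0 by (auto simp: l_def power_divide subset_iff)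
    moreover have "Q w = l ^ e * Q z"
      using zw(3) G0 by (simp add: l_def \<psi>_def power_divide field_simps)
    ultimately show "z = w" using rigid[OF _ _ l1] zw B(3) by blast
  qed
  obtain k where k: "k holomorphic_on \<psi> ` B" "\<And>z. z \<in> B \<Longrightarrow> k (\<psi> z) = z"
    using holomorphic_has_inverse[OF hol\<psi> B(5) inj] by metis
  have op\<psi>: "open (\<psi> ` B)" by (rule open_mapping_thm3[OF hol\<psi> B(5) inj])
  have ua: "u a \<noteq> 0" using uv P0 m0 by simp
  define R where "R x = H (u x / u a)" for x
  have gu: "analytic_germ (\<lambda>x. u x / u a) a" using uv ua by auto
  have R: "analytic_germ R a" unfolding R_def
    by (rule analytic_germ_compose[OF gu holH opRe]) (use ua in simp)
  have Ra: "R a = 1" using ua by (simp add: R_def)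
  \<comment> \<open>From u = P m^p one expects m G(z) = m0 R, and then v = Q m^e says that \<psi>(z)
    must be v / (m0 R)^e.\<close>
  define s where "s x = v x / (m0 * R x) ^ e" for x
  have s: "analytic_germ s a" unfolding s_def using m0 Ra by (intro analytic_germ_divide analytic_germ_power analytic_germ_mult uv R analytic_germ_const) auto
  have sa: "s a = \<psi> z0" using uv(4) Ra m0 Gz0 by (simp add: s_def \<psi>_def)
  then have sa': "s a \<in> \<psi> ` B" using B(4) by simp
  define Z where "Z x = k (s x)" for x
  have Z: "analytic_germ Z a" unfolding Z_def by (rule analytic_germ_compose[OF s k(1) op\<psi> sa'])
  have Za: "Z a = z0" using k(2)[OF B(4)] sa by (simp add: Z_def)
  have GZ: "analytic_germ (\<lambda>x. G (Z x)) a"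
    by (rule analytic_germ_compose[OF Z holG \<open>open E\<close>]) (simp add: Za \<open>z0 \<in> E\<close>)
  define M where "M x = m0 * R x / G (Z x)" for x
  have M: "analytic_germ M a" unfolding M_def using G0 by (intro analytic_germ_divide analytic_germ_mult analytic_germ_const R GZ) auto
  have "\<forall>\<^sub>F x in nhds a. u x / u a \<in> {c. Re c > 0}"
    by (rule eventually_germ_in_open[OF gu opRe]) (use ua in simp)
  moreover have "\<forall>\<^sub>F x in nhds a. s x \<in> \<psi> ` B" by (rule eventually_germ_in_open[OF s op\<psi> sa'])
  ultimately have "\<forall>\<^sub>F x in nhds a. u x = P (Z x) * M x ^ p \<and> v x = Q (Z x) * M x ^ e"
  proof eventually_elim
    case (elim x)
    then have Zx: "Z x \<in> B" "\<psi> (Z x) = s x" using k(2) by (auto simp: Z_def)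
    have "P (Z x) * M x ^ p = P (Z x) * m0 ^ p * R x ^ p / G (Z x) ^ p"
      by (simp add: M_def power_mult_distrib power_divide)
    also have "R x ^ p = u x / u a" unfolding R_def using elim H by simp
    also have "G (Z x) ^ p = P (Z x) / P z0" using Gp Zx B(1) by blast
    also have "P (Z x) * m0 ^ p * (u x / u a) / (P (Z x) / P z0) = u x"
    proof -
      have "P (Z x) / P z0 \<noteq> 0" using Gp[of "Z x"] G0 Zx B(1) by (metis power_not_zero subset_iff)
      then show ?thesis using P0 m0 by (simp add: uv(3))
    qed
    finally have "u x = P (Z x) * M x ^ p" by simp
    moreover have "Q (Z x) = s x * G (Z x) ^ e" using Zx(2) G0 by (simp add: \<psi>_def field_simps)
    then have "Q (Z x) * M x ^ e = s x * (m0 * R x) ^ e"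
      using G0 by (simp add: M_def power_divide)
    then have "v x = Q (Z x) * M x ^ e"
      using m0 by (simp add: s_def R_def H_def)
    ultimately show ?case by blast
  qed
  moreover have "M a = m0" by (simp add: M_def Ra Za Gz0)
  ultimately show thesis using that Z M Za by blast
qed

text \<open>Discreteness of SL2(Z): l = c z + d close to 1 forces c = 0, since Im l = c Im z, and
  then d = 1 by integrality. What is left is w = z + b, and both points lie in a ball of diameter at
  most 1, so b = 0.\<close>

lemma G_rigid:
  assumes z0: "Im z0 > 0"
  obtains \<epsilon> where "\<epsilon> > 0" "\<And>z w l. z \<in> ball z0 \<epsilon> \<Longrightarrow> w \<in> ball z0 \<epsilon> \<Longrightarrow> norm (l - 1) < \<epsilon> \<Longrightarrow>
      G2 w = l ^ 4 * G2 z \<Longrightarrow> G3 w = l ^ 6 * G3 z \<Longrightarrow> z = w"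
proof
  define \<epsilon> where "\<epsilon> = min (1 / 2) (Im z0 / 2)"
  show "\<epsilon> > 0" using z0 by (simp add: \<epsilon>_def)
  fix z w l assume zw: "z \<in> ball z0 \<epsilon>" "w \<in> ball z0 \<epsilon>" "norm (l - 1) < \<epsilon>"
    and G: "G2 w = l ^ 4 * G2 z" "G3 w = l ^ 6 * G3 z"
  have Im: "Im z0 / 2 < Im y" if "y \<in> ball z0 \<epsilon>" for y
  proof -
    have "\<bar>Im (z0 - y)\<bar> < Im z0 / 2"
      using that abs_Im_le_cmod[of "z0 - y"] by (simp add: dist_norm \<epsilon>_def)
    then show ?thesis unfolding minus_complex.simps by linarith
  qed
  have z: "Im z > 0" and w: "Im w > 0" using Im[OF zw(1)] Im[OF zw(2)] z0 by auto
  have l: "l \<noteq> 0" using zw(3) by (auto simp: \<epsilon>_def)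
  have eqs: "G2 z * l ^ 4 = G2 w * 1 ^ 4" "G3 z * l ^ 6 = G3 w * 1 ^ 6" using G by simp_all
  obtain a b c d :: int where *: "a * d - b * c = 1" "l = (of_int c * z + of_int d) * 1"
    "(of_int c * z + of_int d) * w = of_int a * z + of_int b"
    using G_modular[OF z w l one_neq_zero eqs] by metis
  have "c = 0"
  proof (rule ccontr)
    assume "c \<noteq> 0"
    then have "1 * Im z \<le> \<bar>of_int c\<bar> * Im z" using z by (intro mult_right_mono) auto
    also have "\<dots> = \<bar>Im (l - 1)\<bar>" using z by (simp add: * abs_mult)
    also have "\<dots> < \<epsilon>" using abs_Im_le_cmod[of "l - 1"] zw(3) by linarith
    finally show False using Im[OF zw(1)] by (simp add: \<epsilon>_def)
  qed
  then have "l - 1 = of_int (d - 1)" using * by simp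
  then have "norm (l - 1) = \<bar>real_of_int (d - 1)\<bar>" by (simp only: norm_of_int)
  moreover have "\<epsilon> < 1" by (simp add: \<epsilon>_def)
  ultimately have "\<bar>real_of_int (d - 1)\<bar> < 1" using zw(3) by linarith
  then have "d = 1" by linarith
  then have wz: "w = z + of_int b" using * \<open>c = 0\<close> by simp
  then have "\<bar>real_of_int b\<bar> = dist z w" by (simp add: dist_norm)
  also have "\<dots> < 1" using zw(1,2) dist_triangle[of z w z0] by (simp add: \<epsilon>_def dist_commute)
  finally have "b = 0" by linarith
  with wz show "z = w" by simp
qed

text \<open>Here m is the inverse of the scaling k. The first coordinate is absent because the shift
  k' can give it any value without moving the other two.\<close>

definition period_point :: "complex \<times> complex \<times> complex \<Rightarrow> complex \<Rightarrow> complex \<Rightarrow> bool" where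
  "period_point t z m \<longleftrightarrow> Im z > 0 \<and> m \<noteq> 0 \<and> fst (snd t) = G2 z * m ^ 4 \<and> snd (snd t) = G3 z * m ^ 6"

lemma period_point_exists:
  assumes "t \<in> T"
  obtains z m where "period_point t z m"
proof -
  have "27 * (snd (snd t))\<^sup>2 \<noteq> fst (snd t) ^ 3" using assms by (auto simp: T_def)
  then obtain z m where "Im z > 0" "m \<noteq> 0" "fst (snd t) = G2 z * m ^ 4" "snd (snd t) = G3 z * m ^ 6"
    by (rule G_surj)
  then show thesis by (intro that[of z m]) (simp add: period_point_def)
qed

lemma G_holomorphic:
  "G1 holomorphic_on {z. Im z > 0}" "G2 holomorphic_on {z. Im z > 0}" "G3 holomorphic_on {z. Im z > 0}"
  unfolding G1_def G2_def G3_def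
  by (intro holomorphic_intros E2_nome_holomorphic E4_nome_holomorphic E6_nome_holomorphic; simp)+

lemma period_point_section:
  assumes t0: "t0 \<in> T"
  obtains Z M where "analytic_germ Z t0" "analytic_germ M t0" "Im (Z t0) > 0" "M t0 \<noteq> 0"
    "\<forall>\<^sub>F t in nhds t0. period_point t (Z t) (M t)"
proof -
  obtain z0 m0 where p0: "Im z0 > 0" "m0 \<noteq> 0" "fst (snd t0) = G2 z0 * m0 ^ 4" "snd (snd t0) = G3 z0 * m0 ^ 6"
    using period_point_exists[OF t0] unfolding period_point_def by metis
  obtain \<epsilon> where \<epsilon>: "\<epsilon> > 0" "\<And>z w l. z \<in> ball z0 \<epsilon> \<Longrightarrow> w \<in> ball z0 \<epsilon> \<Longrightarrow> norm (l - 1) < \<epsilon> \<Longrightarrow>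
      G2 w = l ^ 4 * G2 z \<Longrightarrow> G3 w = l ^ 6 * G3 z \<Longrightarrow> z = w"
    using G_rigid[OF p0(1)] by metis
  have op: "open {z. Im z > 0}" by (rule open_halfspace_Im_gt)
  have lin: "linear (\<lambda>t :: complex \<times> complex \<times> complex. fst (snd t))" "linear (\<lambda>t :: complex \<times> complex \<times> complex. snd (snd t))"
    by (auto intro!: linearI)
  note germs = analytic_germ_linear[OF lin(1)] analytic_germ_linear[OF lin(2)]
  have "\<exists>Z M. analytic_germ Z t0 \<and> analytic_germ M t0 \<and> Z t0 = z0 \<and> M t0 = m0 \<and>
    (\<forall>\<^sub>F t in nhds t0. fst (snd t) = G2 (Z t) * M t ^ 4 \<and> snd (snd t) = G3 (Z t) * M t ^ 6)"
  proof (cases "G2 z0 = 0")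
    case False
    obtain Z M where "analytic_germ Z t0" "analytic_germ M t0" "Z t0 = z0" "M t0 = m0"
      "\<forall>\<^sub>F t in nhds t0. fst (snd t) = G2 (Z t) * M t ^ 4 \<and> snd (snd t) = G3 (Z t) * M t ^ 6"
      by (rule local_section[OF G_holomorphic(2,3) op _ False _ p0(2) \<epsilon>(1) \<epsilon>(2) germs p0(3,4)]) (use p0(1) in auto)
    then show ?thesis by blast
  next
    case True
    then have 3: "G3 z0 \<noteq> 0" using G2_or_G3_nonzero[OF p0(1)] by simp
    have \<epsilon>': "z = w" if "z \<in> ball z0 \<epsilon>" "w \<in> ball z0 \<epsilon>" "norm (l - 1) < \<epsilon>"
      "G3 w = l ^ 6 * G3 z" "G2 w = l ^ 4 * G2 z" for z w l
      using \<epsilon>(2) that by blast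
    obtain Z M where "analytic_germ Z t0" "analytic_germ M t0" "Z t0 = z0" "M t0 = m0"
      "\<forall>\<^sub>F t in nhds t0. snd (snd t) = G3 (Z t) * M t ^ 6 \<and> fst (snd t) = G2 (Z t) * M t ^ 4"
      by (rule local_section[OF G_holomorphic(3,2) op _ 3 _ p0(2) \<epsilon>(1) \<epsilon>' germs(2,1) p0(4,3)]) (use p0(1) in auto)
    then show ?thesis by (auto simp: conj_commute)
  qed
  then obtain Z M where ZM: "analytic_germ Z t0" "analytic_germ M t0" "Z t0 = z0" "M t0 = m0"
    "\<forall>\<^sub>F t in nhds t0. fst (snd t) = G2 (Z t) * M t ^ 4 \<and> snd (snd t) = G3 (Z t) * M t ^ 6" by blast
  have "\<forall>\<^sub>F t in nhds t0. Z t \<in> {z. Im z > 0}"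
    by (rule eventually_germ_in_open[OF ZM(1) op]) (simp add: ZM p0)
  moreover have "\<forall>\<^sub>F t in nhds t0. M t \<in> - {0}"
    by (rule eventually_germ_in_open[OF ZM(2)]) (auto simp: ZM p0)
  ultimately have "\<forall>\<^sub>F t in nhds t0. period_point t (Z t) (M t)"
    using ZM(5) by eventually_elim (auto simp: period_point_def)
  then show thesis using that ZM p0 by simp
qed

text \<open>If \<open>t = (t1, t2, t3)\<close> is obtained from \<open>g z\<close> with the parameters \<open>k = 1 / m\<close> and \<open>k'\<close>, then
  \<open>k' = shift_param t z m\<close> and the functional equations force the following values at \<open>t\<close>.\<close>

definition shift_param :: "complex \<times> complex \<times> complex \<Rightarrow> complex \<Rightarrow> complex \<Rightarrow> complex" where
  "shift_param t z m = (fst t - G1 z * m\<^sup>2) / m"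

definition val1 :: "complex \<Rightarrow> complex \<Rightarrow> real" where
  "val1 z m = Im z / (norm m)\<^sup>2"

definition val2 :: "complex \<Rightarrow> complex \<Rightarrow> complex \<Rightarrow> real" where
  "val2 z m s = Im z * (norm s)\<^sup>2 + Im (s * cnj m)"

definition val3 :: "complex \<Rightarrow> complex \<Rightarrow> complex \<Rightarrow> complex" where
  "val3 z m s = cnj m / m + 2 * \<i> * cnj s * of_real (Im z) / m"

text \<open>With this, real-valued expressions become rational in the variables and their
  conjugates: identities between them turn into field arithmetic, and analyticity into closure of
  germs under \<open>cnj\<close>.\<close>

lemma of_real_Im: "of_real (Im s) = (s - cnj s) / (2 * \<i>)"
  by (simp add: complex_eq_iff)

lemma of_real_val1: "of_real (val1 z m) = of_real (Im z) / (m * cnj m)"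
  by (simp only: val1_def of_real_divide complex_norm_square)

lemma of_real_val2: "of_real (val2 z m s) = of_real (Im z) * (s * cnj s) + (s * cnj m - cnj s * m) / (2 * \<i>)"
  unfolding val2_def of_real_add of_real_mult complex_norm_square of_real_Im[of "s * cnj m"] by simp

text \<open>Changing (w, n) to (z, l n) divides Im w into Im z as the factor |l|^2, and by the
  quasi-modularity of \<open>G1\<close> turns the shift s into s / l + c n. The link between both
  effects is Im l = c Im z.\<close>

lemma vals_well_defined:
  assumes p: "period_point t z m" and q: "period_point t w n"
  shows "val1 z m = val1 w n" "val2 z m (shift_param t z m) = val2 w n (shift_param t w n)"
    "val3 z m (shift_param t z m) = val3 w n (shift_param t w n)"
proof -
  obtain a b c d :: int where *: "a * d - b * c = 1" "m = (of_int c * z + of_int d) * n"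
    "G1 w * n\<^sup>2 = G1 z * m\<^sup>2 + of_int c * m * n"
    "Im w * (norm (of_int c * z + of_int d))\<^sup>2 = Im z"
    using G_modular[of z w m n] p q unfolding period_point_def by metis
  define l where "l = of_int c * z + of_int d"
  \<comment> \<open>Capitals stand for conjugates and are treated as independent variables; the only
    relations between them that enter are \<open>yz\<close> and \<open>lL\<close>.\<close>
  define L where "L = cnj l"
  define y where "y = complex_of_real (Im w)"
  define k where "k = complex_of_int c"
  define s where "s = shift_param t w n"
  define S where "S = cnj s"
  define N where "N = cnj n"
  have n: "n \<noteq> 0" "N \<noteq> 0" and m: "m \<noteq> 0" using p q by (auto simp: period_point_def N_def)
  have ml: "m = l * n" using * by (simp add: l_def)
  then have l: "l \<noteq> 0" "L \<noteq> 0" using m by (auto simp: L_def)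
  have yz: "complex_of_real (Im z) = y * (l * L)"
    unfolding y_def L_def complex_norm_square[symmetric] of_real_mult[symmetric] l_def *(4) by (rule refl)
  have "Im l = of_int c * Im z" by (simp add: l_def)
  then have "(l - L) / (2 * \<i>) = k * (y * (l * L))"
    unfolding L_def of_real_Im[symmetric] by (simp add: yz[symmetric, unfolded L_def] k_def)
  then have lL: "l - L = 2 * \<i> * (k * (y * (l * L)))" by (simp add: field_simps)
  have sn: "s * n = fst t - G1 w * n\<^sup>2" using n by (simp add: s_def shift_param_def)
  have sz: "shift_param t z m = s / l + k * n"
  proof -
    have "fst t - G1 z * m\<^sup>2 = s * n + k * m * n" using sn *(3) by (simp add: k_def algebra_simps)
    then have "shift_param t z m = (s * n + k * m * n) / m" by (simp add: shift_param_def)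
    then show ?thesis using n l by (simp add: ml add_divide_distrib)
  qed
  have cs: "cnj (s / l + k * n) = S / L + k * N" "cnj m = L * N"
    by (simp_all add: S_def L_def N_def k_def ml)
  have d1: "L / l = 1 - 2 * \<i> * (k * y * L)" and d2: "l / L = 1 + 2 * \<i> * (k * y * l)"
  proof -
    have "L = l - 2 * \<i> * (k * (y * (l * L)))" using lL by (simp add: algebra_simps)
    then have "L = l * (1 - 2 * \<i> * (k * y * L))" by (simp add: algebra_simps)
    then show "L / l = 1 - 2 * \<i> * (k * y * L)" using l by (metis nonzero_mult_div_cancel_left)
    have "l = L + 2 * \<i> * (k * (y * (l * L)))" using lL by (simp add: algebra_simps)
    then have "l = L * (1 + 2 * \<i> * (k * y * l))" by (simp add: algebra_simps)
    then show "l / L = 1 + 2 * \<i> * (k * y * l)" using l by (metis nonzero_mult_div_cancel_left)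
  qed
  have "complex_of_real (val1 z m) = of_real (val1 w n)"
    unfolding of_real_val1 yz cs unfolding ml using l n by (simp add: y_def N_def)
  then show "val1 z m = val1 w n" by (simp only: of_real_eq_iff)
  have "complex_of_real (val2 z m (shift_param t z m)) = of_real (val2 w n s)"
  proof -
    have "complex_of_real (val2 z m (shift_param t z m)) =
        y * (l * L) * ((s / l + k * n) * (S / L + k * N)) + ((s / l + k * n) * (L * N) - (S / L + k * N) * m) / (2 * \<i>)"
      unfolding of_real_val2 sz yz cs by simp
    also have "y * (l * L) * ((s / l + k * n) * (S / L + k * N)) = y * ((s + k * n * l) * (S + k * N * L))"
      using l by (simp add: field_simps)
    also have "(s / l + k * n) * (L * N) - (S / L + k * N) * m =
        s * N * (L / l) - S * n * (l / L) - k * n * N * (l - L)"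
      by (simp add: ml algebra_simps)
    \<comment> \<open>By \<open>d1\<close>, \<open>d2\<close> and \<open>lL\<close> all terms
      containing k cancel: the cross terms of the product against those from L/l and l/L, and the
      quadratic term against the one from l - L.\<close>
    also have "y * ((s + k * n * l) * (S + k * N * L)) + (s * N * (L / l) - S * n * (l / L) - k * n * N * (l - L)) / (2 * \<i>)
        = y * (s * S) + (s * N - S * n) / (2 * \<i>)"
      unfolding d1 d2 lL by (simp add: field_simps)
    also have "\<dots> = of_real (val2 w n s)"
      unfolding of_real_val2 by (simp add: y_def S_def N_def)
    finally show ?thesis .
  qed
  then show "val2 z m (shift_param t z m) = val2 w n (shift_param t w n)" by (simp only: of_real_eq_iff s_def)
  have "val3 z m (shift_param t z m) = L * N / m + 2 * \<i> * (S / L + k * N) * (y * (l * L)) / m"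
    unfolding val3_def sz cs yz by simp
  also have "\<dots> = N / n * (L / l) + 2 * \<i> * (S + k * N * L) * y / n"
    using l n by (simp add: ml field_simps)
  also have "\<dots> = N / n + 2 * \<i> * S * y / n"
    unfolding d1 using n by (simp add: field_simps)
  finally show "val3 z m (shift_param t z m) = val3 w n (shift_param t w n)"
    by (simp add: val3_def S_def N_def y_def s_def)
qed

section \<open>The three functions, their equations and their uniqueness\<close>

definition chosen_point :: "complex \<times> complex \<times> complex \<Rightarrow> complex \<times> complex" where
  "chosen_point t = (SOME (z,m). period_point t z m)"

definition B1 :: "complex \<times> complex \<times> complex \<Rightarrow> real" where
  "B1 t = (case chosen_point t of (z,m) \<Rightarrow> val1 z m)"

definition B2 :: "complex \<times> complex \<times> complex \<Rightarrow> real" where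
  "B2 t = (case chosen_point t of (z,m) \<Rightarrow> val2 z m (shift_param t z m))"

definition B3 :: "complex \<times> complex \<times> complex \<Rightarrow> complex" where
  "B3 t = (case chosen_point t of (z,m) \<Rightarrow> val3 z m (shift_param t z m))"

lemma B_eq_vals:
  assumes "period_point t z m"
  shows "B1 t = val1 z m" "B2 t = val2 z m (shift_param t z m)" "B3 t = val3 z m (shift_param t z m)"
proof -
  obtain w n where wn: "chosen_point t = (w,n)" by force
  have "case (z,m) of (z,m) \<Rightarrow> period_point t z m" using assms by simp
  then have "case chosen_point t of (z,m) \<Rightarrow> period_point t z m"
    unfolding chosen_point_def by (rule someI)
  then have "period_point t w n" by (simp add: wn)
  from vals_well_defined[OF this assms]
  show "B1 t = val1 z m" "B2 t = val2 z m (shift_param t z m)" "B3 t = val3 z m (shift_param t z m)"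
    by (simp_all add: B1_def B2_def B3_def wn)
qed

text \<open>Values do not depend on the chosen period point, so near each t the arbitrary choice may
  be replaced by the analytic section; the formulas are then rational in analytic germs and their
  conjugates.\<close>

lemma B_analytic: "real_analytic_on B1 T" "real_analytic_on B2 T" "real_analytic_on B3 T"
proof -
  have *: "\<exists>h1 h2 h3. analytic_germ h1 t \<and> analytic_germ h2 t \<and> analytic_germ h3 t \<and>
      (\<forall>\<^sub>F x in nhds t. of_real (B1 x) = h1 x \<and> of_real (B2 x) = h2 x \<and> B3 x = h3 x)" if t: "t \<in> T" for t
  proof -
    obtain Z M where ZM: "analytic_germ Z t" "analytic_germ M t" "Im (Z t) > 0" "M t \<noteq> 0"
      "\<forall>\<^sub>F t in nhds t. period_point t (Z t) (M t)"
      using period_point_section[OF t] by metis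
    define y where "y x = complex_of_real (Im (Z x))" for x
    define s where "s x = shift_param x (Z x) (M x)" for x
    have y: "analytic_germ y t" unfolding y_def of_real_Im by (intro analytic_germ_intros ZM) (use ZM in auto)
    have "analytic_germ (\<lambda>x. G1 (Z x)) t"
      by (rule analytic_germ_compose[OF ZM(1) G_holomorphic(1) open_halfspace_Im_gt]) (use ZM in simp)
    moreover have "analytic_germ fst t" by (rule analytic_germ_linear) (auto intro!: linearI)
    ultimately have s: "analytic_germ s t" unfolding s_def shift_param_def
      by (intro analytic_germ_intros ZM) (use ZM in auto)
    show ?thesis
    proof (intro exI conjI)
      show "analytic_germ (\<lambda>x. y x / (M x * cnj (M x))) t"
        by (intro analytic_germ_intros y ZM) (use ZM in auto)
      show "analytic_germ (\<lambda>x. y x * (s x * cnj (s x)) + (s x * cnj (M x) - cnj (s x) * M x) / (2 * \<i>)) t"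
        by (intro analytic_germ_intros y s ZM) (use ZM in auto)
      show "analytic_germ (\<lambda>x. cnj (M x) / M x + 2 * \<i> * cnj (s x) * y x / M x) t"
        by (intro analytic_germ_intros y s ZM)
      show "\<forall>\<^sub>F x in nhds t. of_real (B1 x) = y x / (M x * cnj (M x)) \<and>
          of_real (B2 x) = y x * (s x * cnj (s x)) + (s x * cnj (M x) - cnj (s x) * M x) / (2 * \<i>) \<and>
          B3 x = cnj (M x) / M x + 2 * \<i> * cnj (s x) * y x / M x"
        using ZM(5) by eventually_elim (simp only: B_eq_vals of_real_val1 of_real_val2 val3_def y_def s_def simp_thms)
    qed
  qed
  have real: "real_analytic_on B T"
    if "\<And>t. t \<in> T \<Longrightarrow> \<exists>h. analytic_germ h t \<and> (\<forall>\<^sub>F x in nhds t. of_real (B x) = h x)" for B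
  proof (rule real_analytic_onI[OF bounded_linear_Re])
    fix t :: "complex \<times> complex \<times> complex" assume "t \<in> T"
    from that[OF this] obtain h where "analytic_germ h t" "\<forall>\<^sub>F x in nhds t. of_real (B x) = h x" by blast
    moreover from this(2) have "\<forall>\<^sub>F x in nhds t. B x = Re (h x)"
      by (rule eventually_mono) (metis Re_complex_of_real)
    ultimately show "\<exists>h. analytic_germ h t \<and> (\<forall>\<^sub>F x in nhds t. B x = Re (h x))" by blast
  qed
  show "real_analytic_on B1 T" "real_analytic_on B2 T"
    by (rule real, drule *, auto simp: eventually_conj_iff)+
  show "real_analytic_on B3 T"
    by (rule real_analytic_onI[OF bounded_linear_ident], drule *) (auto simp: eventually_conj_iff)
qed

text \<open>Under the parameters k, k' a period point (z, m) becomes (z, m / k), and its shift s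
  becomes s / k + k' / m. Substituting this in the formulas yields each equation.\<close>

lemma B_system_B: "B_system B1 B2 B3"
  unfolding B_system_def
proof (intro conjI allI impI B_analytic)
  fix t1 t1' t2 t3 assume "(t1, t2, t3) \<in> T \<and> (t1', t2, t3) \<in> T"
  then obtain z m where p: "period_point (t1, t2, t3) z m" using period_point_exists by metis
  then have "period_point (t1', t2, t3) z m" by (simp add: period_point_def)
  with p show "B1 (t1, t2, t3) = B1 (t1', t2, t3)" using B_eq_vals(1) by simp
next
  fix z assume "0 < Im z"
  then have p: "period_point (g z) z 1" by (simp add: period_point_def g_eq)
  have s: "shift_param (g z) z 1 = 0" by (simp add: shift_param_def g_eq)
  show "B1 (g z) = Im z" "B2 (g z) = 0" "B3 (g z) = 1"
    unfolding B_eq_vals[OF p] s by (simp_all add: val1_def val2_def val3_def)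
next
  fix t1 t2 t3 k k' :: complex
  assume "(t1, t2, t3) \<in> T \<and> k \<noteq> 0"
  then obtain z m where p: "period_point (t1, t2, t3) z m" and k: "k \<noteq> 0" using period_point_exists by metis
  have m: "m \<noteq> 0" using p by (simp add: period_point_def)
  have powi: "k powi (-2) = 1 / k\<^sup>2" "k powi (-4) = 1 / k ^ 4" "k powi (-6) = 1 / k ^ 6"
    by (simp_all add: power_int_def field_simps)
  have p': "period_point (x, t2 * k powi (-4), t3 * k powi (-6)) z (m / k)" for x
    using p k by (simp add: period_point_def powi power_divide)
  have "val1 z (m / k) = val1 z m * (cmod k)\<^sup>2"
    using k by (simp add: val1_def norm_divide power_divide)
  then show "B1 (t1, t2 * k powi (-4), t3 * k powi (-6)) = B1 (t1, t2, t3) * (cmod k)\<^sup>2"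
    using B_eq_vals(1)[OF p'] B_eq_vals(1)[OF p] by simp
  define s where "s = shift_param (t1, t2, t3) z m"
  let ?t = "(t1 * k powi (-2) + k' * inverse k, t2 * k powi (-4), t3 * k powi (-6))"
  have s': "shift_param ?t z (m / k) = s / k + k' / m"
    using k m by (simp add: shift_param_def s_def powi field_simps power2_eq_square)
  define S K K' N y where "S = cnj s" and "K = cnj k" and "K' = cnj k'" and "N = cnj m" and "y = complex_of_real (Im z)"
  have nz: "K \<noteq> 0" "N \<noteq> 0" using k m by (auto simp: K_def N_def)
  have b1: "complex_of_real (B1 (t1, t2, t3)) = y / (m * N)"
    unfolding B_eq_vals(1)[OF p] of_real_val1 by (simp add: N_def y_def)
  have b2: "complex_of_real (B2 (t1, t2, t3)) = y * (s * S) + (s * N - S * m) / (2 * \<i>)"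
    unfolding B_eq_vals(2)[OF p] of_real_val2 s_def[symmetric] by (simp add: N_def y_def S_def)
  have b3: "B3 (t1, t2, t3) = N / m + 2 * \<i> * S * y / m" "cnj (N / m + 2 * \<i> * S * y / m) = m / N - 2 * \<i> * s * y / N"
    unfolding B_eq_vals(3)[OF p] val3_def s_def[symmetric] by (simp_all add: N_def y_def S_def)
  have norms: "complex_of_real ((cmod k')\<^sup>2) = k' * K'" "complex_of_real ((cmod (inverse k))\<^sup>2) = 1 / (k * K)"
    unfolding complex_norm_square by (simp_all add: K'_def K_def divide_inverse)
  have invs: "cnj (inverse k) = 1 / K" "inverse k = 1 / k"
    by (simp_all add: K_def divide_inverse)
  have "complex_of_real (B2 ?t) = y * ((s / k + k' / m) * (S / K + K' / N)) +
      ((s / k + k' / m) * (N / K) - (S / K + K' / N) * (m / k)) / (2 * \<i>)"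
    unfolding B_eq_vals(2)[OF p'] s' of_real_val2 by (simp add: S_def K_def K'_def N_def y_def)
  also have "\<dots> = y / (m * N) * (k' * K') + (y * (s * S) + (s * N - S * m) / (2 * \<i>)) * (1 / (k * K)) +
      ((N / m + 2 * \<i> * S * y / m) * k' * (1 / K) - (m / N - 2 * \<i> * s * y / N) * K' * (1 / k)) / (2 * \<i>)"
    using nz k m by (simp add: field_simps)
  also have "\<dots> = complex_of_real (B1 (t1, t2, t3) * (cmod k')\<^sup>2 + B2 (t1, t2, t3) * (cmod (inverse k))\<^sup>2 +
      Im (B3 (t1, t2, t3) * k' * cnj (inverse k)))"
    unfolding of_real_add of_real_mult of_real_Im[of "B3 (t1, t2, t3) * k' * cnj (inverse k)"] b1 b2 norms
    unfolding complex_cnj_mult complex_cnj_cnj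
    unfolding b3(1) invs(1) K'_def[symmetric] unfolding b3(2) invs(2) by (rule refl)
  finally show "B2 ?t = B1 (t1, t2, t3) * (cmod k')\<^sup>2 + B2 (t1, t2, t3) * (cmod (inverse k))\<^sup>2 +
      Im (B3 (t1, t2, t3) * k' * cnj (inverse k))"
    by (simp only: of_real_eq_iff)
  have "B3 ?t = N / K / (m / k) + 2 * \<i> * (S / K + K' / N) * y / (m / k)"
    unfolding B_eq_vals(3)[OF p'] s' val3_def by (simp add: S_def K_def K'_def N_def y_def)
  also have "\<dots> = (N / m + 2 * \<i> * S * y / m) * k * (1 / K) + 2 * \<i> * k * K' * (y / (m * N))"
    using nz k m by (simp add: field_simps)
  also have "\<dots> = B3 (t1, t2, t3) * k * cnj (inverse k) + 2 * \<i> * k * cnj k' * of_real (B1 (t1, t2, t3))"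
    unfolding b3(1) b1 invs(1) K'_def[symmetric] by (rule refl)
  finally show "B3 ?t = B3 (t1, t2, t3) * k * cnj (inverse k) + 2 * \<i> * k * cnj k' * of_real (B1 (t1, t2, t3))" .
qed

lemma g_in_T: "Im z > 0 \<Longrightarrow> g z \<in> T"
proof -
  assume "Im z > 0"
  define a where "a = 2 * of_real pi * \<i> / (12 :: complex)"
  have "27 * G3 z ^ 2 - G2 z ^ 3 = 1728 * a ^ 6 * (E6 (nome z) ^ 2 - E4 (nome z) ^ 3)"
    unfolding G2_def G3_def a_def[symmetric] by (simp add: power_mult_distrib algebra_simps flip: power_mult)
  moreover have "a \<noteq> 0" by (simp add: a_def)
  ultimately show "g z \<in> T"
    using discriminant_nonzero[OF \<open>Im z > 0\<close>] by (auto simp: T_def g_eq)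
qed

lemma B_system_eq_vals:
  assumes C: "B_system C1 C2 C3" and t: "t \<in> T" and p: "period_point t z m"
  shows "C1 t = val1 z m" "C2 t = val2 z m (shift_param t z m)" "C3 t = val3 z m (shift_param t z m)"
proof -
  have z: "Im z > 0" and m: "m \<noteq> 0" using p by (auto simp: period_point_def)
  define s where "s = shift_param t z m"
  have t_eq: "t = (G1 z * m\<^sup>2 + s * m, G2 z * m ^ 4, G3 z * m ^ 6)"
    using p m by (cases t) (auto simp: period_point_def s_def shift_param_def)
  have powi: "inverse m powi (-2) = m\<^sup>2" "inverse m powi (-4) = m ^ 4" "inverse m powi (-6) = m ^ 6"
    by (simp_all add: power_int_def)
  have gT: "(G1 z, G2 z, G3 z) \<in> T" using g_in_T[OF z] by (simp add: g_eq)
  have inverse_nonzero: "inverse m \<noteq> 0" using m by simp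
  have C': "C1 (t1, t2 * k powi (-4), t3 * k powi (-6)) = C1 (t1, t2, t3) * (cmod k)\<^sup>2 \<and>
      C2 (t1 * k powi (-2) + k' * inverse k, t2 * k powi (-4), t3 * k powi (-6)) =
        C1 (t1, t2, t3) * (cmod k')\<^sup>2 + C2 (t1, t2, t3) * (cmod (inverse k))\<^sup>2 +
        Im (C3 (t1, t2, t3) * k' * cnj (inverse k)) \<and>
      C3 (t1 * k powi (-2) + k' * inverse k, t2 * k powi (-4), t3 * k powi (-6)) =
        C3 (t1, t2, t3) * k * cnj (inverse k) + 2 * \<i> * k * cnj k' * of_real (C1 (t1, t2, t3))"
    if "(t1, t2, t3) \<in> T" "k \<noteq> 0" for t1 t2 t3 k k'
    using C that unfolding B_system_def by blast
  have act: "C1 (G1 z, G2 z * m ^ 4, G3 z * m ^ 6) = C1 (g z) * (cmod (inverse m))\<^sup>2"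
    "C2 t = C1 (g z) * (cmod s)\<^sup>2 + C2 (g z) * (cmod m)\<^sup>2 + Im (C3 (g z) * s * cnj m)"
    "C3 t = C3 (g z) * inverse m * cnj m + 2 * \<i> * inverse m * cnj s * of_real (C1 (g z))"
    using C'[OF gT inverse_nonzero, of s] unfolding t_eq powi inverse_inverse_eq g_eq by simp_all
  have gz: "C1 (g z) = Im z" "C2 (g z) = 0" "C3 (g z) = 1" using C z by (auto simp: B_system_def)
  \<comment> \<open>The equation for C1 leaves the first coordinate unchanged, so it only reaches
    the point with first coordinate \<open>G1 z\<close>; independence of t1 passes from there to
    t.\<close>
  have "(x, G2 z * m ^ 4, G3 z * m ^ 6) \<in> T" for x using t by (simp add: t_eq T_def)
  then have "C1 t = C1 (G1 z, G2 z * m ^ 4, G3 z * m ^ 6)"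
    using C unfolding B_system_def t_eq by blast
  then show "C1 t = val1 z m" by (simp add: act gz val1_def norm_inverse power_inverse divide_inverse)
  show "C2 t = val2 z m (shift_param t z m)" by (simp add: act gz val2_def s_def)
  show "C3 t = val3 z m (shift_param t z m)" by (simp add: act gz val3_def s_def divide_inverse)
qed

text \<open>Completing the square in s: 4 Im z times \<open>val2\<close> is |cnj m + 2 i cnj s Im
  z|^2 - |m|^2. Division by |m|^2 turns this into the identity.\<close>

lemma norm_val3: "m \<noteq> 0 \<Longrightarrow> (cmod (val3 z m s))\<^sup>2 = 1 + 4 * val1 z m * val2 z m s"
proof -
  assume m: "m \<noteq> 0"
  define S N y where "S = cnj s" and "N = cnj m" and "y = complex_of_real (Im z)"
  have N: "N \<noteq> 0" using m by (simp add: N_def)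
  have "complex_of_real ((cmod (val3 z m s))\<^sup>2) = (N / m + 2 * \<i> * S * y / m) * (m / N - 2 * \<i> * s * y / N)"
    unfolding complex_norm_square val3_def by (simp add: S_def N_def y_def)
  also have "\<dots> = 1 + 4 * (y / (m * N)) * (y * (s * S) + (s * N - S * m) / (2 * \<i>))"
    using m N by (simp add: field_simps)
  also have "\<dots> = complex_of_real (1 + 4 * val1 z m * val2 z m s)"
    unfolding of_real_add of_real_mult of_real_val1 of_real_val2 by (simp add: S_def N_def y_def)
  finally show ?thesis by (simp only: of_real_eq_iff)
qed

theorem theorem2:
  "\<exists>B1 B2 B3. B_system B1 B2 B3 \<and>
     (\<forall>C1 C2 C3. B_system C1 C2 C3 \<longrightarrow>
        (\<forall>t\<in>T. C1 t = B1 t \<and> C2 t = B2 t \<and> C3 t = B3 t)) \<and>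
     (\<forall>t\<in>T. B2 t = 0 \<longrightarrow> cmod (B3 t) = 1)"
proof (intro exI conjI allI impI ballI)
  show "B_system B1 B2 B3" by (rule B_system_B)
next
  fix C1 C2 C3 t assume C: "B_system C1 C2 C3" and t: "t \<in> T"
  obtain z m where "period_point t z m" using period_point_exists[OF t] .
  then show "C1 t = B1 t" "C2 t = B2 t" "C3 t = B3 t"
    using B_system_eq_vals[OF C t] B_eq_vals by simp_all
next
  fix t assume t: "t \<in> T" and B2: "B2 t = 0"
  obtain z m where p: "period_point t z m" using period_point_exists[OF t] .
  then have "(cmod (B3 t))\<^sup>2 = 1 + 4 * B1 t * B2 t"
    unfolding B_eq_vals[OF p] by (intro norm_val3) (simp add: period_point_def)
  then show "cmod (B3 t) = 1" using B2 norm_ge_zero[of "B3 t"] power2_eq_1_iff[of "cmod (B3 t)"] by auto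
qed

end
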